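(* Let $n\geq 2$, and let $h_k$, $\zeta_m$, $Q_{m,k}$, $X_m$, $P$, $P_m$ be as defined in the context. Let $\mathscr{C}$ be the standard ternary Cantor set in $[-\frac12,\frac12]$. For each $m\ge 0$ set $\mathcal{C}_m=\zeta_m\left(\mathscr{C}\times\{(0,\dots,0,-\tfrac12)\}\right)$, where $(0,\dots,0,-\frac12)\in\mathbb{R}^{n-1}$. For all $m,k\geq 0$ let $\mathcal{C}_{m,k}\subset\partial Q_{m,k}\cap X_m$ be a uniformly perfect Cantor set such that $\operatorname{dist}(x,\mathcal{C}_{m,k})<8^{-k-m}$ for all $x\in\partial Q_{m,k}\cap X_m$. Then $$\mathcal{C}=\{P\}\cup\{P_m\}_{m\geq 0}\cup\bigcup_{m\geq 0}\mathcal{C}_m\cup\bigcup_{m,k\geq 0}\mathcal{C}_{m,k}$$ is a Cantor set. Moreover, the mapping $f:\mathcal{C}\to\mathbb{R}^n$ defined by $f(P)=P$, $f(P_m)=\zeta_m(0,\dots,0,2)$ and $f|_{\mathcal{C}_m}=\mathrm{Id}$ for $m\ge 0$, and $f|_{\mathcal{C}_{m,k}}=\zeta_m\circ h_k\circ\zeta_m^{-1}|_{\mathcal{C}_{m,k}}$ for $m,k\ge 0$, is bi-Lipschitz and admits a homeomorphic extension on $\mathbb{R}^n$ (to a homeomorphism of $\mathbb{R}^n$) but no quasisymmetric extension on $\mathbb{R}^n$.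
   Context: Construction. Fix an integer $n\ge 2$ and write $\mathbb{R}^n=\mathbb{R}^{n-1}\times\mathbb{R}$. Define $h(v,t)=(v,2-t)$ for $(v,t)\in\mathbb{R}^{n-1}\times\mathbb{R}$. Let $Q_0=[-1,1]^{n-1}\times[-1,1]$ and, for each integer $k\ge 1$, $Q_k=[-4^{-k},4^{-k}]^{n-1}\times[2^{-k},2^{1-k}]$. Set $h_0=\mathrm{Id}$ and $h_k=h|_{Q_k}$ for $k\ge 1$. Let $U=\operatorname{int}\left(Q_0\setminus\bigcup_{k\ge 1}Q_k\right)$ and $X=\partial U$. For each integer $m\ge 0$ let $\zeta_m:\mathbb{R}^n\to\mathbb{R}^n$ be a similarity that maps $[-2,2]^n$ onto $[\frac12 4^{-m},4^{-m}]\times[-4^{-m-1},4^{-m-1}]^{n-1}$. For $m,k\ge 0$ set $Q_{m,k}=\zeta_m(Q_k)$, $X_m=\zeta_m(X)$, $P_m=\zeta_m(0,\dots,0,0)$, and $P=(0,\dots,0)\in\mathbb{R}^n$. Definitions. A Cantor set is a set homeomorphic to the standard ternary Cantor set. A metric space $Y$ is uniformly perfect if there is $c>1$ such that for all $x\in Y$ and $r>0$, $\overline{B}(x,r)\neq Y$ implies $\overline{B}(x,r)\setminus B(x,r/c)\neq\emptyset$, where $B(x,r)$ and $\overline{B}(x,r)$ are the open ball $\{d(\cdot,x)<r\}$ and the closed ball $\{d(\cdot,x)\le r\}$ in $Y$. Subsets of $\mathbb{R}^n$ carry the Euclidean metric. A mapping is bi-Lipschitz if it is a homeomorphism onto its image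 and, for some $L>1$, both it and its inverse are $L$-Lipschitz. A map $g:(Y,d)\to(Z,d')$ that is a homeomorphism onto its image is quasisymmetric if there is a homeomorphism $\eta:[0,\infty)\to[0,\infty)$ such that $\frac{d'(g(x),g(a))}{d'(g(x),g(b))}\le\eta\left(\frac{d(x,a)}{d(x,b)}\right)$ for all $x,a,b\in Y$ with $x\ne b$. *)

theory Defs
  imports "HOL-Analysis.Analysis"
begin

text \<open>
  The Euclidean space of dimension n is \<open>real ^ 'n\<close> with n = CARD('n). Two coordinates play
  a distinguished role (the first one and the last one), so the index type is linearly ordered.
  A point (v, t) with t real and v of dimension n - 1 is the vector x with \<open>x $ last_ix = t\<close>
  whose remaining coordinates are those of v.
\<close>

definition first_ix :: "'n::{finite,linorder}" where
  "first_ix = Min UNIV"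

definition last_ix :: "'n::{finite,linorder}" where
  "last_ix = Max UNIV"

fun ternary_stage :: "nat \<Rightarrow> real set" where
  "ternary_stage 0 = {0..1}"
| "ternary_stage (Suc j) =
     (\<lambda>x. x / 3) ` ternary_stage j \<union> (\<lambda>x. (x + 2) / 3) ` ternary_stage j"

definition ternary_cantor :: "real set" where
  "ternary_cantor = (\<Inter>j. ternary_stage j)"

definition centered_ternary_cantor :: "real set" where
  "centered_ternary_cantor = (\<lambda>x. x - 1/2) ` ternary_cantor"

definition cantor_set :: "'a::topological_space set \<Rightarrow> bool" where
  "cantor_set S \<longleftrightarrow> S homeomorphic ternary_cantor"

definition uniformly_perfect :: "'a::metric_space set \<Rightarrow> bool" where
  "uniformly_perfect Y \<longleftrightarrow>
     (\<exists>c>1. \<forall>x\<in>Y. \<forall>r>0.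
        Y \<inter> cball x r \<noteq> Y \<longrightarrow> (Y \<inter> cball x r) - (Y \<inter> ball x (r / c)) \<noteq> {})"

definition embedding_on :: "'a::topological_space set \<Rightarrow> ('a \<Rightarrow> 'b::topological_space) \<Rightarrow> bool" where
  "embedding_on S f \<longleftrightarrow> (\<exists>g. homeomorphism S (f ` S) f g)"

definition bi_lipschitz_on :: "'a::metric_space set \<Rightarrow> ('a \<Rightarrow> 'b::metric_space) \<Rightarrow> bool" where
  "bi_lipschitz_on S f \<longleftrightarrow>
     embedding_on S f \<and>
     (\<exists>L>1. L-lipschitz_on S f \<and> L-lipschitz_on (f ` S) (inv_into S f))"

definition quasisymmetric_on :: "'a::metric_space set \<Rightarrow> ('a \<Rightarrow> 'b::metric_space) \<Rightarrow> bool" where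
  "quasisymmetric_on Y g \<longleftrightarrow>
     embedding_on Y g \<and>
     (\<exists>\<eta> \<theta> :: real \<Rightarrow> real. homeomorphism {0..} {0..} \<eta> \<theta> \<and>
        (\<forall>x\<in>Y. \<forall>a\<in>Y. \<forall>b\<in>Y. x \<noteq> b \<longrightarrow>
           dist (g x) (g a) / dist (g x) (g b) \<le> \<eta> (dist x a / dist x b)))"

definition similarity :: "('a::metric_space \<Rightarrow> 'b::metric_space) \<Rightarrow> bool" where
  "similarity z \<longleftrightarrow> (\<exists>c>0. \<forall>x y. dist (z x) (z y) = c * dist x y)"

definition flip_h :: "real ^ 'n::{finite,linorder} \<Rightarrow> real ^ 'n::{finite,linorder}" where
  "flip_h x = (\<chi> i. if i = last_ix then 2 - x $ i else x $ i)"

definition block_Q :: "nat \<Rightarrow> (real ^ 'n::{finite,linorder}) set" where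
  "block_Q k = (if k = 0 then {x. \<forall>i. x $ i \<in> {-1..1}}
          else {x. (\<forall>i. i \<noteq> last_ix \<longrightarrow> x $ i \<in> {- (1 / 4 ^ k) .. 1 / 4 ^ k}) \<and>
                   x $ last_ix \<in> {1 / 2 ^ k .. 2 / 2 ^ k}})"

definition h_piece :: "nat \<Rightarrow> real ^ 'n::{finite,linorder} \<Rightarrow> real ^ 'n::{finite,linorder}" where
  "h_piece k = (if k = 0 then id else restrict flip_h (block_Q k))"

definition domain_U :: "(real ^ 'n::{finite,linorder}) set" where
  "domain_U = interior (block_Q 0 - (\<Union>k\<in>{1..}. block_Q k))"

definition boundary_X :: "(real ^ 'n::{finite,linorder}) set" where
  "boundary_X = frontier domain_U"

definition big_cube :: "(real ^ 'n::{finite,linorder}) set" where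
  "big_cube = {x. \<forall>i. x $ i \<in> {-2..2}}"

definition target_cube :: "nat \<Rightarrow> (real ^ 'n::{finite,linorder}) set" where
  "target_cube m = {x. x $ first_ix \<in> {1/2 * (1 / 4 ^ m) .. 1 / 4 ^ m} \<and>
     (\<forall>i. i \<noteq> first_ix \<longrightarrow> x $ i \<in> {- (1 / 4 ^ (m + 1)) .. 1 / 4 ^ (m + 1)})}"

definition cantor_slice :: "(real ^ 'n::{finite,linorder}) set" where
  "cantor_slice = {x. x $ first_ix \<in> centered_ternary_cantor \<and> x $ last_ix = - (1/2) \<and>
     (\<forall>i. i \<noteq> first_ix \<and> i \<noteq> last_ix \<longrightarrow> x $ i = 0)}"

definition big_cantor ::
  "(nat \<Rightarrow> real ^ 'n::{finite,linorder} \<Rightarrow> real ^ 'n::{finite,linorder}) \<Rightarrow>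
   (nat \<Rightarrow> nat \<Rightarrow> (real ^ 'n::{finite,linorder}) set) \<Rightarrow>
   (real ^ 'n::{finite,linorder}) set" where
  "big_cantor \<zeta> K =
     {0} \<union> (\<Union>m. {\<zeta> m 0}) \<union> (\<Union>m. \<zeta> m ` cantor_slice) \<union> (\<Union>m. \<Union>k. K m k)"

text \<open>
  The prescriptions determining the values of f on \<open>big_cantor \<zeta> K\<close>; values of f elsewhere
  are irrelevant. The vector \<open>axis last_ix 2\<close> is the point (0, ..., 0, 2). The pieces \<open>K m k\<close>
  need not be disjoint, so that some f satisfies this is not automatic.
\<close>

definition cantor_map ::
  "(nat \<Rightarrow> real ^ 'n::{finite,linorder} \<Rightarrow> real ^ 'n::{finite,linorder}) \<Rightarrow>
   (nat \<Rightarrow> nat \<Rightarrow> (real ^ 'n::{finite,linorder}) set) \<Rightarrow>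
   (real ^ 'n::{finite,linorder} \<Rightarrow> real ^ 'n::{finite,linorder}) \<Rightarrow> bool" where
  "cantor_map \<zeta> K f \<longleftrightarrow>
     f 0 = 0 \<and>
     (\<forall>m. f (\<zeta> m 0) = \<zeta> m (axis last_ix 2)) \<and>
     (\<forall>m. \<forall>x\<in>\<zeta> m ` cantor_slice. f x = x) \<and>
     (\<forall>m k. \<forall>x\<in>K m k. f x = (\<zeta> m \<circ> h_piece k \<circ> inv (\<zeta> m)) x)"

end

theory Submission
  imports Defs
begin

text \<open>
  The set is compact because the pieces of one cube shrink to its centre and the cubes shrink to the
  origin. It is a countable union of compact totally disconnected sets, hence totally disconnected
  (\<open>totally_disconnected_countable_Union\<close>), and it has no isolated points; by Brouwer's
  characterisation (\<open>cantor_like_homeomorphic_sequences\<close>) it is a Cantor set. In the coordinates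
  of one cube the map fixes the points on the boundary of \<open>Q 0\<close> and on the slice, and reflects the spike formed by the
  remaining blocks in the hyperplane at height 1. Fixed points of height different from 1 stay away from the spike,
  so the map is bi-Lipschitz (\<open>dist_fixed_spike\<close>), and different cubes are far apart compared
  with their sizes.

  The homeomorphic extension uses only that the set and its image are compact, totally disconnected and covered by
  countably many hyperplanes (\<open>ambient_extension\<close>). Choose a direction w parallel to none of the
  hyperplanes. Then each piece projects injectively along w, and for a generic continuous function
  \<open>\<phi>\<close> of the projection the shear by \<open>\<phi>\<close> in the direction w gives the points of the set pairwise different
  heights in the direction w (\<open>generic_shear\<close>). A set with this property can be sheared
  onto a line. Klee's trick extends maps between compact subsets of a line to a plane containing
  it, and composing these homeomorphisms extends the given map.

  A quasisymmetric extension is impossible because the spike points into \<open>Q 0\<close> and is reflected outwards. Below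
  the tip the domain U is wide, that is, a point at distance r from the tip has distance comparable to r from
  the boundary, but near the image of the tip the region enclosed by the image of the boundary is a cusp. A
  quasisymmetric map preserves the first property, so the image of such a point lies outside that region,
  from where it can escape to infinity; but the image of U is bounded. The extension is known only on Cantor
  subsets of the boundary, yet in the coordinates of the m-th cube these are arbitrarily dense for large m and the
  argument tolerates small errors (\<open>no_model_quasisymmetry\<close>).
\<close>

section \<open>Cantor sets among compact sets\<close>

definition totally_disconnected :: "'a::topological_space set \<Rightarrow> bool" where
  "totally_disconnected S \<longleftrightarrow> (\<forall>C. C \<subseteq> S \<longrightarrow> connected C \<longrightarrow> (\<exists>a. C \<subseteq> {a}))"

definition clopen_in :: "'a::topological_space set \<Rightarrow> 'a set \<Rightarrow> bool" where
  "clopen_in S A \<longleftrightarrow> openin (top_of_set S) A \<and> closedin (top_of_set S) A"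

definition no_isolated_points :: "'a::topological_space set \<Rightarrow> bool" where
  "no_isolated_points S \<longleftrightarrow> (\<forall>x\<in>S. x islimpt S)"

definition cantor_like :: "'a::topological_space set \<Rightarrow> bool" where
  "cantor_like S \<longleftrightarrow> compact S \<and> S \<noteq> {} \<and> totally_disconnected S \<and> no_isolated_points S"

lemma clopen_in_subset: "clopen_in S A \<Longrightarrow> A \<subseteq> S"
  by (auto simp: clopen_in_def dest: openin_imp_subset)

lemma clopen_in_self: "clopen_in S S"
  by (simp add: clopen_in_def)

lemma clopen_in_Int: "clopen_in S A \<Longrightarrow> clopen_in S B \<Longrightarrow> clopen_in S (A \<inter> B)"
  by (auto simp: clopen_in_def)

lemma clopen_in_Diff: "clopen_in S A \<Longrightarrow> clopen_in S B \<Longrightarrow> clopen_in S (A - B)"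
  unfolding clopen_in_def by (meson openin_diff closedin_diff)

lemma continuous_on_locally_constant:
  assumes "\<And>x. x \<in> S \<Longrightarrow> \<exists>A. openin (top_of_set S) A \<and> x \<in> A \<and> (\<forall>y\<in>A. f y = f x)"
  shows "continuous_on S f"
  unfolding continuous_on_topological
proof (intro ballI allI impI)
  fix x B assume "x \<in> S" "open B" "f x \<in> B"
  then obtain A where A: "openin (top_of_set S) A" "x \<in> A" "\<forall>y\<in>A. f y = f x"
    using assms by blast
  then obtain T where "open T" "A = S \<inter> T" by (auto simp: openin_open)
  then show "\<exists>A. open A \<and> x \<in> A \<and> (\<forall>y\<in>S. y \<in> A \<longrightarrow> f y \<in> B)"
    using A(2,3) \<open>f x \<in> B\<close> by (metis IntI IntD2)
qed

text \<open>Compactness enters through the Sura-Bura theorem: components are intersections of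
  clopen sets, so trivial components give a base of clopen sets.\<close>
lemma clopen_neighbourhood:
  fixes S :: "'a::euclidean_space set"
  assumes "compact S" "totally_disconnected S" "x \<in> S" "open U" "x \<in> U"
  obtains A where "clopen_in S A" "x \<in> A" "A \<subseteq> U"
proof -
  have "connected_component_set S x = {x}"
  proof -
    obtain a where "connected_component_set S x \<subseteq> {a}"
      using assms(2) unfolding totally_disconnected_def
      by (meson connected_component_subset connected_connected_component)
    moreover have "x \<in> connected_component_set S x"
      using assms(3) by (simp add: connected_component_refl)
    ultimately show ?thesis by blast
  qed
  then have "{x} \<in> components S" using assms(3) by (metis componentsI)
  moreover have "locally compact S" using assms(1) by (simp add: closed_imp_locally_compact compact_imp_closed)
  ultimately obtain A where A: "openin (top_of_set S) A" "compact A" "{x} \<subseteq> A" "A \<subseteq> U"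
    using Sura_Bura_clopen_subset[of S "{x}" U] assms(4,5) by auto
  have "closedin (top_of_set S) A"
    using A by (meson closed_subset compact_imp_closed openin_imp_subset)
  then show ?thesis using that A by (auto simp: clopen_in_def)
qed

lemma totally_disconnected_subset:
  "totally_disconnected S \<Longrightarrow> T \<subseteq> S \<Longrightarrow> totally_disconnected T"
  by (auto simp: totally_disconnected_def)

lemma totally_disconnected_homeomorphic:
  assumes "homeomorphism S T f g" "totally_disconnected S"
  shows "totally_disconnected T"
  unfolding totally_disconnected_def
proof (intro allI impI)
  fix C assume C: "C \<subseteq> T" "connected C"
  have "g ` C \<subseteq> S" using C(1) assms(1) by (auto simp: homeomorphism_def)
  moreover have "connected (g ` C)"
    using C assms(1) by (meson connected_continuous_image continuous_on_subset homeomorphism_def)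
  ultimately obtain a where "g ` C \<subseteq> {a}" using assms(2) unfolding totally_disconnected_def by blast
  moreover have "y = f (g y)" if "y \<in> C" for y using that C assms(1) by (auto simp: homeomorphism_def)
  ultimately have "C \<subseteq> {f a}" by (metis image_subset_iff singletonD singletonI subsetI)
  then show "\<exists>a. C \<subseteq> {a}" by blast
qed

lemma no_isolated_iff_openin: "no_isolated_points S \<longleftrightarrow> (\<forall>x\<in>S. \<not> openin (top_of_set S) {x})"
proof -
  have "(x islimpt S) \<longleftrightarrow> \<not> openin (top_of_set S) {x}" if "x \<in> S" for x
  proof
    assume "x islimpt S"
    show "\<not> openin (top_of_set S) {x}"
    proof
      assume "openin (top_of_set S) {x}"
      then obtain T where T: "open T" "{x} = S \<inter> T" by (auto simp: openin_open)
      then obtain y where "y \<in> S" "y \<in> T" "y \<noteq> x" using \<open>x islimpt S\<close> unfolding islimpt_def by blast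
      then show False using T by blast
    qed
  next
    assume *: "\<not> openin (top_of_set S) {x}"
    show "x islimpt S" unfolding islimpt_def
    proof (intro allI impI)
      fix T assume T: "x \<in> T" "open T"
      then have "S \<inter> T \<noteq> {x}" using * by (metis openin_open_Int)
      then show "\<exists>y\<in>S. y \<in> T \<and> y \<noteq> x" using T that by blast
    qed
  qed
  then show ?thesis by (auto simp: no_isolated_points_def)
qed

lemma no_isolated_homeomorphic:
  assumes "homeomorphism S T f g" "no_isolated_points S"
  shows "no_isolated_points T"
  unfolding no_isolated_iff_openin
proof (intro ballI notI)
  fix y assume y: "y \<in> T" "openin (top_of_set T) {y}"
  have "homeomorphism T S g f" using assms(1) homeomorphism_symD by blast
  then have "openin (top_of_set S) (g ` {y})" using y(2) homeomorphism_imp_open_map by blast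
  moreover have "g y \<in> S" using y assms(1) by (auto simp: homeomorphism_def)
  ultimately show False using assms(2) by (auto simp: no_isolated_iff_openin)
qed

lemma cantor_like_homeomorphic:
  assumes "S homeomorphic T" "cantor_like S"
  shows "cantor_like T"
  using assms homeomorphic_compactness[OF assms(1)] homeomorphic_empty
  unfolding cantor_like_def homeomorphic_def
  by (metis homeomorphism_def image_is_empty no_isolated_homeomorphic totally_disconnected_homeomorphic)

text \<open>For every pair of members of a countable base at most one clopen set separating them is kept;
  these countably many sets still separate all pairs of points.\<close>
lemma countable_separating_clopens:
  fixes S :: "'a::euclidean_space set"
  assumes "compact S" "totally_disconnected S"
  obtains D :: "nat \<Rightarrow> 'a set" where "\<And>n. clopen_in S (D n)"
    "\<And>x y. x \<in> S \<Longrightarrow> y \<in> S \<Longrightarrow> x \<noteq> y \<Longrightarrow> \<exists>n. x \<in> D n \<and> y \<notin> D n"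
proof -
  obtain \<B> :: "'a set set" where \<B>: "countable \<B>" "topological_basis \<B>"
    using ex_countable_basis by blast
  define sep where "sep p C \<longleftrightarrow> clopen_in S C \<and> S \<inter> fst p \<subseteq> C \<and> S \<inter> snd p \<inter> C = {}" for p C
  define c where "c p = (if \<exists>C. sep p C then SOME C. sep p C else {})" for p
  define D where "D n = from_nat_into (insert {} (c ` (\<B> \<times> \<B>))) n" for n
  have c: "sep p (c p)" if "sep p C" for p C
    using that unfolding c_def by (metis someI_ex)
  have cl: "clopen_in S (c p)" for p
  proof (cases "\<exists>C. sep p C")
    case True then show ?thesis using c sep_def by blast
  qed (auto simp: c_def clopen_in_def)
  have cnt: "countable (insert {} (c ` (\<B> \<times> \<B>)))" using \<B>(1) by auto
  show ?thesis
  proof (rule that)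
    fix n
    have "D n \<in> insert {} (c ` (\<B> \<times> \<B>))" unfolding D_def by (rule from_nat_into) auto
    then show "clopen_in S (D n)" using cl by (auto simp: clopen_in_def)
  next
    fix x y assume xy: "x \<in> S" "y \<in> S" "x \<noteq> y"
    obtain A where A: "clopen_in S A" "x \<in> A" "A \<subseteq> - {y}"
      using clopen_neighbourhood[OF assms xy(1), of "- {y}"] xy(3) by auto
    obtain T where T: "open T" "A = S \<inter> T" using A(1) by (auto simp: clopen_in_def openin_open)
    have "openin (top_of_set S) (S - A)" using A(1) by (simp add: clopen_in_def openin_diff)
    then obtain T' where T': "open T'" "S - A = S \<inter> T'" by (auto simp: openin_open)
    obtain B where B: "B \<in> \<B>" "x \<in> B" "B \<subseteq> T"
      using topological_basisE[OF \<B>(2) T(1)] A T by blast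
    obtain B' where B': "B' \<in> \<B>" "y \<in> B'" "B' \<subseteq> T'"
      using topological_basisE[OF \<B>(2) T'(1)] A T' xy by blast
    have "sep (B, B') A" using A B B' T T' by (auto simp: sep_def)
    then have s: "sep (B, B') (c (B, B'))" by (rule c)
    have "c (B, B') \<in> insert {} (c ` (\<B> \<times> \<B>))" using B B' by auto
    then obtain n where "D n = c (B, B')"
      unfolding D_def using from_nat_into_surj[OF cnt] by blast
    then show "\<exists>n. x \<in> D n \<and> y \<notin> D n" using s B B' xy unfolding sep_def by (intro exI[of _ n]) auto
  qed
qed

lemma cantor_like_clopen_splits:
  fixes S :: "'a::euclidean_space set"
  assumes "cantor_like S" "clopen_in S A" "A \<noteq> {}"
  shows "\<exists>B. clopen_in S B \<and> B \<noteq> {} \<and> B \<subset> A"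
proof -
  obtain x where x: "x \<in> A" using assms by blast
  obtain T where T: "open T" "A = S \<inter> T" using assms(2) by (auto simp: clopen_in_def openin_open)
  have "x islimpt S" using assms(1) x T by (auto simp: cantor_like_def no_isolated_points_def)
  then obtain y where y: "y \<in> S" "y \<in> T" "y \<noteq> x" using T x unfolding islimpt_def by blast
  obtain B where "clopen_in S B" "x \<in> B" "B \<subseteq> - {y}"
    using clopen_neighbourhood[of S x "- {y}"] assms(1) x y T by (auto simp: cantor_like_def)
  then show ?thesis using assms(2) x y T by (intro exI[of _ "A \<inter> B"]) (auto intro: clopen_in_Int)
qed

text \<open>Brouwer's characterisation. The set is cut along a binary tree of clopen sets; at level n the
  cut is made along the n-th member of a countable separating family whenever that member cuts the
  current node properly, and arbitrarily otherwise. Hence every node has two nonempty children,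
  and two points cannot share all their nodes.\<close>
lemma cantor_like_homeomorphic_sequences:
  fixes S :: "'a::euclidean_space set"
  assumes "cantor_like S"
  shows "S homeomorphic {b :: nat \<Rightarrow> real. \<forall>n. b n = 0 \<or> b n = 1}"
proof -
  have S: "compact S" "S \<noteq> {}" "totally_disconnected S" using assms by (auto simp: cantor_like_def)
  obtain D :: "nat \<Rightarrow> 'a set" where D: "\<And>n. clopen_in S (D n)"
    and sep: "\<And>x y. x \<in> S \<Longrightarrow> y \<in> S \<Longrightarrow> x \<noteq> y \<Longrightarrow> \<exists>n. x \<in> D n \<and> y \<notin> D n"
    using countable_separating_clopens[OF S(1,3)] by metis
  define cut where "cut n A = (if A \<inter> D n \<noteq> {} \<and> A - D n \<noteq> {} then A \<inter> D n
     else SOME B. clopen_in S B \<and> B \<noteq> {} \<and> B \<subset> A)" for n A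
  have cut: "clopen_in S (cut n A) \<and> cut n A \<noteq> {} \<and> cut n A \<subset> A" if "clopen_in S A" "A \<noteq> {}" for n A
  proof (cases "A \<inter> D n \<noteq> {} \<and> A - D n \<noteq> {}")
    case True then show ?thesis using that D by (auto simp: cut_def intro: clopen_in_Int)
  next
    case False
    then have "cut n A = (SOME B. clopen_in S B \<and> B \<noteq> {} \<and> B \<subset> A)" unfolding cut_def by argo
    then show ?thesis using someI_ex[OF cantor_like_clopen_splits[OF assms that]] by simp
  qed
  define node where "node b = rec_nat S (\<lambda>n A. if b n = (1::real) then cut n A else A - cut n A)"
    for b :: "nat \<Rightarrow> real"
  have node_0: "node b 0 = S" for b by (simp add: node_def)
  have node_Suc: "node b (Suc n) = (if b n = 1 then cut n (node b n) else node b n - cut n (node b n))"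
    for b n by (simp add: node_def)
  define trace where "trace x = rec_nat S (\<lambda>n A. if x \<in> cut n A then cut n A else A - cut n A)" for x
  define code where "code x n = (if x \<in> cut n (trace x n) then 1 else 0 :: real)" for x n
  have trace: "trace x n = node (code x) n" for x n
    by (induction n) (simp_all add: trace_def node_def code_def)
  have code_val: "code x n = (if x \<in> cut n (node (code x) n) then 1 else 0)" for x n
    unfolding trace[symmetric] by (rule code_def)
  have node_clopen: "clopen_in S (node b n) \<and> node b n \<noteq> {}" for b n
  proof (induction n)
    case 0 then show ?case using S by (simp add: node_0 clopen_in_self)
  next
    case (Suc n)
    then show ?case using cut[of "node b n" n] by (auto simp: node_Suc intro: clopen_in_Diff)
  qed
  have in_trace: "x \<in> node (code x) n" if "x \<in> S" for x n
    unfolding trace[symmetric] by (induction n) (auto simp: trace_def that)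
  have code_eq: "(\<forall>i<n. code x i = b i) \<and> node (code x) n = node b n"
    if "x \<in> node b n" "\<forall>i. b i = 0 \<or> b i = 1" for x b n
    using that(1)
  proof (induction n)
    case 0 then show ?case by (simp add: node_0)
  next
    case (Suc n)
    have "cut n (node b n) \<subset> node b n" using cut[of "node b n" n] node_clopen[of b n] by blast
    then have "x \<in> node b n" using Suc.prems unfolding node_Suc by (metis DiffD1 psubsetD)
    then have IH: "\<forall>i<n. code x i = b i" "node (code x) n = node b n" using Suc.IH by auto
    have "code x n = b n" 
    proof (cases "b n = 1")
      case True
      then have "x \<in> cut n (node b n)" using Suc.prems by (simp add: node_Suc)
      then show ?thesis using True code_val[of x n] IH(2) by presburger
    next
      case False
      then have "x \<notin> cut n (node b n)" using Suc.prems by (simp add: node_Suc)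
      then show ?thesis using False that(2) code_val[of x n] IH(2) by metis
    qed
    then show ?case using IH unfolding less_Suc_eq node_Suc by metis
  qed
  have code01: "code x n = 0 \<or> code x n = 1" for x n by (simp add: code_def)
  have cont: "continuous_on S code"
  proof (rule continuous_on_coordinatewise_then_product, rule continuous_on_locally_constant)
    fix n x assume x: "x \<in> S"
    have "code y n = code x n" if "y \<in> node (code x) (Suc n)" for y
      using code_eq[OF that] code01 by auto
    then show "\<exists>A. openin (top_of_set S) A \<and> x \<in> A \<and> (\<forall>y\<in>A. code y n = code x n)"
      using node_clopen[of "code x" "Suc n"] in_trace[OF x, of "Suc n"] unfolding clopen_in_def by blast
  qed
  have inj: "inj_on code S"
  proof (rule inj_onI, rule ccontr)
    fix x y assume xy: "x \<in> S" "y \<in> S" "code x = code y" "x \<noteq> y"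
    then obtain n where n: "x \<in> D n" "y \<notin> D n" using sep by blast
    define A where "A = node (code x) n"
    have "x \<in> A" "y \<in> A" using in_trace xy unfolding A_def by (blast, metis)
    then have "cut n A = A \<inter> D n" using n by (auto simp: cut_def)
    then have "code x n = 1" "code y n = 0"
      using \<open>x \<in> A\<close> n xy(3) code_val[of x n] code_val[of y n] unfolding A_def by simp_all
    then show False using xy(3) by simp
  qed
  have surj: "code ` S = {b. \<forall>n. b n = 0 \<or> b n = 1}"
  proof
    show "code ` S \<subseteq> {b. \<forall>n. b n = 0 \<or> b n = 1}" using code01 by auto
  next
    show "{b. \<forall>n. b n = 0 \<or> b n = 1} \<subseteq> code ` S"
    proof
      fix b :: "nat \<Rightarrow> real" assume "b \<in> {b. \<forall>n. b n = 0 \<or> b n = 1}"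
      then have b: "\<forall>n. b n = 0 \<or> b n = 1" by simp
      have dec: "node b n \<subseteq> node b m" if "m \<le> n" for m n
        using that
      proof (induction n rule: dec_induct)
        case (step n)
        have "node b (Suc n) \<subseteq> node b n" using cut[of "node b n" n] node_clopen[of b n] by (auto simp: node_Suc)
        then show ?case using step by blast
      qed simp
      have "\<Inter>(range (node b)) \<noteq> {}"
      proof (rule compact_nest)
        show "compact (node b n)" for n
          using node_clopen S(1) closedin_compact unfolding clopen_in_def by blast
      qed (use node_clopen dec in auto)
      then obtain x where x: "\<And>n. x \<in> node b n" by auto
      have "code x n = b n" for n using code_eq[OF x[of "Suc n"] b] by auto
      then have "code x = b" by auto
      moreover have "x \<in> S" using x[of 0] by (simp add: node_0)
      ultimately show "b \<in> code ` S" by blast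
    qed
  qed
  show ?thesis by (rule homeomorphic_compact[OF S(1) cont surj inj])
qed

lemma ternary_stage_closed: "closed (ternary_stage j)"
proof (induction j)
  case (Suc j)
  have "closed ((\<lambda>x. x / 3) ` ternary_stage j)"
    using closed_injective_linear_image[OF Suc, of "\<lambda>x. x / 3"] 
    by (simp add: bounded_linear.linear[OF bounded_linear_divide] inj_def) 
  moreover have "(\<lambda>x. (x + 2) / 3) ` ternary_stage j = (\<lambda>x. 2/3 + x) ` ((\<lambda>x. x / 3) ` ternary_stage j)"
    by (auto simp: image_image field_simps)
  ultimately show ?case by (simp add: closed_translation closed_Un)
qed simp

lemma ternary_stage_subset: "ternary_stage j \<subseteq> {0..1}"
  by (induction j) auto

lemma ternary_cantor_subset: "ternary_cantor \<subseteq> {0..1}"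
  using ternary_stage_subset by (auto simp: ternary_cantor_def)

lemma ternary_cantor_compact: "compact ternary_cantor"
proof -
  have "closed ternary_cantor" unfolding ternary_cantor_def by (intro closed_INT ballI ternary_stage_closed)
  moreover have "bounded ternary_cantor" using ternary_cantor_subset bounded_subset by (metis bounded_closed_interval)
  ultimately show ?thesis by (simp add: compact_eq_bounded_closed)
qed

lemma ternary_cantor_endpoints: "0 \<in> ternary_cantor" "1 \<in> ternary_cantor"
proof -
  have "0 \<in> ternary_stage j \<and> 1 \<in> ternary_stage j" for j
  proof (induction j)
    case (Suc j)
    have "0 = (0::real) / 3" "1 = ((1::real) + 2) / 3" by auto
    then show ?case using Suc by (metis UnI1 UnI2 image_eqI ternary_stage.simps(2))
  qed auto
  then show "0 \<in> ternary_cantor" "1 \<in> ternary_cantor" by (auto simp: ternary_cantor_def)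
qed

lemma ternary_cantor_shrink:
  assumes "x \<in> ternary_cantor"
  shows "x / 3 \<in> ternary_cantor" "(x + 2) / 3 \<in> ternary_cantor"
proof -
  have x: "x \<in> ternary_stage j" for j using assms by (auto simp: ternary_cantor_def)
  have "x / 3 \<in> ternary_stage j \<and> (x + 2) / 3 \<in> ternary_stage j" for j
  proof (cases j)
    case 0 then show ?thesis using x[of 0] by auto
  next
    case (Suc i) then show ?thesis using x[of i] by auto
  qed
  then show "x / 3 \<in> ternary_cantor" "(x + 2) / 3 \<in> ternary_cantor" by (auto simp: ternary_cantor_def)
qed

lemma ternary_cantor_expand:
  assumes "x \<in> ternary_cantor"
  shows "3 * x \<in> ternary_cantor \<or> 3 * x - 2 \<in> ternary_cantor"
proof (cases "x \<le> 1/2")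
  case True
  have "3 * x \<in> ternary_stage j" for j
  proof -
    have "x \<in> ternary_stage (Suc j)" using assms unfolding ternary_cantor_def by blast
    moreover have "x \<notin> (\<lambda>x. (x + 2) / 3) ` ternary_stage j"
      using True ternary_stage_subset[of j] by fastforce
    ultimately show ?thesis by auto
  qed
  then show ?thesis by (auto simp: ternary_cantor_def)
next
  case False
  have "3 * x - 2 \<in> ternary_stage j" for j
  proof -
    have "x \<in> ternary_stage (Suc j)" using assms unfolding ternary_cantor_def by blast
    moreover have "x \<notin> (\<lambda>x. x / 3) ` ternary_stage j"
      using False ternary_stage_subset[of j] by fastforce
    ultimately obtain u where "u \<in> ternary_stage j" "x = (u + 2) / 3" by auto
    moreover from this have "3 * x - 2 = u" by simp
    ultimately show ?thesis by simp
  qed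
  then show ?thesis by (auto simp: ternary_cantor_def)
qed

text \<open>An interval inside a stage avoids the middle third, so tripling it gives an interval inside the
  preceding stage.\<close>
lemma ternary_stage_interval_length:
  "x \<le> y \<Longrightarrow> {x..y} \<subseteq> ternary_stage j \<Longrightarrow> y - x \<le> 1 / 3 ^ j"
proof (induction j arbitrary: x y)
  case 0
  then have "x \<in> {0..1}" "y \<in> {0..1}" by auto
  then show ?case by auto
next
  case (Suc j)
  have half: "1/2 \<notin> ternary_stage (Suc j)" using ternary_stage_subset[of j] by fastforce
  have "y < 1/2 \<or> x > 1/2" using half Suc.prems by (meson atLeastAtMost_iff in_mono linorder_not_le)
  then show ?case
  proof
    assume y: "y < 1/2"
    have "{3 * x..3 * y} \<subseteq> ternary_stage j"
    proof
      fix z assume "z \<in> {3 * x..3 * y}"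
      then have "z / 3 \<in> {x..y}" by auto
      then have "z / 3 \<in> ternary_stage (Suc j)" using Suc.prems by blast
      moreover have "z / 3 \<notin> (\<lambda>x. (x + 2) / 3) ` ternary_stage j"
        using y \<open>z / 3 \<in> {x..y}\<close> ternary_stage_subset[of j] by fastforce
      ultimately show "z \<in> ternary_stage j" by auto
    qed
    then have "3 * y - 3 * x \<le> 1 / 3 ^ j" using Suc.IH[of "3 * x" "3 * y"] Suc.prems by simp
    then show ?thesis by (simp add: field_simps)
  next
    assume x: "x > 1/2"
    have "{3 * x - 2..3 * y - 2} \<subseteq> ternary_stage j"
    proof
      fix z assume "z \<in> {3 * x - 2..3 * y - 2}"
      then have m: "(z + 2) / 3 \<in> {x..y}" by auto
      then have "(z + 2) / 3 \<in> ternary_stage (Suc j)" using Suc.prems by blast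
      moreover have "(z + 2) / 3 \<notin> (\<lambda>x. x / 3) ` ternary_stage j"
        using x m ternary_stage_subset[of j] by fastforce
      ultimately show "z \<in> ternary_stage j" by auto
    qed
    then have "(3 * y - 2) - (3 * x - 2) \<le> 1 / 3 ^ j" using Suc.IH[of "3 * x - 2" "3 * y - 2"] Suc.prems by simp
    then show ?thesis by (simp add: field_simps)
  qed
qed

lemma ternary_cantor_totally_disconnected: "totally_disconnected ternary_cantor"
  unfolding totally_disconnected_def
proof (intro allI impI)
  fix C assume C: "C \<subseteq> ternary_cantor" "connected C"
  have eq: "x = y" if "x \<in> C" "y \<in> C" "x \<le> y" for x y
  proof (rule ccontr)
    assume "x \<noteq> y"
    then have "y - x > 0" using that by simp
    then obtain j where j: "(1/3) ^ j < y - x" using real_arch_pow_inv[of "y - x" "1/3"] by auto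
    have "{x..y} \<subseteq> ternary_stage j"
      using C that connected_contains_Icc[OF C(2)] by (auto simp: ternary_cantor_def)
    then show False using ternary_stage_interval_length[OF that(3)] j by (simp add: power_one_over not_le[symmetric])
  qed
  show "\<exists>a. C \<subseteq> {a}"
  proof (cases "C = {}")
    case False
    then obtain a where "a \<in> C" by blast
    then have "C \<subseteq> {a}" using eq by (metis linear singleton_iff subsetI)
    then show ?thesis by blast
  qed simp
qed

text \<open>Self-similarity: a neighbour of the tripled point yields a neighbour three times as close.\<close>
lemma ternary_cantor_near:
  "x \<in> ternary_cantor \<Longrightarrow> \<exists>y\<in>ternary_cantor. y \<noteq> x \<and> \<bar>y - x\<bar> \<le> 1 / 3 ^ j"
proof (induction j arbitrary: x)
  case 0
  then have "x \<in> {0..1}" using ternary_cantor_subset by auto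
  then show ?case using ternary_cantor_endpoints by (cases "x = 0") (auto intro: bexI[of _ 0] bexI[of _ 1])
next
  case (Suc j)
  from ternary_cantor_expand[OF Suc.prems] show ?case
  proof
    assume "3 * x \<in> ternary_cantor"
    then obtain y where y: "y \<in> ternary_cantor" "y \<noteq> 3 * x" "\<bar>y - 3 * x\<bar> \<le> 1 / 3 ^ j" using Suc.IH by blast
    have "\<bar>y / 3 - x\<bar> = \<bar>y - 3 * x\<bar> / 3" by (simp add: field_simps)
    then show ?thesis using y ternary_cantor_shrink(1)[OF y(1)] by (intro bexI[of _ "y / 3"]) (auto simp: field_simps)
  next
    assume "3 * x - 2 \<in> ternary_cantor"
    then obtain y where y: "y \<in> ternary_cantor" "y \<noteq> 3 * x - 2" "\<bar>y - (3 * x - 2)\<bar> \<le> 1 / 3 ^ j" using Suc.IH by blast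
    have "\<bar>(y + 2) / 3 - x\<bar> = \<bar>y - (3 * x - 2)\<bar> / 3" by (simp add: field_simps)
    then show ?thesis using y ternary_cantor_shrink(2)[OF y(1)] by (intro bexI[of _ "(y + 2) / 3"]) (auto simp: field_simps)
  qed
qed

lemma ternary_cantor_like: "cantor_like ternary_cantor"
proof -
  have "x islimpt ternary_cantor" if "x \<in> ternary_cantor" for x
    unfolding islimpt_approachable
  proof (intro allI impI)
    fix e :: real assume "e > 0"
    then obtain j where "(1/3) ^ j < e" using real_arch_pow_inv[of e "1/3"] by auto
    then show "\<exists>x'\<in>ternary_cantor. x' \<noteq> x \<and> dist x' x < e"
      using ternary_cantor_near[OF that, of j] by (auto simp: dist_real_def power_one_over)
  qed
  then show ?thesis
    using ternary_cantor_compact ternary_cantor_totally_disconnected ternary_cantor_endpoints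
    by (auto simp: cantor_like_def no_isolated_points_def)
qed

lemma cantor_set_iff_cantor_like:
  fixes S :: "'a::euclidean_space set"
  shows "cantor_set S \<longleftrightarrow> cantor_like S"
proof
  show "cantor_set S \<Longrightarrow> cantor_like S"
    unfolding cantor_set_def by (metis cantor_like_homeomorphic homeomorphic_sym ternary_cantor_like)
  assume "cantor_like S"
  then show "cantor_set S" unfolding cantor_set_def
    by (meson cantor_like_homeomorphic_sequences homeomorphic_sym homeomorphic_trans ternary_cantor_like)
qed

text \<open>Baire's theorem makes one of the pieces contain a relatively open part of a hypothetical
  nontrivial continuum; a small clopen part of that piece is then clopen in the whole continuum.\<close>
lemma totally_disconnected_countable_Union:
  fixes S :: "'a::euclidean_space set"
  assumes S: "closed S" "S = \<Union>\<A>" "countable \<A>"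
    and A: "\<And>A. A \<in> \<A> \<Longrightarrow> compact A \<and> totally_disconnected A"
  shows "totally_disconnected S"
proof -
  have main: "\<exists>a. T \<subseteq> {a}" if T: "closed T" "connected T" "T \<subseteq> S" for T
  proof (cases "T = {}")
    case False
    have "\<exists>A\<in>\<A>. \<not> T \<subseteq> closure (T - A)"
    proof (rule ccontr)
      assume "\<not> ?thesis"
      then have d: "T \<subseteq> closure (T - A)" if "A \<in> \<A>" for A using that by blast
      have "T \<subseteq> closure (\<Inter>((\<lambda>A. T - A) ` \<A>))"
      proof (rule Baire[OF T(1)])
        show "countable ((\<lambda>A. T - A) ` \<A>)" using S(3) by simp
        fix X assume "X \<in> (\<lambda>A. T - A) ` \<A>"
        then obtain A where X: "A \<in> \<A>" "X = T - A" by blast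
        have "openin (top_of_set T) (T - A)"
          using A[OF X(1)] by (simp add: Diff_eq compact_imp_closed open_Compl openin_open_Int)
        then show "openin (top_of_set T) X \<and> T \<subseteq> closure X" using d X by simp
      qed
      moreover have "\<A> \<noteq> {}" using False T(3) S(2) by auto
      then have "\<Inter>((\<lambda>A. T - A) ` \<A>) = {}" using T(3) S(2) by auto
      ultimately show False using False by simp
    qed
    then obtain A p where p: "A \<in> \<A>" "p \<in> T" "p \<notin> closure (T - A)" by blast
    define W where "W = - closure (T - A)"
    have W: "open W" "p \<in> W" using p by (auto simp: W_def)
    have TW: "T \<inter> W \<subseteq> A" using closure_subset[of "T - A"] by (auto simp: W_def)
    have "compact (T \<inter> A)" using A[OF p(1)] T(1) by (simp add: closed_Int_compact)
    moreover have "totally_disconnected (T \<inter> A)"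
      using A[OF p(1)] totally_disconnected_subset by blast
    ultimately obtain N where N: "clopen_in (T \<inter> A) N" "p \<in> N" "N \<subseteq> W"
      using clopen_neighbourhood[of "T \<inter> A" p W] W p TW by blast
    obtain O' where O': "open O'" "N = T \<inter> A \<inter> O'" using N(1) by (auto simp: clopen_in_def openin_open)
    have "N = T \<inter> (W \<inter> O')" using O' N(3) TW by blast
    then have "openin (top_of_set T) N" using W O' by (metis open_Int openin_open_Int)
    moreover have "closedin (top_of_set T) N"
    proof -
      have "compact N" using N(1) \<open>compact (T \<inter> A)\<close> closedin_compact unfolding clopen_in_def by blast
      then show ?thesis using O' by (simp add: closed_subset compact_imp_closed inf_assoc)
    qed
    ultimately have "N = T" using T(2) N(2) by (auto simp: connected_clopen)
    then have "T \<subseteq> A" using O' by blast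
    then show ?thesis using A[OF p(1)] T(2) unfolding totally_disconnected_def by blast
  qed simp
  show ?thesis unfolding totally_disconnected_def
  proof (intro allI impI)
    fix C assume C: "C \<subseteq> S" "connected C"
    then have "\<exists>a. closure C \<subseteq> {a}"
      using main[of "closure C"] S(1) by (simp add: closure_minimal connected_imp_connected_closure)
    then show "\<exists>a. C \<subseteq> {a}" using closure_subset by fastforce
  qed
qed

text \<open>This gives compactness at each of the two levels of accumulation: the pieces of one cube shrink
  to its centre, and the cubes shrink to the origin.\<close>
lemma compact_insert_shrinking_Union:
  fixes p :: "'a::metric_space"
  assumes A: "\<And>k::nat. compact (A k)"
    and shrink: "\<And>e. e > 0 \<Longrightarrow> \<exists>N. \<forall>k\<ge>N. A k \<subseteq> ball p e"
  shows "compact (insert p (\<Union>k. A k))"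
proof (rule compactI)
  fix C assume C: "\<forall>t\<in>C. open t" "insert p (\<Union>k. A k) \<subseteq> \<Union>C"
  then obtain U where U: "U \<in> C" "p \<in> U" by blast
  then obtain e where e: "e > 0" "ball p e \<subseteq> U" using C open_contains_ball by blast
  obtain N where N: "\<forall>k\<ge>N. A k \<subseteq> ball p e" using shrink[OF e(1)] by blast
  have "compact (\<Union>k<N. A k)" using A by (intro compact_UN) auto
  moreover have "(\<Union>k<N. A k) \<subseteq> \<Union>C" using C by blast
  ultimately obtain C' where C': "C' \<subseteq> C" "finite C'" "(\<Union>k<N. A k) \<subseteq> \<Union>C'"
    using C(1) by (meson compactE)
  have "x \<in> \<Union>(insert U C')" if "x \<in> insert p (\<Union>k. A k)" for x
  proof (cases "x = p")
    case False
    then obtain k where "x \<in> A k" using \<open>x \<in> insert p (\<Union>k. A k)\<close> by blast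
    then show ?thesis
    proof (cases "k < N")
      case True then show ?thesis using C'(3) \<open>x \<in> A k\<close> by blast
    next
      case False then show ?thesis using N e(2) \<open>x \<in> A k\<close> by (simp add: not_less) blast
    qed
  qed (use U in auto)
  then show "\<exists>C'\<subseteq>C. finite C' \<and> insert p (\<Union>k. A k) \<subseteq> \<Union>C'"
    using U C' by (intro exI[of _ "insert U C'"]) blast
qed

section \<open>Homeomorphic extensions by shears\<close>

text \<open>The displacement g is constant along itself, so subtracting it undoes the map.\<close>
lemma shear_homeomorphism:
  fixes g :: "'a::real_normed_vector \<Rightarrow> 'a"
  assumes "continuous_on UNIV g" "\<And>x. g (x + g x) = g x" "\<And>x. g (x - g x) = g x"
  shows "homeomorphism UNIV UNIV (\<lambda>x. x + g x) (\<lambda>x. x - g x)"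
proof -
  have "surj (\<lambda>x. x + g x)" by (rule surjI[of _ "\<lambda>x. x - g x"]) (simp add: assms)
  moreover have "surj (\<lambda>x. x - g x)" by (rule surjI[of _ "\<lambda>x. x + g x"]) (simp add: assms)
  ultimately show ?thesis
    unfolding homeomorphism_def by (auto simp: assms intro!: continuous_intros)
qed

definition extends_ambiently :: "'a::topological_space set \<Rightarrow> ('a \<Rightarrow> 'a) \<Rightarrow> bool" where
  "extends_ambiently S f \<longleftrightarrow> (\<exists>F G. homeomorphism UNIV UNIV F G \<and> (\<forall>x\<in>S. F x = f x))"

lemma ambient_compose:
  assumes "extends_ambiently S f" "extends_ambiently (f ` S) g" "\<And>x. x \<in> S \<Longrightarrow> h x = g (f x)"
  shows "extends_ambiently S h"
proof -
  obtain F F' where F: "homeomorphism UNIV UNIV F F'" "\<forall>x\<in>S. F x = f x"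
    using assms(1) by (auto simp: extends_ambiently_def)
  obtain G G' where G: "homeomorphism UNIV UNIV G G'" "\<forall>x\<in>f ` S. G x = g x"
    using assms(2) by (auto simp: extends_ambiently_def)
  have "homeomorphism UNIV UNIV (G \<circ> F) (F' \<circ> G')" by (rule homeomorphism_compose[OF F(1) G(1)])
  moreover have "\<forall>x\<in>S. (G \<circ> F) x = h x" using F G assms(3) by simp
  ultimately show ?thesis unfolding extends_ambiently_def by blast
qed

lemma ambient_inverse:
  assumes "extends_ambiently S f" "\<And>x. x \<in> S \<Longrightarrow> h (f x) = x"
  shows "extends_ambiently (f ` S) h"
proof -
  obtain F F' where F: "homeomorphism UNIV UNIV F F'" "\<forall>x\<in>S. F x = f x"
    using assms(1) by (auto simp: extends_ambiently_def)
  have "homeomorphism UNIV UNIV F' F" using F(1) by (rule homeomorphism_symD)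
  moreover have "\<forall>y\<in>f ` S. F' y = h y" using F assms(2) by (auto simp: homeomorphism_def) metis
  ultimately show ?thesis unfolding extends_ambiently_def by blast
qed

lemma ambient_shear:
  fixes g :: "'a::real_normed_vector \<Rightarrow> 'a"
  assumes "continuous_on UNIV g" "\<And>x. g (x + g x) = g x" "\<And>x. g (x - g x) = g x"
    "\<And>x. x \<in> S \<Longrightarrow> f x = x + g x"
  shows "extends_ambiently S f"
  unfolding extends_ambiently_def using shear_homeomorphism[OF assms(1-3)] assms(4) by metis

text \<open>Tietze's theorem applied to the function that \<open>h\<close> induces on the compact image of \<open>\<alpha>\<close>. In this
  form it supplies the shearing functions with prescribed values at the images of given points.\<close>
lemma extend_along_injection:
  fixes \<alpha> :: "'a::topological_space \<Rightarrow> 'b::{metric_space,second_countable_topology}"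
    and h :: "'a \<Rightarrow> 'c::real_inner"
  assumes "compact S" "continuous_on S \<alpha>" "inj_on \<alpha> S" "continuous_on S h"
    "0 \<le> B" "\<And>x. x \<in> S \<Longrightarrow> norm (h x) \<le> B"
  obtains k where "continuous_on UNIV k" "\<And>x. x \<in> S \<Longrightarrow> k (\<alpha> x) = h x" "\<And>y. norm (k y) \<le> B"
proof -
  define i where "i = inv_into S \<alpha>"
  have i: "i (\<alpha> x) = x" if "x \<in> S" for x using that assms(3) by (simp add: i_def)
  have ci: "continuous_on (\<alpha> ` S) i" by (rule continuous_on_inv) (use assms i in auto)
  have "continuous_on (\<alpha> ` S) (h \<circ> i)"
    by (rule continuous_on_compose[OF ci]) (use i assms(4) in \<open>simp add: image_image\<close>)
  moreover have "closedin (top_of_set UNIV) (\<alpha> ` S)"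
    using assms(1,2) by (simp add: compact_continuous_image compact_imp_closed)
  moreover have "norm ((h \<circ> i) y) \<le> B" if "y \<in> \<alpha> ` S" for y using that i assms(6) by auto
  ultimately obtain k where "continuous_on UNIV k" "\<And>y. y \<in> \<alpha> ` S \<Longrightarrow> k y = (h \<circ> i) y"
      "\<And>y. y \<in> UNIV \<Longrightarrow> norm (k y) \<le> B"
    using Tietze[of "\<alpha> ` S" "h \<circ> i" UNIV B] assms(5) by metis
  then show ?thesis using that[of k] i by simp
qed

lemma extend_along_injection_unbounded:
  fixes \<alpha> :: "'a::topological_space \<Rightarrow> 'b::{metric_space,second_countable_topology}"
    and h :: "'a \<Rightarrow> 'c::real_inner"
  assumes "compact S" "continuous_on S \<alpha>" "inj_on \<alpha> S" "continuous_on S h"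
  shows "\<exists>k. continuous_on UNIV k \<and> (\<forall>x\<in>S. k (\<alpha> x) = h x)"
proof -
  have "bounded (h ` S)" using assms compact_continuous_image compact_imp_bounded by blast
  then obtain B where "\<And>x. x \<in> S \<Longrightarrow> norm (h x) \<le> B" by (auto simp: bounded_iff)
  then have "0 \<le> \<bar>B\<bar>" "\<And>x. x \<in> S \<Longrightarrow> norm (h x) \<le> \<bar>B\<bar>" by force+
  then show ?thesis using extend_along_injection[OF assms] by metis
qed

text \<open>A partition into small clopen pieces carries a step function; its values can be chosen freely in
  small intervals, hence outside any finite set.\<close>
lemma locally_constant_approximation:
  fixes A :: "'a::euclidean_space set" and g :: "'a \<Rightarrow> real"
  assumes A: "compact A" "totally_disconnected A" and g: "continuous_on A g"
    and "e > 0" "finite Z"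
  obtains g' where "continuous_on A g'" "finite (g' ` A)" "g' ` A \<inter> Z = {}"
    "\<And>x. x \<in> A \<Longrightarrow> \<bar>g' x - g x\<bar> < e"
proof -
  have "\<exists>C. clopen_in A C \<and> x \<in> C \<and> (\<forall>y\<in>C. \<bar>g y - g x\<bar> < e/2)" if x: "x \<in> A" for x
  proof -
    have "openin (top_of_set A) (A \<inter> g -` ball (g x) (e/2))"
      by (rule continuous_openin_preimage_gen[OF g]) simp
    then obtain U where U: "open U" "A \<inter> g -` ball (g x) (e/2) = A \<inter> U" by (auto simp: openin_open)
    have "x \<in> A \<inter> g -` ball (g x) (e/2)" using x \<open>e > 0\<close> by simp
    then have "x \<in> U" using U by blast
    then obtain C where C: "clopen_in A C" "x \<in> C" "C \<subseteq> U" using clopen_neighbourhood A x U by metis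
    have "\<forall>y\<in>C. \<bar>g y - g x\<bar> < e/2"
    proof
      fix y assume "y \<in> C"
      then have "y \<in> A \<inter> g -` ball (g x) (e/2)" using C U clopen_in_subset by blast
      then show "\<bar>g y - g x\<bar> < e/2" by (simp add: dist_real_def abs_minus_commute)
    qed
    then show ?thesis using C by blast
  qed
  then obtain C where C: "\<And>x. x \<in> A \<Longrightarrow> clopen_in A (C x) \<and> x \<in> C x \<and> (\<forall>y\<in>C x. \<bar>g y - g x\<bar> < e/2)"
    by metis
  have "\<forall>x\<in>A. \<exists>T. open T \<and> C x = A \<inter> T" using C by (auto simp: clopen_in_def openin_open)
  then obtain T where T: "\<And>x. x \<in> A \<Longrightarrow> open (T x) \<and> C x = A \<inter> T x" by metis
  have "A \<subseteq> (\<Union>x\<in>A. T x)"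
  proof
    fix x assume "x \<in> A"
    then have "x \<in> T x" using T[of x] C[of x] by blast
    then show "x \<in> (\<Union>x\<in>A. T x)" using \<open>x \<in> A\<close> by blast
  qed
  then obtain D where D: "D \<subseteq> A" "finite D" "A \<subseteq> (\<Union>x\<in>D. T x)"
    using compactE_image[OF A(1), of A T] T by metis
  have cover: "A = (\<Union>x\<in>D. C x)"
  proof -
    have "C x = A \<inter> T x" if "x \<in> D" for x using T[of x] D(1) that by blast
    then show ?thesis using D(3) by auto
  qed
  have "\<exists>g'. continuous_on (\<Union>x\<in>D'. C x) g' \<and> finite (g' ` (\<Union>x\<in>D'. C x)) \<and> g' ` (\<Union>x\<in>D'. C x) \<inter> Z = {}
      \<and> (\<forall>x\<in>(\<Union>x\<in>D'. C x). \<bar>g' x - g x\<bar> < e)" if "finite D'" "D' \<subseteq> A" for D'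
    using that
  proof (induction D' rule: finite_induct)
    case (insert x D')
    then obtain g' where g': "continuous_on (\<Union>x\<in>D'. C x) g'" "finite (g' ` (\<Union>x\<in>D'. C x))"
      "g' ` (\<Union>x\<in>D'. C x) \<inter> Z = {}" "\<forall>x\<in>(\<Union>x\<in>D'. C x). \<bar>g' x - g x\<bar> < e" by auto
    have x: "x \<in> A" using insert by auto
    have "infinite {g x<..<g x + e/2}" using \<open>e > 0\<close> by simp
    then obtain c where c: "c \<notin> Z" "g x < c" "c < g x + e/2"
      using \<open>finite Z\<close> by (meson finite_subset greaterThanLessThan_iff subsetI)
    define V where "V = (\<Union>x\<in>D'. C x) - C x"
    define k where "k y = (if y \<in> C x then c else g' y)" for y
    have un: "(\<Union>x\<in>insert x D'. C x) = C x \<union> V" by (auto simp: V_def)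
    have clC: "closed (C y)" if "y \<in> A" for y
      using C[OF that] A(1) by (meson clopen_in_def closedin_compact compact_imp_closed)
    have clV: "closed V"
    proof -
      have eq: "V = (\<Union>y\<in>D'. C y \<inter> (A - C x))"
      proof -
        have "C y \<subseteq> A" if "y \<in> D'" for y using C[of y] clopen_in_subset[of A "C y"] that insert.prems by blast
        then show ?thesis unfolding V_def by auto
      qed
      have "clopen_in A (A - C x)" using C[OF x] clopen_in_Diff clopen_in_self by blast
      then have "closed (A - C x)" using A(1) by (meson clopen_in_def closedin_compact compact_imp_closed)
      then show ?thesis unfolding eq using insert.prems insert.hyps clC by (intro closed_UN) auto
    qed
    have "continuous_on (C x \<union> V) k"
      unfolding k_def
    proof (rule continuous_on_cases_local)
      show "closedin (top_of_set (C x \<union> V)) (C x)" "closedin (top_of_set (C x \<union> V)) V"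
        using clC[OF x] clV by (auto intro: closed_subset)
      show "continuous_on V g'" using g'(1) continuous_on_subset V_def by blast
    qed (auto simp: V_def)
    moreover have sub: "k ` (C x \<union> V) \<subseteq> insert c (g' ` (\<Union>x\<in>D'. C x))" by (auto simp: k_def V_def)
    moreover have "\<forall>y\<in>C x \<union> V. \<bar>k y - g y\<bar> < e"
    proof
      fix y assume "y \<in> C x \<union> V"
      then show "\<bar>k y - g y\<bar> < e"
      proof
        assume "y \<in> C x"
        then have "\<bar>g y - g x\<bar> < e/2" "k y = c" using C[OF x] by (auto simp: k_def)
        then show ?thesis using c by linarith
      next
        assume "y \<in> V" then show ?thesis using g'(4) by (auto simp: k_def V_def)
      qed
    qed
    moreover have "k ` (C x \<union> V) \<inter> Z = {}" using sub c(1) g'(3) by blast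
    moreover have "finite (k ` (C x \<union> V))" using finite_subset[OF sub] g'(2) by simp
    ultimately show ?case unfolding un by (intro exI[of _ k] conjI)
  qed auto
  from this[OF D(2,1)] show ?thesis using that cover by metis
qed

text \<open>Countably many hyperplanes through the origin form a null set, so almost every vector avoids all of them.\<close>
lemma generic_direction:
  fixes N :: "'a::euclidean_space set"
  assumes "countable N" "0 \<notin> N"
  obtains w where "norm w = 1" "\<And>a. a \<in> N \<Longrightarrow> a \<bullet> w \<noteq> 0"
proof -
  have "(\<Union>a\<in>N. {x. a \<bullet> x = 0}) \<in> null_sets lebesgue"
  proof (rule null_sets_UN'[OF assms(1)])
    fix a assume "a \<in> N"
    then have "a \<noteq> 0" using assms(2) by auto
    then show "{x. a \<bullet> x = 0} \<in> null_sets lebesgue"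
      using negligible_hyperplane[of a 0] by (simp add: negligible_iff_null_sets)
  qed
  then have "negligible (\<Union>a\<in>N. {x. a \<bullet> x = 0})" by (simp add: negligible_iff_null_sets)
  moreover have "\<not> negligible (- {0::'a})" by (rule open_not_negligible) (auto simp: UNIV_not_singleton Compl_eq_Diff_UNIV)
  ultimately have "\<not> - {0} \<subseteq> (\<Union>a\<in>N. {x. a \<bullet> x = 0})" using negligible_subset by blast
  then obtain v where v: "v \<noteq> 0" "\<And>a. a \<in> N \<Longrightarrow> a \<bullet> v \<noteq> 0" by auto
  show ?thesis using v by (intro that[of "v /\<^sub>R norm v"]) auto
qed

text \<open>Along a line parallel to w the shear preserves differences of heights, so only pairs with
  different projections matter. Two pieces with disjoint projections, each projecting injectively,
  can have their heights changed to finitely many distinct values by an arbitrarily small change of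
  the shearing function, and separated heights stay separated under small changes; Baire's theorem
  in the space of bounded continuous functions treats all pairs of pieces at once.\<close>
lemma generic_shear:
  fixes S :: "'a::euclidean_space set" and w :: 'a
  assumes S: "compact S" "totally_disconnected S"
    and H: "countable H" "S \<subseteq> (\<Union>(a,b)\<in>H. {x. a \<bullet> x = b})"
    and w: "norm w = 1" "\<And>h. h \<in> H \<Longrightarrow> fst h \<bullet> w \<noteq> 0"
  obtains \<phi> :: "'a \<Rightarrow> real" where "continuous_on UNIV \<phi>"
    "inj_on (\<lambda>x. x \<bullet> w + \<phi> (x - (x \<bullet> w) *\<^sub>R w)) S"
proof -
  define \<pi> where "\<pi> x = x - (x \<bullet> w) *\<^sub>R w" for x
  have cont_\<pi>: "continuous_on U \<pi>" for U unfolding \<pi>_def by (intro continuous_intros)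
  define ht where "ht \<phi> x = x \<bullet> w + apply_bcontfun \<phi> (\<pi> x)" for \<phi> :: "'a \<Rightarrow>\<^sub>C real" and x
  have cont_ht: "continuous_on U (ht \<phi>)" for U \<phi>
    unfolding ht_def
    by (intro continuous_intros continuous_on_compose2[OF continuous_on_apply_bcontfun cont_\<pi>]) auto
  define G where "G A B = {\<phi>. ht \<phi> ` A \<inter> ht \<phi> ` B = {}}" for A B
  define piece where "piece A \<longleftrightarrow> compact A \<and> totally_disconnected A \<and> inj_on \<pi> A" for A
  have open_G: "open (G A B)" if "compact A" "compact B" for A B
    unfolding open_dist
  proof
    fix \<phi> assume \<phi>: "\<phi> \<in> G A B"
    have "compact (ht \<phi> ` A)" "compact (ht \<phi> ` B)"
      using that cont_ht compact_continuous_image by blast+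
    then obtain d where d: "d > 0" "\<forall>s\<in>ht \<phi> ` A. \<forall>t\<in>ht \<phi> ` B. d \<le> dist s t"
      using separate_compact_closed[of "ht \<phi> ` A" "ht \<phi> ` B"] \<phi> by (auto simp: G_def compact_imp_closed)
    show "\<exists>e>0. \<forall>\<phi>'. dist \<phi>' \<phi> < e \<longrightarrow> \<phi>' \<in> G A B"
    proof (intro exI[of _ "d/2"] conjI allI impI)
      fix \<phi>' assume "dist \<phi>' \<phi> < d/2"
      then have *: "\<bar>ht \<phi>' x - ht \<phi> x\<bar> < d/2" for x
        using dist_bounded[of \<phi>' "\<pi> x" \<phi>] by (simp add: ht_def dist_real_def)
      have "ht \<phi>' x \<noteq> ht \<phi>' y" if "x \<in> A" "y \<in> B" for x y
      proof -
        have "d \<le> \<bar>ht \<phi> x - ht \<phi> y\<bar>" using d that by (auto simp: dist_real_def)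
        then show ?thesis using *[of x] *[of y] by argo
      qed
      then show "\<phi>' \<in> G A B" by (auto simp: G_def)
    qed (use d in auto)
  qed
  have dense_G: "\<exists>\<phi>'\<in>G A B. dist \<phi> \<phi>' < e"
    if A: "piece A" and B: "piece B" and AB: "\<pi> ` A \<inter> \<pi> ` B = {}" and e: "e > 0" for A B \<phi> e
  proof -
    obtain gA where gA: "continuous_on A gA" "finite (gA ` A)" "\<And>x. x \<in> A \<Longrightarrow> \<bar>gA x - ht \<phi> x\<bar> < e/2"
      using locally_constant_approximation[of A "ht \<phi>" "e/2" "{}"] A e cont_ht[of A \<phi>] half_gt_zero[OF e]
      unfolding piece_def by (metis finite.emptyI)
    obtain gB where gB: "continuous_on B gB" "gB ` B \<inter> gA ` A = {}" "\<And>x. x \<in> B \<Longrightarrow> \<bar>gB x - ht \<phi> x\<bar> < e/2"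
      using locally_constant_approximation[of B "ht \<phi>" "e/2" "gA ` A"] B e cont_ht[of B \<phi>] gA(2) half_gt_zero[OF e]
      unfolding piece_def by metis
    define g where "g x = (if x \<in> A then gA x else gB x)" for x
    have disj: "A \<inter> B = {}" using AB by blast
    have cg: "continuous_on (A \<union> B) g"
      unfolding g_def
    proof (rule continuous_on_cases_local)
      show "closedin (top_of_set (A \<union> B)) A" "closedin (top_of_set (A \<union> B)) B"
        using A B by (auto simp: piece_def compact_imp_closed intro: closed_subset)
    qed (use gA gB disj in auto)
    have comp: "compact (A \<union> B)" using A B by (auto simp: piece_def)
    have inj: "inj_on \<pi> (A \<union> B)" using A B AB by (auto simp: piece_def inj_on_Un)
    have near: "norm (g x - ht \<phi> x) \<le> e/2" if "x \<in> A \<union> B" for x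
      using that gA(3)[of x] gB(3)[of x] disj by (auto simp: g_def)
    have c': "continuous_on (A \<union> B) (\<lambda>x. g x - ht \<phi> x)" by (intro continuous_intros cg cont_ht)
    have e2: "0 \<le> e/2" using e by simp
    obtain k where k: "continuous_on UNIV k" "\<And>x. x \<in> A \<union> B \<Longrightarrow> k (\<pi> x) = g x - ht \<phi> x"
      "\<And>y. norm (k y) \<le> e/2"
      using extend_along_injection[OF comp cont_\<pi> inj c' e2 near] by metis
    have "(\<lambda>y. apply_bcontfun \<phi> y + k y) \<in> bcontfun"
    proof -
      have "bounded (range k)" using k(3) unfolding bounded_iff by blast
      then have "bounded (range (\<lambda>y. apply_bcontfun \<phi> y + k y))"
        by (intro bounded_plus_comp) auto
      then show ?thesis using k(1) by (auto simp: bcontfun_def intro!: continuous_intros)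
    qed
    then obtain \<phi>' where \<phi>': "(\<lambda>y. apply_bcontfun \<phi> y + k y) = apply_bcontfun \<phi>'" by (rule bcontfunE)
    have val: "apply_bcontfun \<phi>' y = apply_bcontfun \<phi> y + k y" for y using fun_cong[OF \<phi>', of y] by simp
    have "dist \<phi> \<phi>' \<le> e/2" using k(3) by (intro dist_bound) (simp add: val dist_real_def)
    moreover have "ht \<phi>' x = g x" if "x \<in> A \<union> B" for x
      using k(2)[OF that] by (simp add: ht_def val)
    then have "\<phi>' \<in> G A B" using gB(2) disj by (auto simp: G_def g_def) 
    ultimately show ?thesis using e by force
  qed
  obtain \<D> :: "'a set set" where \<D>: "countable \<D>" "topological_basis \<D>"
    using ex_countable_basis by blast
  define P where "P = (\<lambda>((a,b),D). S \<inter> {x. a \<bullet> x = b} \<inter> \<pi> -` closure D) ` (H \<times> \<D>)"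
  have P: "countable P" "\<And>A. A \<in> P \<Longrightarrow> piece A"
  proof -
    show "countable P" using H(1) \<D>(1) by (auto simp: P_def)
    fix A assume "A \<in> P"
    then obtain a b D where A: "(a,b) \<in> H" "A = S \<inter> {x. a \<bullet> x = b} \<inter> \<pi> -` closure D" by (auto simp: P_def)
    have "closed (\<pi> -` closure D)" by (rule closed_vimage) (auto intro: cont_\<pi>)
    then have "compact A" unfolding A by (intro compact_Int_closed S closed_hyperplane)
    moreover have "totally_disconnected A" by (rule totally_disconnected_subset[OF S(2)]) (use A(2) in blast)
    moreover have "inj_on \<pi> A"
    proof (rule inj_onI)
      fix x y assume xy: "x \<in> A" "y \<in> A" "\<pi> x = \<pi> y"
      then have eq: "x - y = ((x - y) \<bullet> w) *\<^sub>R w" by (simp add: \<pi>_def inner_diff_left algebra_simps)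
      have "a \<bullet> (x - y) = 0" using xy A by (simp add: inner_diff_right)
      then have "((x - y) \<bullet> w) * (a \<bullet> w) = 0" using eq by (metis inner_scaleR_right)
      then have "(x - y) \<bullet> w = 0" using w(2)[OF A(1)] by simp
      then show "x = y" using eq by simp
    qed
    ultimately show "piece A" by (simp add: piece_def)
  qed
  define \<G> where "\<G> = (\<lambda>(A,B). G A B) ` {(A,B) \<in> P \<times> P. \<pi> ` A \<inter> \<pi> ` B = {}}"
  have "countable {(A,B) \<in> P \<times> P. \<pi> ` A \<inter> \<pi> ` B = {}}"
    by (rule countable_subset[of _ "P \<times> P"]) (use P(1) in auto)
  then have "countable \<G>" by (simp add: \<G>_def)
  moreover have "openin Met_TC.mtopology X \<and> Met_TC.mtopology closure_of X = UNIV" if XG: "X \<in> \<G>" for X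
  proof -
    obtain A B where X: "A \<in> P" "B \<in> P" "\<pi> ` A \<inter> \<pi> ` B = {}" "X = G A B" using XG by (auto simp: \<G>_def)
    have pc: "piece A" "piece B" using X P by auto
    have "open X" using pc open_G X by (auto simp: piece_def)
    moreover have "closure X = UNIV"
    proof -
      have "\<phi> \<in> closure X" for \<phi>
        unfolding closure_approachable using dense_G[OF pc X(3)] X(4) by (metis dist_commute)
      then show ?thesis by blast
    qed
    ultimately show ?thesis by simp
  qed
  moreover have "complete (UNIV :: ('a \<Rightarrow>\<^sub>C real) set)" by (rule complete_UNIV)
  ultimately have "Met_TC.mtopology closure_of (\<Inter>\<G>) = (UNIV :: ('a \<Rightarrow>\<^sub>C real) set)"
    using Met_TC.metric_Baire_category[of \<G>] by simp
  then have "\<Inter>\<G> \<noteq> {}" by (metis UNIV_not_empty closure_of_empty)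
  then obtain \<phi> where \<phi>: "\<phi> \<in> \<Inter>\<G>" by blast
  have "inj_on (ht \<phi>) S"
  proof (rule inj_onI, rule ccontr)
    fix x y assume xy: "x \<in> S" "y \<in> S" "ht \<phi> x = ht \<phi> y" "x \<noteq> y"
    show False
    proof (cases "\<pi> x = \<pi> y")
      case True
      then have "x \<bullet> w = y \<bullet> w" using xy(3) by (simp add: ht_def)
      then show False using True xy(4) by (simp add: \<pi>_def)
    next
      case False
      define d where "d = dist (\<pi> x) (\<pi> y) / 3"
      have d: "d > 0" using False by (simp add: d_def)
      obtain D where D: "D \<in> \<D>" "\<pi> x \<in> D" "D \<subseteq> ball (\<pi> x) d"
        using topological_basisE[OF \<D>(2), of "ball (\<pi> x) d" "\<pi> x"] d by auto
      obtain E where E: "E \<in> \<D>" "\<pi> y \<in> E" "E \<subseteq> ball (\<pi> y) d"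
        using topological_basisE[OF \<D>(2), of "ball (\<pi> y) d" "\<pi> y"] d by auto
      have cD: "closure D \<subseteq> cball (\<pi> x) d" "closure E \<subseteq> cball (\<pi> y) d"
        using D(3) E(3) by (meson ball_subset_cball closed_cball closure_minimal order_trans)+
      have DE: "closure D \<inter> closure E = {}"
      proof (rule ccontr)
        assume "closure D \<inter> closure E \<noteq> {}"
        then obtain z where "dist (\<pi> x) z \<le> d" "dist (\<pi> y) z \<le> d" using cD by fastforce
        then have "dist (\<pi> x) (\<pi> y) \<le> d + d" using dist_triangle2[of "\<pi> x" "\<pi> y" z] by simp
        then show False using d by (simp add: d_def)
      qed
      obtain a b where ab: "(a,b) \<in> H" "a \<bullet> x = b" using H(2) xy(1) by fastforce
      obtain a' b' where ab': "(a',b') \<in> H" "a' \<bullet> y = b'" using H(2) xy(2) by fastforce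
      define A where "A = S \<inter> {x. a \<bullet> x = b} \<inter> \<pi> -` closure D"
      define B where "B = S \<inter> {x. a' \<bullet> x = b'} \<inter> \<pi> -` closure E"
      have "A \<in> P" unfolding P_def A_def by (rule image_eqI[of _ _ "((a,b),D)"]) (use ab D in auto)
      moreover have "B \<in> P" unfolding P_def B_def by (rule image_eqI[of _ _ "((a',b'),E)"]) (use ab' E in auto)
      moreover have "\<pi> ` A \<inter> \<pi> ` B = {}" using DE by (auto simp: A_def B_def)
      ultimately have "G A B \<in> \<G>" unfolding \<G>_def by auto
      then have "\<phi> \<in> G A B" using \<phi> by blast
      moreover have "x \<in> A" "y \<in> B"
        using xy ab ab' D E closure_subset by (auto simp: A_def B_def)
      ultimately show False using xy(3) by (auto simp: G_def)
    qed
  qed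
  then show ?thesis using that[of "apply_bcontfun \<phi>"] by (simp add: inj_on_def ht_def \<pi>_def)
qed

text \<open>After the generic shear the heights determine the points, so the set is a graph over the line
  spanned by w and a second shear, transversal to w, moves it onto that line.\<close>
lemma ambient_generic_shear:
  fixes S :: "'a::euclidean_space set" and w :: 'a
  assumes S: "compact S" "totally_disconnected S"
    and H: "countable H" "S \<subseteq> (\<Union>(a,b)\<in>H. {x. a \<bullet> x = b})"
    and w: "norm w = 1" "\<And>h. h \<in> H \<Longrightarrow> fst h \<bullet> w \<noteq> 0"
  obtains \<alpha> :: "'a \<Rightarrow> real" where "continuous_on S \<alpha>" "inj_on \<alpha> S" "extends_ambiently S (\<lambda>x. \<alpha> x *\<^sub>R w)"
proof -
  have ww: "w \<bullet> w = 1" using w(1) by (simp add: norm_eq_1)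
  obtain \<phi> :: "'a \<Rightarrow> real" where \<phi>: "continuous_on UNIV \<phi>"
    "inj_on (\<lambda>x. x \<bullet> w + \<phi> (x - (x \<bullet> w) *\<^sub>R w)) S"
    using generic_shear[OF S H w] by blast
  define \<alpha> where "\<alpha> x = x \<bullet> w + \<phi> (x - (x \<bullet> w) *\<^sub>R w)" for x
  define g where "g x = \<phi> (x - (x \<bullet> w) *\<^sub>R w) *\<^sub>R w" for x
  have cg: "continuous_on U g" for U
    unfolding g_def by (intro continuous_intros continuous_on_compose2[OF \<phi>(1)]) auto
  have g: "g (x + c *\<^sub>R w) = g x" for x c
    by (simp add: g_def inner_add_left ww algebra_simps)
  have g1: "g (x + g x) = g x" for x unfolding g_def[of x] by (subst g) (simp add: g_def)
  have g2: "g (x - g x) = g x" for x using g[of x "- \<phi> (x - (x \<bullet> w) *\<^sub>R w)"] by (simp add: g_def)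
  have first: "extends_ambiently S (\<lambda>x. x + g x)" by (rule ambient_shear[OF cg g1 g2]) simp
  have ht: "(x + g x) \<bullet> w = \<alpha> x" for x by (simp add: g_def \<alpha>_def inner_add_left ww)
  have c\<alpha>: "continuous_on S \<alpha>" unfolding \<alpha>_def
    by (intro continuous_intros continuous_on_compose2[OF \<phi>(1)]) auto
  have inj\<alpha>: "inj_on \<alpha> S" using \<phi>(2) unfolding \<alpha>_def .
  have ck: "continuous_on S (\<lambda>x. x + g x - \<alpha> x *\<^sub>R w)" by (intro continuous_intros cg c\<alpha>)
  obtain k where k: "continuous_on UNIV k" "\<And>x. x \<in> S \<Longrightarrow> k (\<alpha> x) = x + g x - \<alpha> x *\<^sub>R w"
    using extend_along_injection_unbounded[OF S(1) c\<alpha> inj\<alpha> ck] by blast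
  \<comment> \<open>The component along w is removed from k so that the next map is a shear; on the values
    that matter it vanishes already.\<close>
  define l where "l x = - (k (x \<bullet> w) - (k (x \<bullet> w) \<bullet> w) *\<^sub>R w)" for x
  have cl: "continuous_on UNIV l"
    unfolding l_def by (intro continuous_intros continuous_on_compose2[OF k(1)]) auto
  have lw: "l x \<bullet> w = 0" for x by (simp add: l_def inner_diff_left ww)
  have l1: "l (x + l x) = l x" and l2: "l (x - l x) = l x" for x
    using lw[of x] by (simp_all add: l_def[of "x + l x"] l_def[of "x - l x"] inner_add_left inner_diff_left)
      (simp_all add: l_def)
  have "extends_ambiently ((\<lambda>x. x + g x) ` S) (\<lambda>y. (y \<bullet> w) *\<^sub>R w)"
  proof (rule ambient_shear[OF cl l1 l2])
    fix y assume "y \<in> (\<lambda>x. x + g x) ` S"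
    then obtain x where x: "x \<in> S" "y = x + g x" by blast
    have "k (\<alpha> x) \<bullet> w = 0" using k(2)[OF x(1)] ht[of x] by (simp add: inner_diff_left ww)
    then have "l y = - (x + g x - \<alpha> x *\<^sub>R w)" using k(2)[OF x(1)] ht[of x] x by (simp add: l_def)
    then show "(y \<bullet> w) *\<^sub>R w = y + l y" using x ht[of x] by simp
  qed
  then have "extends_ambiently S (\<lambda>x. \<alpha> x *\<^sub>R w)"
    by (rule ambient_compose[OF first]) (simp add: ht)
  then show ?thesis using that c\<alpha> inj\<alpha> by blast
qed

lemma exists_orthonormal:
  fixes w :: "'a::euclidean_space"
  assumes "DIM('a) \<ge> 2"
  obtains u where "norm u = 1" "u \<bullet> w = 0"
proof -
  obtain v where v: "v \<noteq> 0" "orthogonal w v"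
    using orthogonal_to_vector_exists[of w] assms by auto
  then show ?thesis
    by (intro that[of "v /\<^sub>R norm v"]) (auto simp: orthogonal_def inner_commute)
qed

text \<open>Klee's trick: in the plane of w and u the graph of p lies over both axes, so shears along
  u and then w turn the subset R of the first axis into p(R) on the second.\<close>
lemma ambient_line_map:
  fixes w :: "'a::euclidean_space"
  assumes "DIM('a) \<ge> 2" "norm w = 1" "compact R" "continuous_on R p" "inj_on p R"
    and f: "\<And>s. s \<in> R \<Longrightarrow> f (s *\<^sub>R w) = (p s :: real) *\<^sub>R w"
  shows "extends_ambiently ((\<lambda>s. s *\<^sub>R w) ` R) f"
proof -
  obtain u where u: "norm u = 1" "u \<bullet> w = 0" using exists_orthonormal[OF assms(1)] by blast
  have i: "w \<bullet> w = 1" "u \<bullet> u = 1" "u \<bullet> w = 0" "w \<bullet> u = 0"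
    using u assms(2) by (auto simp: norm_eq_1 inner_commute)
  obtain P where P: "continuous_on UNIV P" "\<And>s. s \<in> R \<Longrightarrow> P s = p s"
    using extend_along_injection_unbounded[OF assms(3) continuous_on_id inj_on_id2 assms(4)] by blast
  obtain Q where Q: "continuous_on UNIV Q" "\<And>s. s \<in> R \<Longrightarrow> Q (p s) = s"
    using extend_along_injection_unbounded[OF assms(3,4,5) continuous_on_id] by blast
  have 1: "extends_ambiently ((\<lambda>s. s *\<^sub>R w) ` R) (\<lambda>y. y + P (y \<bullet> w) *\<^sub>R u)"
    by (rule ambient_shear[where g="\<lambda>y. P (y \<bullet> w) *\<^sub>R u"])
      (auto simp: inner_add_left inner_diff_left i intro!: continuous_intros continuous_on_compose2[OF P(1)])
  have 2: "extends_ambiently U (\<lambda>y. y - Q (y \<bullet> u) *\<^sub>R w)" for U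
    by (rule ambient_shear[where g="\<lambda>y. - Q (y \<bullet> u) *\<^sub>R w"])
      (auto simp: inner_add_left inner_diff_left i intro!: continuous_intros continuous_on_compose2[OF Q(1)])
  have 3: "extends_ambiently U (\<lambda>y. y + (y \<bullet> u) *\<^sub>R w)" for U
    by (rule ambient_shear[where g="\<lambda>y. (y \<bullet> u) *\<^sub>R w"])
      (auto simp: inner_add_left inner_diff_left i intro!: continuous_intros)
  have 4: "extends_ambiently U (\<lambda>y. y - (y \<bullet> w) *\<^sub>R u)" for U
    by (rule ambient_shear[where g="\<lambda>y. - (y \<bullet> w) *\<^sub>R u"])
      (auto simp: inner_add_left inner_diff_left i intro!: continuous_intros)
  have "extends_ambiently ((\<lambda>s. s *\<^sub>R w) ` R) (\<lambda>y. P (y \<bullet> w) *\<^sub>R u)"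
    by (rule ambient_compose[OF 1 2]) (auto simp: inner_add_left i P Q)
  then have "extends_ambiently ((\<lambda>s. s *\<^sub>R w) ` R) (\<lambda>y. P (y \<bullet> w) *\<^sub>R u + P (y \<bullet> w) *\<^sub>R w)"
    by (rule ambient_compose[OF _ 3]) (simp add: i)
  then show ?thesis
    by (rule ambient_compose[OF _ 4]) (auto simp: inner_add_left i P f)
qed

text \<open>Both S and its image are straightened onto one line; the induced map between subsets of that
  line extends by Klee's trick.\<close>
lemma ambient_extension:
  fixes S :: "'a::euclidean_space set"
  assumes dim: "DIM('a) \<ge> 2" and S: "compact S" "totally_disconnected S"
    and f: "continuous_on S f" "inj_on f S"
    and H: "countable H" "S \<union> f ` S \<subseteq> (\<Union>(a,b)\<in>H. {x. a \<bullet> x = b})" "\<And>a b. (a,b) \<in> H \<Longrightarrow> a \<noteq> 0"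
  shows "extends_ambiently S f"
proof -
  have "countable (fst ` H)" "0 \<notin> fst ` H" using H by auto
  then obtain w where w: "norm w = 1" "\<And>a. a \<in> fst ` H \<Longrightarrow> a \<bullet> w \<noteq> 0"
    using generic_direction by blast
  then have w': "\<And>h. h \<in> H \<Longrightarrow> fst h \<bullet> w \<noteq> 0" by blast
  obtain g where g: "homeomorphism S (f ` S) f g"
    using homeomorphism_compact[OF S(1) f(1) refl f(2)] by blast
  have S': "compact (f ` S)" "totally_disconnected (f ` S)"
    using S f compact_continuous_image totally_disconnected_homeomorphic[OF g] by auto
  obtain \<alpha> where \<alpha>: "continuous_on S \<alpha>" "inj_on \<alpha> S" "extends_ambiently S (\<lambda>x. \<alpha> x *\<^sub>R w)"
    using ambient_generic_shear[OF S H(1) _ w(1) w'] H(2) by auto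
  obtain \<beta> where \<beta>: "continuous_on (f ` S) \<beta>" "inj_on \<beta> (f ` S)" "extends_ambiently (f ` S) (\<lambda>x. \<beta> x *\<^sub>R w)"
    using ambient_generic_shear[OF S' H(1) _ w(1) w'] H(2) by auto
  define i where "i = inv_into S \<alpha>"
  have i: "i (\<alpha> x) = x" if "x \<in> S" for x using that \<alpha>(2) by (simp add: i_def)
  have ci: "continuous_on (\<alpha> ` S) i" by (rule continuous_on_inv) (use \<alpha> S i in auto)
  define p where "p s = \<beta> (f (i s))" for s
  have cp: "continuous_on (\<alpha> ` S) p"
    unfolding p_def
    by (rule continuous_on_compose2[OF \<beta>(1)], rule continuous_on_compose2[OF f(1) ci]) (use i in auto)
  have ip: "inj_on p (\<alpha> ` S)"
    using \<beta>(2) f(2) by (auto simp: inj_on_def p_def i)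
  have "extends_ambiently ((\<lambda>s. s *\<^sub>R w) ` \<alpha> ` S) (\<lambda>y. p (y \<bullet> w) *\<^sub>R w)"
    using w(1) by (intro ambient_line_map[OF dim w(1) _ cp ip] compact_continuous_image \<alpha> S)
      (simp add: norm_eq_1)
  then have "extends_ambiently ((\<lambda>x. \<alpha> x *\<^sub>R w) ` S) (\<lambda>y. p (y \<bullet> w) *\<^sub>R w)" by (simp add: image_image)
  then have 1: "extends_ambiently S (\<lambda>x. \<beta> (f x) *\<^sub>R w)"
    by (rule ambient_compose[OF \<alpha>(3)]) (use w(1) in \<open>simp add: p_def i norm_eq_1\<close>)
  define j where "j y = inv_into (f ` S) \<beta> (y \<bullet> w)" for y
  have j: "j (\<beta> y *\<^sub>R w) = y" if "y \<in> f ` S" for y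
    using that \<beta>(2) w(1) by (simp add: j_def norm_eq_1)
  have "extends_ambiently ((\<lambda>x. \<beta> x *\<^sub>R w) ` f ` S) j"
    by (rule ambient_inverse[OF \<beta>(3) j])
  then have "extends_ambiently ((\<lambda>x. \<beta> (f x) *\<^sub>R w) ` S) j" by (simp add: image_image)
  then show ?thesis by (rule ambient_compose[OF 1]) (simp add: j)
qed

section \<open>Geometry of the blocks and of the reflection\<close>

lemma first_ix_neq_last_ix:
  assumes "CARD('n::{finite,linorder}) \<ge> 2"
  shows "(first_ix :: 'n) \<noteq> last_ix"
proof
  assume eq: "(first_ix :: 'n) = last_ix"
  have "x = first_ix" for x :: 'n
    using Min_le[of UNIV x] Max_ge[of UNIV x] eq
    unfolding first_ix_def last_ix_def by (metis UNIV_I antisym finite_code)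
  then have "UNIV = {first_ix :: 'n}" by blast
  then have "CARD('n) = 1" by (metis card_1_singleton_iff One_nat_def)
  then show False using assms by simp
qed

lemma flip_h_component: "flip_h x $ i = (if i = last_ix then 2 - x $ i else x $ i)"
  by (simp add: flip_h_def)

lemma flip_h_involution [simp]: "flip_h (flip_h x) = x"
  by (simp add: vec_eq_iff flip_h_component)

lemma dist_flip_h [simp]: "dist (flip_h x) (flip_h y) = dist x y"
proof -
  have "norm (flip_h x - flip_h y) \<le> norm (x - y)" for x y :: "real ^ 'n::{finite,linorder}"
    by (rule norm_le_componentwise_cart) (simp add: flip_h_component abs_minus_commute)
  from this[of x y] this[of "flip_h x" "flip_h y"] show ?thesis by (simp add: dist_norm)
qed

lemma flip_h_zero: "flip_h 0 = axis last_ix 2"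
  by (simp add: vec_eq_iff flip_h_component axis_def)

lemma dist_flip_h_self: "dist x (flip_h x) = 2 * \<bar>1 - x $ last_ix\<bar>"
proof -
  have "x - flip_h x = (2 * x $ last_ix - 2) *\<^sub>R axis last_ix 1"
    by (simp add: vec_eq_iff flip_h_component axis_def)
  then have "dist x (flip_h x) = \<bar>2 * x $ last_ix - 2\<bar>" by (simp add: dist_norm norm_axis_1)
  then show ?thesis by (smt (verit))
qed

lemma block_Q_eq_cbox:
  "(block_Q k :: (real ^ 'n::{finite,linorder}) set) =
    cbox (\<chi> i. if k = 0 then - 1 else if i = last_ix then 1 / 2 ^ k else - (1 / 4 ^ k))
         (\<chi> i. if k = 0 then 1 else if i = last_ix then 2 / 2 ^ k else 1 / 4 ^ k)"
  by (auto simp: block_Q_def mem_box_cart split: if_splits)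

lemma compact_block_Q: "compact (block_Q k)"
  unfolding block_Q_eq_cbox by (rule compact_cbox)

lemma closed_block_Q: "closed (block_Q k)"
  unfolding block_Q_eq_cbox by (rule closed_cbox)

lemma frontier_block_Q_subset: "frontier (block_Q k) \<subseteq> block_Q k"
  using closed_block_Q by (rule frontier_subset_closed)

text \<open>All faces lie in hyperplanes on which a coordinate has a fixed rational value. This is how
  countably many hyperplanes covering the whole Cantor set and its image are found.\<close>
lemma frontier_block_Q_rational:
  assumes "x \<in> frontier (block_Q k)"
  shows "\<exists>i. x $ i \<in> \<rat>"
proof -
  obtain i where "\<not> ((if k = 0 then - 1 else if i = last_ix then 1 / 2 ^ k else - (1 / 4 ^ k)) < x $ i \<and>
      x $ i < (if k = 0 then 1 else if i = last_ix then 2 / 2 ^ k else 1 / 4 ^ k))"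
    and "(if k = 0 then - 1 else if i = last_ix then 1 / 2 ^ k else - (1 / 4 ^ k)) \<le> x $ i \<and>
      x $ i \<le> (if k = 0 then 1 else if i = last_ix then 2 / 2 ^ k else 1 / 4 ^ k)"
    using assms unfolding block_Q_eq_cbox frontier_cbox by (auto simp: mem_box_cart)
  then have "x $ i \<in> {- 1, 1, 1 / 2 ^ k, - (1 / 4 ^ k), 2 / 2 ^ k, 1 / 4 ^ k}"
    by (auto split: if_splits)
  moreover have "{- 1, 1, 1 / 2 ^ k, - (1 / 4 ^ k), 2 / 2 ^ k, 1 / 4 ^ k} \<subseteq> (\<rat> :: real set)" by simp
  ultimately show ?thesis by blast
qed

lemma frontier_block_Q_0:
  fixes x :: "real ^ 'n::{finite,linorder}"
  assumes "x \<in> frontier (block_Q 0)"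
  shows "\<exists>i. \<bar>x $ i\<bar> = 1"
proof -
  have "x \<in> cbox (- 1) 1 - box (- 1) (1 :: real ^ 'n::{finite,linorder})"
    using assms by (simp add: block_Q_eq_cbox frontier_cbox one_vec_def uminus_vec_def)
  then obtain i where "- 1 \<le> x $ i \<and> x $ i \<le> 1" "\<not> (- 1 < x $ i \<and> x $ i < 1)"
    by (auto simp: mem_box_cart)
  then show ?thesis by (intro exI[of _ i]) linarith
qed

lemma block_Q_component_bound:
  assumes "x \<in> block_Q k"
  shows "\<bar>x $ i\<bar> \<le> 2 / 2 ^ k"
proof (cases "k = 0 \<or> i = last_ix")
  case True
  have "0 < (1::real) / 2 ^ k" by simp
  then show ?thesis using assms True by (auto simp: block_Q_def abs_le_iff split: if_splits) (smt (verit))+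
next
  case False
  have "1 / 4 ^ k \<le> (1::real) / 2 ^ k" by (intro divide_left_mono power_mono) auto
  moreover have "0 < (1::real) / 2 ^ k" by simp
  moreover have "\<bar>x $ i\<bar> \<le> 1 / 4 ^ k" using assms False by (auto simp: block_Q_def)
  ultimately show ?thesis by simp
qed

lemma norm_cart_le:
  fixes x :: "real ^ 'n" and B :: real
  assumes "\<And>i. \<bar>x $ i\<bar> \<le> B"
  shows "norm x \<le> CARD('n) * B"
proof -
  have "norm x \<le> (\<Sum>i\<in>UNIV. \<bar>x $ i\<bar>)" by (rule norm_le_l1_cart)
  also have "\<dots> \<le> (\<Sum>i\<in>(UNIV :: 'n set). B)" by (intro sum_mono assms)
  finally show ?thesis by simp
qed

text \<open>Every fixed point (on the boundary of the cube or on the slice) has height 1, or height at most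
  \<open>- 1/2\<close>, or lies on a lateral face of the cube; this is all that the metric estimates use.\<close>
definition fixed_part :: "(real ^ 'n::{finite,linorder}) set" where
  "fixed_part = {x \<in> block_Q 0. x $ last_ix = 1 \<or> x $ last_ix \<le> - 1/2 \<or> (\<exists>i. i \<noteq> last_ix \<and> \<bar>x $ i\<bar> = 1)}"

definition spike_part :: "(real ^ 'n::{finite,linorder}) set" where
  "spike_part = {x. 0 \<le> x $ last_ix \<and> x $ last_ix \<le> 1 \<and> (\<forall>i. i \<noteq> last_ix \<longrightarrow> \<bar>x $ i\<bar> \<le> 1/4)}"

lemma frontier_block_Q_0_fixed: "frontier (block_Q 0) \<subseteq> fixed_part"
proof
  fix x :: "real ^ 'n::{finite,linorder}" assume x: "x \<in> frontier (block_Q 0)"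
  then obtain i where i: "\<bar>x $ i\<bar> = 1" using frontier_block_Q_0 by blast
  have "x \<in> block_Q 0" using x frontier_block_Q_subset by blast
  moreover have "x $ last_ix = 1 \<or> x $ last_ix \<le> - 1/2" if "i = last_ix" using i unfolding that by linarith
  ultimately show "x \<in> fixed_part" using i unfolding fixed_part_def by blast
qed

lemma centered_cantor_subset: "centered_ternary_cantor \<subseteq> {- 1/2..1/2}"
  using ternary_cantor_subset by (fastforce simp: centered_ternary_cantor_def)

lemma cantor_slice_fixed: "cantor_slice \<subseteq> fixed_part"
proof
  fix x :: "real ^ 'n::{finite,linorder}" assume x: "x \<in> cantor_slice"
  have "x $ first_ix \<in> {- 1/2..1/2}" using x centered_cantor_subset by (auto simp: cantor_slice_def)
  then have "- 1 \<le> x $ i \<and> x $ i \<le> 1" for i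
    using x by (cases "i = first_ix"; cases "i = last_ix") (auto simp: cantor_slice_def)
  then have "x \<in> block_Q 0" by (simp add: block_Q_def)
  then show "x \<in> fixed_part" using x by (auto simp: fixed_part_def cantor_slice_def)
qed

lemma block_Q_spike:
  assumes "k \<ge> 1"
  shows "block_Q k \<subseteq> spike_part"
proof
  fix x :: "real ^ 'n::{finite,linorder}" assume x: "x \<in> block_Q k"
  have "(4::real) ^ 1 \<le> 4 ^ k" "(2::real) ^ 1 \<le> 2 ^ k" using assms by (intro power_increasing; simp)+
  then have 4: "1 / 4 ^ k \<le> (1/4::real)" and 2: "2 / 2 ^ k \<le> (1::real)" by (auto simp: field_simps)
  have 0: "0 < (1::real) / 2 ^ k" by simp
  have last: "1 / 2 ^ k \<le> x $ last_ix" "x $ last_ix \<le> 2 / 2 ^ k" using x assms by (auto simp: block_Q_def)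
  have "0 \<le> x $ last_ix" "x $ last_ix \<le> 1" using last 0 2 by linarith+
  moreover have "\<And>i. i \<noteq> last_ix \<Longrightarrow> \<bar>x $ i\<bar> \<le> 1/4"
    using x assms order_trans[OF _ 4] by (auto simp: block_Q_def abs_le_iff)
  ultimately show "x \<in> spike_part" by (simp add: spike_part_def)
qed

lemma zero_spike: "0 \<in> spike_part"
  by (simp add: spike_part_def)

text \<open>The two prescriptions agree where the pieces meet, namely on the rim at height 1.\<close>
lemma flip_h_fixed_spike:
  assumes "x \<in> fixed_part" "x \<in> spike_part"
  shows "flip_h x = x"
proof -
  have "x $ last_ix = 1" using assms by (force simp: fixed_part_def spike_part_def)
  then show ?thesis by (simp add: vec_eq_iff flip_h_component)
qed

lemma fixed_part_big_cube: "fixed_part \<subseteq> big_cube"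
proof
  fix x :: "real ^ 'n::{finite,linorder}" assume "x \<in> fixed_part"
  then have x: "- 1 \<le> x $ i \<and> x $ i \<le> 1" for i by (auto simp: fixed_part_def block_Q_def)
  have "- 2 \<le> x $ i \<and> x $ i \<le> 2" for i using x[of i] by linarith
  then show "x \<in> big_cube" by (simp add: big_cube_def)
qed

lemma spike_part_big_cube:
  assumes "x \<in> spike_part"
  shows "x \<in> big_cube" "flip_h x \<in> big_cube"
proof -
  have "\<bar>x $ i\<bar> \<le> 1" "\<bar>flip_h x $ i\<bar> \<le> 2" for i
    using assms by (cases "i = last_ix"; fastforce simp: spike_part_def flip_h_component)+
  then show "x \<in> big_cube" "flip_h x \<in> big_cube"
    unfolding big_cube_def by (smt (verit) abs_le_iff atLeastAtMost_iff mem_Collect_eq)+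
qed

text \<open>A fixed point whose height differs from 1 keeps a definite distance from the spike, which
  absorbs the displacement; at height 1 the two distances agree.\<close>
lemma dist_fixed_spike:
  assumes x: "x \<in> fixed_part" and y: "y \<in> spike_part"
  shows "dist x y \<le> dist x (flip_h y)" "dist x (flip_h y) \<le> 5 * dist x y"
proof -
  have x1: "x $ last_ix \<le> 1" using x by (auto simp: fixed_part_def block_Q_def)
  have y1: "0 \<le> y $ last_ix" "y $ last_ix \<le> 1" using y by (auto simp: spike_part_def)
  have "norm (x - y) \<le> norm (x - flip_h y)"
    by (rule norm_le_componentwise_cart) (use x1 y1 in \<open>auto simp: flip_h_component\<close>)
  then show "dist x y \<le> dist x (flip_h y)" by (simp add: dist_norm)
  have comp: "\<bar>x $ i - y $ i\<bar> \<le> dist x y" for i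
    using component_le_norm_cart[of "x - y" i] by (simp add: dist_norm)
  have "1 - y $ last_ix \<le> 2 * dist x y"
  proof -
    consider "x $ last_ix = 1" | "x $ last_ix \<le> - 1/2" | i where "i \<noteq> last_ix" "\<bar>x $ i\<bar> = 1"
      using x by (auto simp: fixed_part_def)
    then show ?thesis
    proof cases
      case 3
      then have "\<bar>y $ i\<bar> \<le> 1/4" using y by (auto simp: spike_part_def)
      then show ?thesis using comp[of i] 3 y1 by linarith
    qed (use comp[of last_ix] y1 in linarith)+
  qed
  moreover have "dist x (flip_h y) \<le> dist x y + dist y (flip_h y)" by (rule dist_triangle)
  ultimately show "dist x (flip_h y) \<le> 5 * dist x y" using y1 by (simp add: dist_flip_h_self)
qed

lemma cantor_like_slice:
  assumes "CARD('n::{finite,linorder}) \<ge> 2"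
  shows "cantor_like (cantor_slice :: (real ^ 'n::{finite,linorder}) set)"
proof -
  define e :: "real \<Rightarrow> real ^ 'n::{finite,linorder}" where
    "e t = (\<chi> i. if i = first_ix then t - 1/2 else if i = last_ix then - (1/2) else 0)" for t
  have ne: "(last_ix :: 'n) \<noteq> first_ix" using first_ix_neq_last_ix[OF assms] by simp
  have e_first: "e t $ first_ix = t - 1/2" for t by (simp add: e_def)
  have "continuous_on ternary_cantor e"
    unfolding e_def
  proof (rule continuous_on_vec_lambda)
    fix i :: 'n
    show "continuous_on ternary_cantor
      (\<lambda>t. if i = first_ix then t - 1/2 else if i = last_ix then - (1/2) else 0)"
      by (cases "i = first_ix"; cases "i = last_ix") (auto intro!: continuous_intros)
  qed
  moreover have "inj_on e ternary_cantor" by (rule inj_onI) (metis e_first diff_add_cancel)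
  moreover have "e ` ternary_cantor = cantor_slice"
  proof
    show "e ` ternary_cantor \<subseteq> cantor_slice"
      using ne by (auto simp: e_def cantor_slice_def centered_ternary_cantor_def)
    show "cantor_slice \<subseteq> e ` ternary_cantor"
    proof
      fix x :: "real ^ 'n::{finite,linorder}" assume x: "x \<in> cantor_slice"
      then obtain t where "t \<in> ternary_cantor" "x $ first_ix = t - 1/2"
        by (auto simp: cantor_slice_def centered_ternary_cantor_def)
      moreover from this have "x = e t"
        using x ne by (simp add: vec_eq_iff e_def cantor_slice_def)
      ultimately show "x \<in> e ` ternary_cantor" by blast
    qed
  qed
  ultimately have "ternary_cantor homeomorphic (cantor_slice :: (real ^ 'n::{finite,linorder}) set)"
    using homeomorphic_compact ternary_cantor_compact by blast
  then show ?thesis using cantor_like_homeomorphic ternary_cantor_like by blast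
qed

lemma similarity_affine:
  fixes z :: "'a::euclidean_space \<Rightarrow> 'a"
  assumes "similarity z"
  obtains c L where "c > 0" "orthogonal_transformation L" "\<And>x. z x = z 0 + c *\<^sub>R L x"
    "\<And>x y. dist (z x) (z y) = c * dist x y"
proof -
  obtain c where c: "c > 0" "\<And>x y. dist (z x) (z y) = c * dist x y"
    using assms by (auto simp: similarity_def)
  define L where "L x = (z x - z 0) /\<^sub>R c" for x
  have "dist (L x) (L y) = dist x y" for x y
  proof -
    have "L x - L y = (z x - z y) /\<^sub>R c" by (simp add: L_def algebra_simps)
    then show ?thesis using c by (simp add: dist_norm)
  qed
  then have "orthogonal_transformation L" by (simp add: orthogonal_transformation_isometry L_def)
  moreover have "z x = z 0 + c *\<^sub>R L x" for x using c(1) by (simp add: L_def)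
  ultimately show ?thesis using that c by blast
qed

lemma similarity_homeomorphism:
  fixes z :: "'a::euclidean_space \<Rightarrow> 'a"
  assumes "similarity z"
  shows "bij z" "homeomorphism UNIV UNIV z (inv z)"
proof -
  obtain c L where c: "c > 0" "orthogonal_transformation L" "\<And>x. z x = z 0 + c *\<^sub>R L x"
    "\<And>x y. dist (z x) (z y) = c * dist x y"
    using similarity_affine[OF assms] by blast
  have "inj z" using c(1,4) by (metis dist_eq_0_iff injI mult_eq_0_iff less_irrefl)
  moreover have "surj z"
  proof (rule surjI)
    fix y
    have "surj L" using c(2) by (rule orthogonal_transformation_surj)
    then have "L (inv L ((y - z 0) /\<^sub>R c)) = (y - z 0) /\<^sub>R c" by (rule surj_f_inv_f)
    then show "z (inv L ((y - z 0) /\<^sub>R c)) = y"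
      using c(1) c(3)[of "inv L ((y - z 0) /\<^sub>R c)"] by simp
  qed
  ultimately show b: "bij z" by (simp add: bij_def)
  have "continuous_on UNIV z"
    by (rule lipschitz_on_continuous_on[of c], rule lipschitz_onI) (use c(1) in \<open>simp_all add: c(4)\<close>)
  moreover have "continuous_on UNIV (inv z)"
  proof (rule lipschitz_on_continuous_on[of "1/c"], rule lipschitz_onI)
    fix x y
    have "dist x y = c * dist (inv z x) (inv z y)"
      using c(4)[of "inv z x" "inv z y"] b by (simp add: bij_is_surj surj_f_inv_f)
    then show "dist (inv z x) (inv z y) \<le> 1/c * dist x y" using c(1) by (simp add: field_simps)
  qed (use c(1) in auto)
  ultimately show "homeomorphism UNIV UNIV z (inv z)"
    using b unfolding homeomorphism_def
    by (simp add: bij_is_inj bij_is_surj surj_f_inv_f inv_f_f bij_imp_bij_inv)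
qed

lemma homeomorphism_frontier_image:
  assumes "homeomorphism UNIV UNIV f g"
  shows "frontier (f ` S) = f ` frontier S"
proof -
  have "homeomorphic_maps euclidean euclidean f g"
    using assms by (simp add: homeomorphic_maps_def homeomorphism_def)
  then have *: "homeomorphic_map euclidean euclidean f" by (simp add: homeomorphic_maps_map)
  then show ?thesis
    using homeomorphic_map_frontier_of[OF *, of S] by simp
qed

lemma geometric_eventually_small:
  fixes b C e :: real
  assumes "b \<ge> 2" "e > 0"
  shows "\<exists>N. \<forall>k\<ge>N. C / b ^ k < e"
proof -
  have "(\<lambda>k. C * (1/b) ^ k) \<longlonglongrightarrow> C * 0"
    using assms by (intro tendsto_mult tendsto_const LIMSEQ_realpow_zero) auto
  then have "\<forall>\<^sub>F k in sequentially. C * (1/b) ^ k < e"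
    using assms by (auto intro: order_tendstoD)
  then show ?thesis by (simp add: eventually_sequentially divide_inverse power_inverse)
qed

lemma target_cube_bounds:
  fixes x :: "real ^ 'n::{finite,linorder}"
  assumes "x \<in> target_cube m"
  shows "x $ first_ix \<ge> 1 / 2 * (1 / 4 ^ m)" "x $ first_ix \<le> 1 / 4 ^ m" "norm x \<le> CARD('n) * (1 / 4 ^ m)"
proof -
  show 1: "x $ first_ix \<ge> 1 / 2 * (1 / 4 ^ m)" "x $ first_ix \<le> 1 / 4 ^ m"
    using assms by (auto simp: target_cube_def)
  have p: "(0::real) < 1 / 4 ^ m" by simp
  show "norm x \<le> CARD('n) * (1 / 4 ^ m)"
  proof (rule norm_cart_le)
    fix i
    show "\<bar>x $ i\<bar> \<le> 1 / 4 ^ m"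
    proof (cases "i = first_ix")
      case True
      have "0 \<le> x $ first_ix" using 1 p by linarith
      then show ?thesis using 1 True by simp
    next
      case False
      then have "\<bar>x $ i\<bar> \<le> 1 / 4 ^ (m + 1)" using assms by (auto simp: target_cube_def)
      also have "\<dots> \<le> 1 / 4 ^ m" by (simp add: field_simps)
      finally show ?thesis .
    qed
  qed
qed

text \<open>The gap between two cubes is comparable to the size of the larger one, so any displacement inside
  the cubes changes such distances by a bounded factor only.\<close>
lemma dist_target_cubes:
  fixes x x' y y' :: "real ^ 'n::{finite,linorder}"
  assumes "x \<in> target_cube m" "x' \<in> target_cube m" "m < m'"
    and y: "y = 0 \<and> y' = 0 \<or> y \<in> target_cube m' \<and> y' \<in> target_cube m'"
  shows "dist x' y' \<le> 8 * CARD('n) * dist x y"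
proof -
  have p: "(0::real) < 1 / 4 ^ m" by simp
  have "(4::real) ^ (m + 1) \<le> 4 ^ m'" using assms(3) by (intro power_increasing) auto
  then have 4: "1 / 4 ^ m' \<le> 1/4 * (1 / (4::real) ^ m)" by (simp add: field_simps)
  have "y $ first_ix \<le> 1/4 * (1 / 4 ^ m)"
    using y target_cube_bounds(2)[of y m'] 4 by auto
  then have "1/4 * (1 / 4 ^ m) \<le> x $ first_ix - y $ first_ix" using target_cube_bounds(1)[OF assms(1)] by linarith
  also have "\<dots> \<le> dist x y"
    using component_le_norm_cart[of "x - y" first_ix] by (simp add: dist_norm)
  finally have low: "1/4 * (1 / 4 ^ m) \<le> dist x y" .
  have "norm y' \<le> CARD('n) * (1 / 4 ^ m)"
  proof (cases "y' = 0")
    case False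
    then have "norm y' \<le> CARD('n) * (1 / 4 ^ m')" using y target_cube_bounds(3) by blast
    also have "\<dots> \<le> CARD('n) * (1 / 4 ^ m)" using 4 p by (intro mult_left_mono) linarith+
    finally show ?thesis .
  qed simp
  then have "dist x' y' \<le> 2 * CARD('n) * (1 / 4 ^ m)"
    using target_cube_bounds(3)[OF assms(2)] norm_triangle_ineq4[of x' y'] by (simp add: dist_norm)
  also have "\<dots> = 8 * CARD('n) * (1/4 * (1 / 4 ^ m))" by simp
  also have "\<dots> \<le> 8 * CARD('n) * dist x y" using low by (intro mult_left_mono) auto
  finally show ?thesis .
qed

lemma bi_lipschitz_onI:
  fixes f :: "'a::metric_space \<Rightarrow> 'b::metric_space"
  assumes "L > 1" "\<And>x y. x \<in> S \<Longrightarrow> y \<in> S \<Longrightarrow> dist (f x) (f y) \<le> L * dist x y"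
    "\<And>x y. x \<in> S \<Longrightarrow> y \<in> S \<Longrightarrow> dist x y \<le> L * dist (f x) (f y)"
  shows "bi_lipschitz_on S f" "inj_on f S" "continuous_on S f"
proof -
  show inj: "inj_on f S"
  proof (rule inj_onI)
    fix x y assume "x \<in> S" "y \<in> S" "f x = f y"
    then show "x = y" using assms(3)[of x y] by simp
  qed
  have lip: "L-lipschitz_on S f" using assms by (auto simp: lipschitz_on_def)
  have lip': "L-lipschitz_on (f ` S) (inv_into S f)"
    using assms inj by (auto simp: lipschitz_on_def)
  show cont: "continuous_on S f" using lip by (rule lipschitz_on_continuous_on)
  have "continuous_on (f ` S) (inv_into S f)" using lip' by (rule lipschitz_on_continuous_on)
  then have "homeomorphism S (f ` S) f (inv_into S f)"
    using cont inj by (auto simp: homeomorphism_def inv_into_into f_inv_into_f)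
  then show "bi_lipschitz_on S f" using lip lip' assms(1) by (auto simp: bi_lipschitz_on_def embedding_on_def)
qed

section \<open>The set, the map and the homeomorphic extension\<close>

locale cube_cantor_family =
  fixes \<zeta> :: "nat \<Rightarrow> real ^ 'n::{finite,linorder} \<Rightarrow> real ^ 'n::{finite,linorder}"
    and K :: "nat \<Rightarrow> nat \<Rightarrow> (real ^ 'n::{finite,linorder}) set"
  assumes dim: "CARD('n) \<ge> 2"
    and sim: "\<And>m. similarity (\<zeta> m)"
    and cubes: "\<And>m. \<zeta> m ` big_cube = target_cube m"
    and K_cantor: "\<And>m k. cantor_set (K m k)"
    and K_sub: "\<And>m k. K m k \<subseteq> frontier (\<zeta> m ` block_Q k) \<inter> \<zeta> m ` boundary_X"
    and K_dense: "\<And>m k x. x \<in> frontier (\<zeta> m ` block_Q k) \<inter> \<zeta> m ` boundary_X \<Longrightarrow>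
      infdist x (K m k) < 1 / 8 ^ (k + m)"
begin

lemma zeta_homeo: "homeomorphism UNIV UNIV (\<zeta> m) (inv (\<zeta> m))"
  by (rule similarity_homeomorphism(2)[OF sim])

lemma inv_zeta [simp]: "inv (\<zeta> m) (\<zeta> m x) = x"
  using similarity_homeomorphism(1)[OF sim] by (simp add: bij_is_inj inv_f_f)

lemma zeta_inv [simp]: "\<zeta> m (inv (\<zeta> m) x) = x"
  using similarity_homeomorphism(1)[OF sim] by (simp add: bij_is_surj surj_f_inv_f)

lemma zeta_eq_iff [simp]: "\<zeta> m x = \<zeta> m y \<longleftrightarrow> x = y"
  by (metis inv_zeta)

lemma zeta_dist: obtains c where "c > 0" "\<And>x y. dist (\<zeta> m x) (\<zeta> m y) = c * dist x y"
  using sim[of m] by (auto simp: similarity_def)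

lemma zeta_in_target: "u \<in> big_cube \<Longrightarrow> \<zeta> m u \<in> target_cube m"
  using cubes by blast

lemma zeta_cube_injective:
  assumes "\<zeta> m u = \<zeta> m' u'" "u \<in> big_cube" "u' \<in> big_cube"
  shows "m = m'" "u = u'"
proof -
  have in1: "\<zeta> m u \<in> target_cube m" "\<zeta> m u \<in> target_cube m'"
    using assms zeta_in_target by (blast, metis)
  have F: "\<not> i < j" if "\<zeta> m u \<in> target_cube i" "\<zeta> m u \<in> target_cube j" for i j
  proof
    assume "i < j"
    then have "(4::real) ^ (i + 1) \<le> 4 ^ j" by (intro power_increasing) auto
    then have "1 / 4 ^ j \<le> 1/4 * (1 / (4::real) ^ i)" by (simp add: field_simps)
    moreover have "(0::real) < 1 / 4 ^ i" by simp
    ultimately show False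
      using target_cube_bounds(1)[OF that(1)] target_cube_bounds(2)[OF that(2)] by linarith
  qed
  show "m = m'" using F[OF in1] F[OF in1(2,1)] by simp
  then show "u = u'" using assms(1) by simp
qed

lemma zeta_cube_nonzero: "u \<in> big_cube \<Longrightarrow> \<zeta> m u \<noteq> 0"
proof
  assume u: "u \<in> big_cube" "\<zeta> m u = 0"
  have "(0::real) < 1 / 4 ^ m" by simp
  then show False using target_cube_bounds(1)[OF zeta_in_target[OF u(1), of m]] unfolding u(2) zero_index by linarith
qed

lemma K_frontier: "x \<in> K m k \<Longrightarrow> \<exists>u. x = \<zeta> m u \<and> u \<in> frontier (block_Q k) \<and> u \<in> boundary_X"
proof -
  assume "x \<in> K m k"
  then have "x \<in> frontier (\<zeta> m ` block_Q k)" "x \<in> \<zeta> m ` boundary_X" using K_sub[of m k] by blast+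
  then have "x \<in> \<zeta> m ` frontier (block_Q k)" "x \<in> \<zeta> m ` boundary_X"
    by (simp_all add: homeomorphism_frontier_image[OF zeta_homeo])
  then show ?thesis by auto
qed

lemma K_parts:
  assumes "x \<in> K m k"
  shows "\<exists>u. x = \<zeta> m u \<and> u \<in> frontier (block_Q k) \<and> u \<in> (if k = 0 then fixed_part else spike_part)"
proof -
  obtain u where u: "x = \<zeta> m u" "u \<in> frontier (block_Q k)" using K_frontier[OF assms] by blast
  have "u \<in> (if k = 0 then fixed_part else spike_part)"
  proof (cases "k = 0")
    case True then show ?thesis using u(2) frontier_block_Q_0_fixed by auto
  next
    case False then show ?thesis using u(2) block_Q_spike[of k] frontier_block_Q_subset by force
  qed
  then show ?thesis using u by blast
qed

lemma K_cantor_like: "cantor_like (K m k)"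
  using K_cantor cantor_set_iff_cantor_like by blast

text \<open>A relation, because a point may belong to the fixed part and to the spike part; that both
  prescriptions agree there is what makes the map well defined.\<close>
definition prescribed :: "real ^ 'n::{finite,linorder} \<Rightarrow> real ^ 'n::{finite,linorder} \<Rightarrow> bool" where
  "prescribed x x' \<longleftrightarrow> x = 0 \<and> x' = 0 \<or>
     (\<exists>m u. x = \<zeta> m u \<and> (u \<in> fixed_part \<and> x' = \<zeta> m u \<or> u \<in> spike_part \<and> x' = \<zeta> m (flip_h u)))"

lemma prescribed_unique:
  assumes "prescribed x y" "prescribed x z"
  shows "y = z"
proof (cases "x = 0")
  case True
  have "\<zeta> m u \<noteq> 0" if "u \<in> fixed_part \<or> u \<in> spike_part" for m u
    using that fixed_part_big_cube spike_part_big_cube zeta_cube_nonzero by blast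
  then show ?thesis using assms True unfolding prescribed_def by metis
next
  case False
  then obtain m u where mu: "x = \<zeta> m u" "u \<in> fixed_part \<and> y = \<zeta> m u \<or> u \<in> spike_part \<and> y = \<zeta> m (flip_h u)"
    using assms(1) unfolding prescribed_def by blast
  obtain m' u' where mu': "x = \<zeta> m' u'" "u' \<in> fixed_part \<and> z = \<zeta> m' u' \<or> u' \<in> spike_part \<and> z = \<zeta> m' (flip_h u')"
    using assms(2) False unfolding prescribed_def by blast
  have "u \<in> big_cube" "u' \<in> big_cube"
    using mu mu' fixed_part_big_cube spike_part_big_cube(1) by blast+
  then have "m = m'" "u = u'" using zeta_cube_injective mu(1) mu'(1) by metis+
  then show ?thesis using mu mu' flip_h_fixed_spike by metis
qed

lemma prescribed_cantor_map:
  assumes "x \<in> big_cantor \<zeta> K"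
  obtains m u where "x = 0 \<or> x = \<zeta> m u \<and> (\<exists>i. u $ i \<in> \<rat>) \<and> (u \<in> fixed_part \<or> u \<in> spike_part)"
    "\<And>f. cantor_map \<zeta> K f \<Longrightarrow> prescribed x (f x)"
proof -
  consider "x = 0" | m where "x = \<zeta> m 0" | m u where "x = \<zeta> m u" "u \<in> cantor_slice" | m k where "x \<in> K m k"
    using assms unfolding big_cantor_def by blast
  then show ?thesis
  proof cases
    case 1
    then show ?thesis using that by (auto simp: prescribed_def cantor_map_def)
  next
    case (2 m)
    have "prescribed x (f x)" if "cantor_map \<zeta> K f" for f
      using that 2 zero_spike by (auto simp: prescribed_def cantor_map_def flip_h_zero[symmetric])
    moreover have "\<exists>i. (0 :: real ^ 'n::{finite,linorder}) $ i \<in> \<rat>" by simp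
    ultimately show ?thesis using that 2 zero_spike by metis
  next
    case (3 m u)
    have "prescribed x (f x)" if "cantor_map \<zeta> K f" for f
    proof -
      have "f x = x" using that 3 unfolding cantor_map_def by blast
      then show ?thesis using 3 cantor_slice_fixed unfolding prescribed_def by blast
    qed
    moreover have "u $ last_ix \<in> \<rat>" using 3(2) by (simp add: cantor_slice_def)
    ultimately show ?thesis using that 3 cantor_slice_fixed by blast
  next
    case (4 m k)
    then obtain u where u: "x = \<zeta> m u" "u \<in> frontier (block_Q k)" "u \<in> (if k = 0 then fixed_part else spike_part)"
      using K_parts by blast
    have "prescribed x (f x)" if "cantor_map \<zeta> K f" for f
    proof -
      have fx: "f x = \<zeta> m (h_piece k u)" using that 4 u(1) unfolding cantor_map_def by auto
      show ?thesis
      proof (cases "k = 0")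
        case True
        then show ?thesis using u fx unfolding prescribed_def h_piece_def by auto
      next
        case False
        then have "h_piece k u = flip_h u" using u(2) frontier_block_Q_subset by (auto simp: h_piece_def)
        then show ?thesis using u fx False unfolding prescribed_def by auto
      qed
    qed
    moreover have "\<exists>i. u $ i \<in> \<rat>" using u(2) by (rule frontier_block_Q_rational)
    ultimately show ?thesis using that u by metis
  qed
qed

text \<open>Within one cube the similarity cancels and the estimate between fixed points and spike points
  applies; between different cubes the sizes alone suffice.\<close>
lemma prescribed_dist:
  assumes "prescribed x x'" "prescribed y y'"
  shows "dist x' y' \<le> 8 * CARD('n) * dist x y" "dist x y \<le> 8 * CARD('n) * dist x' y'"
proof -
  have L: "8 * real CARD('n) \<ge> 16" using dim by linarith
  have cube: "(x = 0 \<and> x' = 0) \<or> (\<exists>m. x \<in> target_cube m \<and> x' \<in> target_cube m)" if "prescribed x x'" for x x'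
    using that fixed_part_big_cube spike_part_big_cube zeta_in_target unfolding prescribed_def by blast
  have main: "dist x' y' \<le> 8 * CARD('n) * dist x y \<and> dist x y \<le> 8 * CARD('n) * dist x' y'"
    if mv: "prescribed x x'" "prescribed y y'" and tx: "x \<in> target_cube m" "x' \<in> target_cube m"
      and ty: "y = 0 \<and> y' = 0 \<or> (\<exists>m'\<ge>m. y \<in> target_cube m' \<and> y' \<in> target_cube m')" for x x' y y' m
  proof (cases "y \<in> target_cube m \<and> y' \<in> target_cube m")
    case False
    then obtain m' where "m < m'" "y = 0 \<and> y' = 0 \<or> y \<in> target_cube m' \<and> y' \<in> target_cube m'"
      using ty by (metis lessI order_le_less)
    then show ?thesis
      using dist_target_cubes[OF tx, of m' y y'] dist_target_cubes[OF tx(2,1), of m' y' y] by blast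
  next
    case True
    have nz: "v \<in> target_cube m \<Longrightarrow> v \<noteq> 0" for v :: "real ^ 'n::{finite,linorder}"
      using target_cube_bounds(1)[of v m] by (metis less_eq_real_def mult_pos_pos not_le zero_index
          zero_less_divide_1_iff zero_less_numeral zero_less_power)
    have rep: "\<exists>u. v = \<zeta> m u \<and> (u \<in> fixed_part \<and> v' = \<zeta> m u \<or> u \<in> spike_part \<and> v' = \<zeta> m (flip_h u))"
      if v: "prescribed v v'" "v \<in> target_cube m" for v v'
    proof -
      obtain i u where iu: "v = \<zeta> i u" "u \<in> fixed_part \<and> v' = \<zeta> i u \<or> u \<in> spike_part \<and> v' = \<zeta> i (flip_h u)"
        using v nz unfolding prescribed_def by blast
      have "u \<in> big_cube" using iu fixed_part_big_cube spike_part_big_cube(1) by blast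
      moreover obtain w where "w \<in> big_cube" "v = \<zeta> m w" using v(2) cubes by blast
      ultimately have "i = m" using iu(1) zeta_cube_injective by metis
      then show ?thesis using iu by blast
    qed
    obtain u where u: "x = \<zeta> m u" "u \<in> fixed_part \<and> x' = \<zeta> m u \<or> u \<in> spike_part \<and> x' = \<zeta> m (flip_h u)"
      using rep[OF mv(1) tx(1)] by blast
    obtain v where v: "y = \<zeta> m v" "v \<in> fixed_part \<and> y' = \<zeta> m v \<or> v \<in> spike_part \<and> y' = \<zeta> m (flip_h v)"
      using rep[OF mv(2)] True by blast
    define u' where "u' = inv (\<zeta> m) x'"
    define v' where "v' = inv (\<zeta> m) y'"
    have u': "x' = \<zeta> m u'" "u \<in> fixed_part \<and> u' = u \<or> u \<in> spike_part \<and> u' = flip_h u"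
      using u by (auto simp: u'_def)
    have v': "y' = \<zeta> m v'" "v \<in> fixed_part \<and> v' = v \<or> v \<in> spike_part \<and> v' = flip_h v"
      using v by (auto simp: v'_def)
    have d5: "dist u' v' \<le> 5 * dist u v \<and> dist u v \<le> 5 * dist u' v'"
    proof -
      have *: "dist u v \<ge> 0" "dist u' v' \<ge> 0" by auto
      consider "u' = u" "v' = v" | "u' = flip_h u" "v' = flip_h v"
        | "u' = u" "u \<in> fixed_part" "v' = flip_h v" "v \<in> spike_part"
        | "v' = v" "v \<in> fixed_part" "u' = flip_h u" "u \<in> spike_part"
        using u'(2) v'(2) by blast
      then show ?thesis
      proof cases
        case 3
        then show ?thesis
          using dist_fixed_spike[of u v] * by simp_all
      next
        case 4
        then show ?thesis
          using dist_fixed_spike[of v u] * by (simp_all add: dist_commute)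
      qed simp_all
    qed
    obtain c where c: "c > 0" "\<And>x y. dist (\<zeta> m x) (\<zeta> m y) = c * dist x y" using zeta_dist[of m] by blast
    have "dist x' y' \<le> 5 * dist x y" "dist x y \<le> 5 * dist x' y'"
      using d5 c(1) unfolding u(1) v(1) u'(1) v'(1) c(2) by simp_all
    moreover have "5 * dist x y \<le> 8 * CARD('n) * dist x y" "5 * dist x' y' \<le> 8 * CARD('n) * dist x' y'"
      using L by (intro mult_right_mono; simp)+
    ultimately show ?thesis by linarith
  qed
  have "dist x' y' \<le> 8 * CARD('n) * dist x y \<and> dist x y \<le> 8 * CARD('n) * dist x' y'"
  proof -
    consider "x = 0 \<and> x' = 0 \<and> y = 0 \<and> y' = 0"
      | m where "x \<in> target_cube m" "x' \<in> target_cube m" "y = 0 \<and> y' = 0"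
      | m where "y \<in> target_cube m" "y' \<in> target_cube m" "x = 0 \<and> x' = 0"
      | m m' where "x \<in> target_cube m" "x' \<in> target_cube m" "y \<in> target_cube m'" "y' \<in> target_cube m'"
      using cube[OF assms(1)] cube[OF assms(2)] by blast
    then show ?thesis
    proof cases
      case 1 then show ?thesis by simp
    next
      case (2 m) then show ?thesis using main[OF assms 2(1,2)] by blast
    next
      case (3 m) then show ?thesis using main[OF assms(2,1) 3(1,2)] by (simp add: dist_commute)
    next
      case (4 m m')
      show ?thesis
      proof (cases "m \<le> m'")
        case True then show ?thesis using main[OF assms 4(1,2)] 4 by blast
      next
        case False
        then have "m' \<le> m" by simp
        then show ?thesis using main[OF assms(2,1) 4(3,4)] 4 by (metis dist_commute)
      qed
    qed
  qed
  then show "dist x' y' \<le> 8 * CARD('n) * dist x y" "dist x y \<le> 8 * CARD('n) * dist x' y'" by auto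
qed

lemma cantor_map_exists: "\<exists>f. cantor_map \<zeta> K f"
proof -
  define f where "f x = (if \<exists>y. prescribed x y then SOME y. prescribed x y else x)" for x
  have f: "f x = y" if "prescribed x y" for x y
    using that prescribed_unique someI[of "prescribed x" y] unfolding f_def by metis
  have "f 0 = 0" by (rule f) (simp add: prescribed_def)
  moreover have "f (\<zeta> m 0) = \<zeta> m (axis last_ix 2)" for m
    by (rule f) (use zero_spike in \<open>unfold prescribed_def flip_h_zero[symmetric], blast\<close>)
  moreover have "f (\<zeta> m u) = \<zeta> m u" if "u \<in> cantor_slice" for m u
    by (rule f) (use that cantor_slice_fixed in \<open>unfold prescribed_def, blast\<close>)
  moreover have "f x = (\<zeta> m \<circ> h_piece k \<circ> inv (\<zeta> m)) x" if x: "x \<in> K m k" for x m k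
  proof (rule f)
    obtain u where u: "x = \<zeta> m u" "u \<in> frontier (block_Q k)" "u \<in> (if k = 0 then fixed_part else spike_part)"
      using K_parts[OF x] by blast
    then have "u \<in> block_Q k" using frontier_block_Q_subset by blast
    then have "h_piece k u = (if k = 0 then u else flip_h u)" by (simp add: h_piece_def)
    then show "prescribed x ((\<zeta> m \<circ> h_piece k \<circ> inv (\<zeta> m)) x)"
      using u unfolding prescribed_def by (auto split: if_splits)
  qed
  ultimately show ?thesis unfolding cantor_map_def by blast
qed

lemma cantor_map_bi_lipschitz:
  assumes "cantor_map \<zeta> K f"
  shows "bi_lipschitz_on (big_cantor \<zeta> K) f" "inj_on f (big_cantor \<zeta> K)" "continuous_on (big_cantor \<zeta> K) f"
proof -
  have m: "prescribed x (f x)" if "x \<in> big_cantor \<zeta> K" for x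
    using prescribed_cantor_map[OF that] assms by metis
  have "8 * real CARD('n) > 1" using dim by linarith
  from bi_lipschitz_onI[OF this, of "big_cantor \<zeta> K" f] prescribed_dist[OF m m]
  show "bi_lipschitz_on (big_cantor \<zeta> K) f" "inj_on f (big_cantor \<zeta> K)" "continuous_on (big_cantor \<zeta> K) f"
    by auto
qed

definition cube_part :: "nat \<Rightarrow> (real ^ 'n::{finite,linorder}) set" where
  "cube_part m = insert (\<zeta> m 0) (\<Union>k. K m k) \<union> \<zeta> m ` cantor_slice"

lemma big_cantor_eq: "big_cantor \<zeta> K = insert 0 (\<Union>m. cube_part m)"
  unfolding big_cantor_def cube_part_def by blast

lemma slice_cantor_like: "cantor_like (\<zeta> m ` cantor_slice)"
proof -
  have "homeomorphism cantor_slice (\<zeta> m ` cantor_slice) (\<zeta> m) (inv (\<zeta> m))"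
    by (rule homeomorphism_of_subsets[OF zeta_homeo]) auto
  then show ?thesis using cantor_like_slice[OF dim] cantor_like_homeomorphic homeomorphic_def by blast
qed

lemma K_shrink:
  assumes "e > 0"
  shows "\<exists>N. \<forall>k\<ge>N. K m k \<subseteq> ball (\<zeta> m 0) e"
proof -
  obtain c where c: "c > 0" "\<And>x y. dist (\<zeta> m x) (\<zeta> m y) = c * dist x y" using zeta_dist[of m] by blast
  obtain N where N: "\<forall>k\<ge>N. (c * CARD('n) * 2) / 2 ^ k < e"
    using geometric_eventually_small[of 2 e] assms by auto
  have "K m k \<subseteq> ball (\<zeta> m 0) e" if "k \<ge> N" for k
  proof
    fix x assume "x \<in> K m k"
    then obtain u where u: "x = \<zeta> m u" "u \<in> frontier (block_Q k)" using K_parts by blast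
    have "norm u \<le> CARD('n) * (2 / 2 ^ k)"
      using u(2) frontier_block_Q_subset block_Q_component_bound by (intro norm_cart_le) blast
    then have "c * norm u \<le> c * (CARD('n) * (2 / 2 ^ k))" using c(1) by (intro mult_left_mono) auto
    also have "\<dots> < e" using N that by (simp add: mult.assoc)
    finally show "x \<in> ball (\<zeta> m 0) e" by (simp add: u(1) c(2))
  qed
  then show ?thesis by blast
qed

lemma cube_part_compact: "compact (cube_part m)"
  unfolding cube_part_def
  using K_shrink K_cantor_like slice_cantor_like unfolding cantor_like_def
  by (intro compact_Un compact_insert_shrinking_Union) blast+

lemma cube_part_target: "cube_part m \<subseteq> target_cube m"
proof
  fix x assume "x \<in> cube_part m"
  then consider "x = \<zeta> m 0" | "x \<in> \<zeta> m ` cantor_slice" | k where "x \<in> K m k"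
    unfolding cube_part_def by blast
  then have "\<exists>u. x = \<zeta> m u \<and> (u \<in> fixed_part \<or> u \<in> spike_part)"
  proof cases
    case 1 then show ?thesis using zero_spike by blast
  next
    case 2 then show ?thesis using cantor_slice_fixed by blast
  next
    case (3 k) then show ?thesis using K_parts[of x m k] by (auto split: if_splits)
  qed
  then have "x \<in> \<zeta> m ` big_cube" using fixed_part_big_cube spike_part_big_cube(1) by blast
  then show "x \<in> target_cube m" using cubes by blast
qed

lemma big_cantor_compact: "compact (big_cantor \<zeta> K)"
  unfolding big_cantor_eq
proof (rule compact_insert_shrinking_Union)
  fix e :: real assume "e > 0"
  then obtain N where N: "\<forall>m\<ge>N. CARD('n) / 4 ^ m < e"
    using geometric_eventually_small[of 4 e "CARD('n)"] by auto
  have "cube_part m \<subseteq> ball 0 e" if "m \<ge> N" for m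
  proof
    fix x assume "x \<in> cube_part m"
    then have "norm x \<le> CARD('n) * (1 / 4 ^ m)" using cube_part_target target_cube_bounds(3) by blast
    also have "\<dots> < e" using N that by simp
    finally show "x \<in> ball 0 e" by simp
  qed
  then show "\<exists>N. \<forall>m\<ge>N. cube_part m \<subseteq> ball 0 e" by blast
qed (rule cube_part_compact)

lemma big_cantor_totally_disconnected: "totally_disconnected (big_cantor \<zeta> K)"
proof -
  define \<A> where "\<A> = {{0}} \<union> range (\<lambda>m. {\<zeta> m 0}) \<union> range (\<lambda>m. \<zeta> m ` cantor_slice) \<union> range (\<lambda>(m, k). K m k)"
  have "totally_disconnected {a}" for a :: "real ^ 'n::{finite,linorder}"
    by (auto simp: totally_disconnected_def)
  then have "compact A \<and> totally_disconnected A" if "A \<in> \<A>" for A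
    using that K_cantor_like slice_cantor_like by (auto simp: \<A>_def cantor_like_def)
  moreover have "big_cantor \<zeta> K = \<Union>\<A>" by (auto simp: \<A>_def big_cantor_def)
  moreover have "countable \<A>" by (simp add: \<A>_def)
  ultimately show ?thesis
    using totally_disconnected_countable_Union big_cantor_compact compact_imp_closed by metis
qed

lemma big_cantor_no_isolated: "no_isolated_points (big_cantor \<zeta> K)"
  unfolding no_isolated_points_def
proof
  fix x assume "x \<in> big_cantor \<zeta> K"
  then consider "x = 0" | m where "x = \<zeta> m 0" | m where "x \<in> \<zeta> m ` cantor_slice" | m k where "x \<in> K m k"
    unfolding big_cantor_def by blast
  then show "x islimpt big_cantor \<zeta> K"
  proof cases
    case 1
    show ?thesis unfolding islimpt_approachable
    proof (intro allI impI)
      fix e :: real assume "e > 0"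
      then obtain N where N: "CARD('n) / 4 ^ N < e"
        using geometric_eventually_small[of 4 e "CARD('n)"] by auto
      have b: "(0 :: real ^ 'n::{finite,linorder}) \<in> big_cube" by (simp add: big_cube_def)
      then have "norm (\<zeta> N 0) < e" using target_cube_bounds(3)[OF zeta_in_target, of 0 N] N by simp
      moreover have "\<zeta> N 0 \<noteq> 0" using zeta_cube_nonzero[OF b] .
      moreover have "\<zeta> N 0 \<in> big_cantor \<zeta> K" by (auto simp: big_cantor_def)
      ultimately show "\<exists>y\<in>big_cantor \<zeta> K. y \<noteq> x \<and> dist y x < e" using 1 by auto
    qed
  next
    case (2 m)
    show ?thesis unfolding islimpt_approachable
    proof (intro allI impI)
      fix e :: real assume "e > 0"
      then obtain N where N: "\<forall>k\<ge>N. K m k \<subseteq> ball (\<zeta> m 0) e" using K_shrink by blast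
      obtain y where y: "y \<in> K m (Suc N)" using K_cantor_like by (auto simp: cantor_like_def)
      obtain u where u: "y = \<zeta> m u" "u \<in> frontier (block_Q (Suc N))" using K_parts[OF y] by blast
      then have "u \<in> block_Q (Suc N)" using frontier_block_Q_subset by blast
      then have "1 / 2 ^ Suc N \<le> u $ last_ix" by (simp add: block_Q_def)
      moreover have "(0::real) < 1 / 2 ^ Suc N" by simp
      ultimately have "u \<noteq> 0" by (metis not_le zero_index)
      then have "y \<noteq> x" using u(1) 2 by simp
      moreover have "dist y x < e" using N y 2 by (metis dist_commute le_SucI mem_ball order_refl subsetD)
      moreover have "y \<in> big_cantor \<zeta> K" using y by (auto simp: big_cantor_def)
      ultimately show "\<exists>y\<in>big_cantor \<zeta> K. y \<noteq> x \<and> dist y x < e" by blast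
    qed
  next
    case (3 m)
    then have "x islimpt \<zeta> m ` cantor_slice" using slice_cantor_like by (auto simp: cantor_like_def no_isolated_points_def)
    then show ?thesis by (rule islimpt_subset) (auto simp: big_cantor_def)
  next
    case (4 m k)
    then have "x islimpt K m k" using K_cantor_like by (auto simp: cantor_like_def no_isolated_points_def)
    then show ?thesis by (rule islimpt_subset) (auto simp: big_cantor_def)
  qed
qed

lemma big_cantor_is_cantor: "cantor_set (big_cantor \<zeta> K)"
  unfolding cantor_set_iff_cantor_like cantor_like_def
  using big_cantor_compact big_cantor_totally_disconnected big_cantor_no_isolated
  by (auto simp: big_cantor_eq)

text \<open>A similarity is a dilation composed with an orthogonal map and a translation, so the coordinates
  of the preimage are affine functions of the image.\<close>
lemma zeta_hyperplane:
  "\<exists>a b d. a \<noteq> 0 \<and> (\<forall>u. a \<bullet> \<zeta> m u = b + d * u $ i)"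
proof -
  obtain c L where c: "orthogonal_transformation L" "\<And>x. \<zeta> m x = \<zeta> m 0 + c *\<^sub>R L x"
    using similarity_affine[OF sim[of m]] by metis
  define a where "a = L (axis i 1)"
  have "norm a = 1" using c(1) by (simp add: a_def orthogonal_transformation_norm norm_axis_1)
  moreover have "a \<bullet> \<zeta> m u = a \<bullet> \<zeta> m 0 + c * u $ i" for u
  proof -
    have "a \<bullet> L u = axis i 1 \<bullet> u" using c(1) by (simp add: a_def orthogonal_transformation_def)
    then show ?thesis using c(2)[of u] by (simp add: inner_add_right inner_axis' )
  qed
  ultimately show ?thesis by (metis norm_zero zero_neq_one)
qed

lemma cantor_map_ambient:
  assumes f: "cantor_map \<zeta> K f"
  shows "extends_ambiently (big_cantor \<zeta> K) f"
proof -
  obtain a b d where abd: "\<And>m i. a m i \<noteq> 0" "\<And>m i u. a m i \<bullet> \<zeta> m u = b m i + d m i * u $ (i :: 'n)"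
    using zeta_hyperplane by metis
  define H where "H = insert (axis last_ix 1, 0)
    ((\<lambda>(m, i, q). (a m i, b m i + d m i * q)) ` (UNIV \<times> UNIV \<times> \<rat>))"
  have in_H: "x \<in> (\<Union>(a,b)\<in>H. {x. a \<bullet> x = b})"
    if "x = 0 \<or> (\<exists>m u i. x = \<zeta> m u \<and> u $ i \<in> \<rat>)" for x
    using that
  proof
    assume "x = 0" then show ?thesis by (auto simp: H_def)
  next
    assume "\<exists>m u i. x = \<zeta> m u \<and> u $ i \<in> \<rat>"
    then obtain m u i where x: "x = \<zeta> m u" "u $ i \<in> \<rat>" by blast
    have "(a m i, b m i + d m i * u $ i) \<in> H" using x(2) by (force simp: H_def)
    then show ?thesis using x(1) abd(2)[of m i u] by blast
  qed
  have main: "x \<in> (\<Union>(a,b)\<in>H. {x. a \<bullet> x = b}) \<and> f x \<in> (\<Union>(a,b)\<in>H. {x. a \<bullet> x = b})"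
    if x: "x \<in> big_cantor \<zeta> K" for x
  proof -
    obtain m u where mu: "x = 0 \<or> x = \<zeta> m u \<and> (\<exists>i. u $ i \<in> \<rat>) \<and> (u \<in> fixed_part \<or> u \<in> spike_part)"
      and mv: "prescribed x (f x)" using prescribed_cantor_map[OF x] f by metis
    have "f x = 0 \<or> (\<exists>m u i. f x = \<zeta> m u \<and> u $ i \<in> \<rat>)"
    proof (cases "x = 0")
      case True then show ?thesis using f by (simp add: cantor_map_def)
    next
      case False
      then obtain i where i: "x = \<zeta> m u" "u $ i \<in> \<rat>" "u \<in> fixed_part \<or> u \<in> spike_part" using mu by blast
      then have "prescribed x (\<zeta> m u) \<or> prescribed x (\<zeta> m (flip_h u))" unfolding prescribed_def by blast
      then have "f x = \<zeta> m u \<or> f x = \<zeta> m (flip_h u)" using mv prescribed_unique by blast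
      moreover have "2 - u $ i \<in> \<rat>" using i(2) by (intro Rats_diff) auto
      then have "flip_h u $ i \<in> \<rat>" using i(2) by (metis flip_h_component)
      ultimately show ?thesis using i(2) by blast
    qed
    then show ?thesis using in_H mu by blast
  qed
  show ?thesis
  proof (rule ambient_extension[OF _ big_cantor_compact big_cantor_totally_disconnected])
    show "DIM(real ^ 'n::{finite,linorder}) \<ge> 2" using dim by simp
    show "continuous_on (big_cantor \<zeta> K) f" "inj_on f (big_cantor \<zeta> K)"
      using cantor_map_bi_lipschitz[OF f] by auto
    show "countable H" by (auto simp: H_def countable_rat)
    show "big_cantor \<zeta> K \<union> f ` big_cantor \<zeta> K \<subseteq> (\<Union>(a,b)\<in>H. {x. a \<bullet> x = b})" using main by blast
    show "\<And>a b. (a, b) \<in> H \<Longrightarrow> a \<noteq> 0" using abd(1) by (auto simp: H_def axis_eq_0_iff)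
  qed
qed

end

section \<open>Absence of quasisymmetric extensions\<close>

text \<open>If the value at 0 were positive, the path from a zero of \<open>\<eta>\<close> up to large values would take it again.\<close>
lemma half_line_homeomorphism_zero:
  fixes \<eta> \<theta> :: "real \<Rightarrow> real"
  assumes "homeomorphism {0..} {0..} \<eta> \<theta>"
  shows "\<eta> 0 = 0"
proof (rule ccontr)
  assume ne: "\<eta> 0 \<noteq> 0"
  have cont: "continuous_on {0..} \<eta>" and im: "\<eta> ` {0..} = {0..}" and inv: "\<And>x. 0 \<le> x \<Longrightarrow> \<theta> (\<eta> x) = x"
    using assms by (auto simp: homeomorphism_def)
  have "0 \<in> \<eta> ` {0..}" unfolding im by simp
  then obtain t0 where t0: "0 \<le> t0" "\<eta> t0 = 0" by auto
  have "compact (\<eta> ` {0..t0})"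
    by (intro compact_continuous_image continuous_on_subset[OF cont]) auto
  then obtain B where B: "\<And>x. x \<in> {0..t0} \<Longrightarrow> \<bar>\<eta> x\<bar> \<le> B"
    using compact_imp_bounded by (fastforce simp: bounded_iff)
  have "B + 1 \<in> {0..}" using B[of 0] t0 by auto
  then have "B + 1 \<in> \<eta> ` {0..}" unfolding im .
  then obtain t1 where t1: "0 \<le> t1" "\<eta> t1 = B + 1" by auto
  have "t1 \<notin> {0..t0}" using B[of t1] t1 by auto
  then have "t0 < t1" using t1 by auto
  \<comment> \<open>The value at 0 is taken a second time between t0 and t1.\<close>
  have "\<eta> 0 \<in> {0..}" using im by blast
  then have "\<eta> t0 \<le> \<eta> 0" "\<eta> 0 \<le> \<eta> t1" using t0 t1 B[of 0] by auto
  then obtain t where t: "t0 \<le> t" "t \<le> t1" "\<eta> t = \<eta> 0"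
    using IVT'[of \<eta> t0 "\<eta> 0" t1] \<open>t0 < t1\<close> continuous_on_subset[OF cont, of "{t0..t1}"] t0 by auto
  have "t = 0" using inv[of t] inv[of 0] t t0 by simp
  then show False using t t0 ne by simp
qed

lemma half_line_homeomorphism_small:
  fixes \<eta> \<theta> :: "real \<Rightarrow> real"
  assumes "homeomorphism {0..} {0..} \<eta> \<theta>" "e > 0"
  obtains \<delta> where "\<delta> > 0" "\<And>s. 0 \<le> s \<Longrightarrow> s < \<delta> \<Longrightarrow> \<eta> s < e"
proof -
  have "continuous_on {0..} \<eta>" using assms(1) by (simp add: homeomorphism_def)
  then obtain \<delta> where \<delta>: "\<delta> > 0" "\<And>s. s \<in> {0..} \<Longrightarrow> dist s 0 < \<delta> \<Longrightarrow> dist (\<eta> s) (\<eta> 0) < e"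
    using assms(2) unfolding continuous_on_iff by (metis atLeast_iff order_refl)
  then show ?thesis
    using that half_line_homeomorphism_zero[OF assms(1)] by (simp add: dist_real_def) (smt (verit))
qed

lemma half_line_homeomorphism_bounded:
  fixes \<eta> \<theta> :: "real \<Rightarrow> real"
  assumes "homeomorphism {0..} {0..} \<eta> \<theta>"
  obtains M where "M \<ge> 1" "\<And>s. 0 \<le> s \<Longrightarrow> s \<le> B \<Longrightarrow> \<eta> s \<le> M"
proof -
  have "continuous_on {0..} \<eta>" using assms(1) by (simp add: homeomorphism_def)
  then have "compact (\<eta> ` {0..B})" by (intro compact_continuous_image) (auto elim: continuous_on_subset)
  then obtain M where "\<And>s. s \<in> {0..B} \<Longrightarrow> \<bar>\<eta> s\<bar> \<le> M"
    using compact_imp_bounded by (fastforce simp: bounded_iff)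
  then have "\<And>s. 0 \<le> s \<Longrightarrow> s \<le> B \<Longrightarrow> \<eta> s \<le> max 1 M" by fastforce
  then show ?thesis using that[of "max 1 M"] by simp
qed

lemma domain_U_subset: "domain_U \<subseteq> block_Q 0 - (\<Union>k\<in>{1..}. block_Q k)"
  unfolding domain_U_def by (rule interior_subset)

lemma below_in_domain_U:
  assumes "0 < r" "r \<le> 1/2"
  shows "axis last_ix (- r) \<in> (domain_U :: (real ^ 'n::{finite,linorder}) set)"
proof -
  define W where "W = box (\<chi> i. - 1) (\<chi> i. 1) \<inter> {x :: real ^ 'n::{finite,linorder}. x $ last_ix < 0}"
  have "open W" unfolding W_def by (intro open_Int open_box open_halfspace_component_lt_cart)
  moreover have "W \<subseteq> block_Q 0 - (\<Union>k\<in>{1..}. block_Q k)"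
  proof
    fix x assume x: "x \<in> W"
    then have "x \<in> block_Q 0" by (auto simp: W_def block_Q_def mem_box_cart less_imp_le)
    moreover have "x \<notin> block_Q k" if "k \<ge> 1" for k
      using x block_Q_spike[OF that] by (force simp: W_def spike_part_def)
    ultimately show "x \<in> block_Q 0 - (\<Union>k\<in>{1..}. block_Q k)" by auto
  qed
  ultimately have "W \<subseteq> domain_U" unfolding domain_U_def by (rule interior_maximal[rotated])
  moreover have "axis last_ix (- r) \<in> W" using assms by (auto simp: W_def mem_box_cart axis_def)
  ultimately show ?thesis by blast
qed

text \<open>The lateral face lies in the closure of an open box that touches it from outside the spike.\<close>
lemma lateral_face_boundary_X:
  fixes z :: "real ^ 'n::{finite,linorder}"
  assumes "CARD('n) \<ge> 2" "k \<ge> 1" "z \<in> block_Q k" "z $ first_ix = 1 / 4 ^ k"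
  shows "z \<in> frontier (block_Q k) \<inter> boundary_X"
proof
  have ne: "(first_ix :: 'n) \<noteq> last_ix" using first_ix_neq_last_ix[OF assms(1)] .
  define lo :: "real ^ 'n::{finite,linorder}" where
    "lo = (\<chi> i. if i = first_ix then 1 / 4 ^ k else if i = last_ix then 1 / 2 ^ k else - 1)"
  define hi :: "real ^ 'n::{finite,linorder}" where
    "hi = (\<chi> i. if i = last_ix then 2 / 2 ^ k else 1)"
  have "(4::real) ^ 1 \<le> 4 ^ k" "(2::real) ^ 1 \<le> 2 ^ k" using assms(2) by (intro power_increasing; simp)+
  then have k4: "1 / 4 ^ k < (1::real)" "0 < 1 / (4::real) ^ k" and k2: "2 / 2 ^ k \<le> (1::real)" "0 < 1 / (2::real) ^ k"
    by (auto simp: field_simps)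
  have sub: "box lo hi \<subseteq> block_Q 0 - (\<Union>j\<in>{1..}. block_Q j)"
  proof
    fix x assume "x \<in> box lo hi"
    then have x: "lo $ i < x $ i" "x $ i < hi $ i" for i by (auto simp: mem_box_cart)
    have "- 1 \<le> lo $ i" "hi $ i \<le> 1" for i using k4 k2 by (auto simp: lo_def hi_def intro: order_trans[of _ 0])
    then have "- 1 \<le> x $ i \<and> x $ i \<le> 1" for i using x[of i] by (meson less_imp_le order_trans)
    then have "x \<in> block_Q 0" by (simp add: block_Q_def)
    moreover have "x \<notin> block_Q j" if j: "j \<ge> 1" for j
    proof
      assume xj: "x \<in> block_Q j"
      have "x $ first_ix \<le> 1 / 4 ^ j" using xj j ne by (simp add: block_Q_def)
      then have "1 / 4 ^ k < 1 / (4::real) ^ j" using x(1)[of first_ix] by (simp add: lo_def)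
      then have "j < k" by (simp add: field_simps)
      then have "(2::real) ^ Suc j \<le> 2 ^ k" by (intro power_increasing) auto
      then have "2 / 2 ^ k \<le> 1 / (2::real) ^ j" by (simp add: field_simps)
      moreover have "1 / 2 ^ j \<le> x $ last_ix" using xj j by (simp add: block_Q_def)
      moreover have "x $ last_ix < 2 / 2 ^ k" using x(2)[of last_ix] by (simp add: hi_def)
      ultimately show False by linarith
    qed
    ultimately show "x \<in> block_Q 0 - (\<Union>j\<in>{1..}. block_Q j)" by auto
  qed
  then have "box lo hi \<subseteq> domain_U" unfolding domain_U_def by (rule interior_maximal) (rule open_box)
  then have "closure (box lo hi) \<subseteq> closure domain_U" by (rule closure_mono)
  moreover have lohi: "lo $ i < hi $ i" for i
  proof -
    have "1 / 2 ^ k < 2 / (2::real) ^ k" by (rule divide_strict_right_mono) auto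
    then show ?thesis using k4 ne by (auto simp: lo_def hi_def)
  qed
  then have "box lo hi \<noteq> {}" by (simp add: interval_ne_empty_cart)
  then have "closure (box lo hi) = cbox lo hi" by (rule closure_box)
  moreover have "lo $ i \<le> z $ i \<and> z $ i \<le> hi $ i" for i
    using assms(2-4) k4 ne by (cases "i = first_ix"; cases "i = last_ix") (auto simp: lo_def hi_def block_Q_def intro: order_trans[of _ "1 / 4 ^ k"] order_trans[of _ "- (1 / 4 ^ k)"])
  then have "z \<in> cbox lo hi" by (simp add: mem_box_cart)
  ultimately have "z \<in> closure domain_U" by blast
  moreover have "z \<notin> domain_U" using domain_U_subset assms(2,3) by fastforce
  moreover have "interior domain_U = (domain_U :: (real ^ 'n::{finite,linorder}) set)" by (simp add: domain_U_def)
  ultimately show "z \<in> boundary_X" by (simp add: boundary_X_def frontier_def)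
  have "z \<notin> interior (block_Q k)"
    using assms(2,4) ne unfolding block_Q_eq_cbox interior_cbox by (auto simp: mem_box_cart intro!: exI[of _ first_ix])
  then show "z \<in> frontier (block_Q k)" using assms(3) closure_subset by (auto simp: frontier_def)
qed

text \<open>The blocks accumulate only at 0, so the union of the spike blocks with 0 is closed.\<close>
lemma boundary_X_cases:
  fixes z :: "real ^ 'n::{finite,linorder}"
  assumes "z \<in> boundary_X"
  shows "z = 0 \<or> (\<exists>k. z \<in> frontier (block_Q k))"
proof (rule ccontr)
  assume neg: "\<not> ?thesis"
  have opU: "open (domain_U :: (real ^ 'n::{finite,linorder}) set)" by (simp add: domain_U_def)
  have zcl: "z \<in> closure domain_U" and zU: "z \<notin> domain_U"
    using assms opU by (auto simp: boundary_X_def frontier_def interior_open)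
  have V: "compact (insert 0 (\<Union>k. block_Q (Suc k) :: (real ^ 'n::{finite,linorder}) set))"
  proof (rule compact_insert_shrinking_Union)
    fix e :: real assume "e > 0"
    then obtain N where N: "\<forall>k\<ge>N. (real CARD('n) * 2) / 2 ^ k < e"
      using geometric_eventually_small[of 2 e "real CARD('n) * 2"] by auto
    have "block_Q (Suc k) \<subseteq> ball (0 :: real ^ 'n::{finite,linorder}) e" if "k \<ge> N" for k
    proof
      fix u :: "real ^ 'n::{finite,linorder}" assume "u \<in> block_Q (Suc k)"
      then have "norm u \<le> CARD('n) * (2 / 2 ^ Suc k)"
        by (intro norm_cart_le block_Q_component_bound)
      also have "\<dots> < e" using N[rule_format, of "Suc k"] that by simp
      finally show "u \<in> ball 0 e" by simp
    qed
    then show "\<exists>N. \<forall>k\<ge>N. block_Q (Suc k) \<subseteq> ball (0 :: real ^ 'n::{finite,linorder}) e" by blast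
  qed (rule compact_block_Q)
  have "domain_U \<subseteq> (block_Q 0 :: (real ^ 'n::{finite,linorder}) set)" using domain_U_subset by blast
  then have "z \<in> block_Q 0" using zcl closure_minimal[OF _ closed_block_Q] by blast
  then have z0: "z \<in> interior (block_Q 0)" using neg closure_subset by (auto simp: frontier_def)
  have "z \<notin> block_Q (Suc k)" for k
  proof
    assume "z \<in> block_Q (Suc k)"
    then have "z \<in> interior (block_Q (Suc k))" using neg closure_subset by (auto simp: frontier_def)
    moreover have "block_Q (Suc k) \<inter> domain_U = ({} :: (real ^ 'n::{finite,linorder}) set)"
      using domain_U_subset by auto
    then have "interior (block_Q (Suc k)) \<inter> domain_U = ({} :: (real ^ 'n::{finite,linorder}) set)"
      using interior_subset[of "block_Q (Suc k)"] by blast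
    ultimately show False
      using zcl open_Int_closure_eq_empty[OF open_interior] by blast
  qed
  then have zW: "z \<in> interior (block_Q 0) - insert 0 (\<Union>k. block_Q (Suc k))" using z0 neg by auto
  have opW: "open (interior (block_Q 0) - insert 0 (\<Union>k. block_Q (Suc k) :: (real ^ 'n::{finite,linorder}) set))"
    using V by (intro open_Diff compact_imp_closed) auto
  have subW: "interior (block_Q 0) - insert 0 (\<Union>k. block_Q (Suc k)) \<subseteq>
    block_Q 0 - (\<Union>k\<in>{1..}. block_Q k :: (real ^ 'n::{finite,linorder}) set)"
  proof
    fix x :: "real ^ 'n::{finite,linorder}" assume x: "x \<in> interior (block_Q 0) - insert 0 (\<Union>k. block_Q (Suc k))"
    have "x \<notin> block_Q k" if "k \<ge> 1" for k using x that by (cases k) auto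
    then show "x \<in> block_Q 0 - (\<Union>k\<in>{1..}. block_Q k)" using x interior_subset by auto
  qed
  have "z \<in> domain_U" unfolding domain_U_def by (rule subsetD[OF interior_maximal[OF subW opW] zW])
  then show False using zU by simp
qed

text \<open>The smallest admissible index belongs to the widest block at height \<open>\<tau>\<close>. So a point of the k-th
  block that is raised to height \<open>\<tau>\<close> lies in that block as well.\<close>
lemma dyadic_scale:
  fixes \<tau> :: real
  assumes "0 < \<tau>" "\<tau> \<le> 1"
  obtains j where "j \<ge> 1" "1 / 2 ^ j \<le> \<tau>" "\<tau> \<le> 2 / 2 ^ j" "\<And>k. k \<ge> 1 \<Longrightarrow> 1 / 2 ^ k \<le> \<tau> \<Longrightarrow> j \<le> k"
proof -
  define j where "j = (LEAST j. j \<ge> 1 \<and> 1 / 2 ^ j \<le> \<tau>)"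
  obtain N where "(1/2) ^ N < \<tau>" using real_arch_pow_inv[of \<tau> "1/2"] assms by auto
  moreover have "(1/2) ^ Suc N \<le> ((1/2) ^ N :: real)" by (intro power_decreasing) auto
  ultimately have "1 / 2 ^ Suc N \<le> \<tau>" by (simp add: power_one_over)
  then have ex: "Suc N \<ge> 1 \<and> 1 / 2 ^ Suc N \<le> \<tau>" by simp
  have j: "j \<ge> 1 \<and> 1 / 2 ^ j \<le> \<tau>" unfolding j_def by (rule LeastI[of _ "Suc N"]) (rule ex)
  have least: "j \<le> k" if "k \<ge> 1" "1 / 2 ^ k \<le> \<tau>" for k unfolding j_def by (rule Least_le) (use that in blast)
  have "\<tau> \<le> 2 / 2 ^ j"
  proof (cases "j = 1")
    case True then show ?thesis using assms by simp
  next
    case False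
    then obtain i where i: "j = Suc i" "i \<ge> 1" using j by (cases j) auto
    then have "\<not> 1 / 2 ^ i \<le> \<tau>" using least[of i] by auto
    then show ?thesis using i by simp
  qed
  then show ?thesis using that j least by blast
qed

lemma big_cube_dist:
  fixes x y :: "real ^ 'n::{finite,linorder}"
  assumes "x \<in> big_cube" "y \<in> big_cube"
  shows "dist x y \<le> 4 * CARD('n)"
proof -
  have "\<bar>(x - y) $ i\<bar> \<le> 4" for i
  proof -
    have "x $ i \<in> {-2..2}" "y $ i \<in> {-2..2}" using assms by (auto simp: big_cube_def)
    then show ?thesis by (auto simp: abs_le_iff)
  qed
  then show ?thesis using norm_cart_le[of "x - y" 4] by (simp add: dist_norm mult.commute)
qed

lemma component_le_dist: "\<bar>x $ i - y $ i\<bar> \<le> dist x (y :: real ^ 'n)"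
  using component_le_norm_cart[of "x - y" i] by (simp add: dist_norm)

text \<open>An endpoint of the Cantor slice. It is fixed and far from all boundary pieces, which makes it
  the reference point for the modulus of continuity of a quasisymmetric map.\<close>
definition slice_end :: "real ^ 'n::{finite,linorder}" where
  "slice_end = (\<chi> i. if i = first_ix then 1/2 else if i = last_ix then - (1/2) else 0)"

lemma slice_end_in_slice:
  assumes "CARD('n::{finite,linorder}) \<ge> 2"
  shows "(slice_end :: real ^ 'n::{finite,linorder}) \<in> cantor_slice"
proof -
  have "1/2 \<in> centered_ternary_cantor"
    using ternary_cantor_endpoints(2) by (force simp: centered_ternary_cantor_def)
  then show ?thesis using first_ix_neq_last_ix[OF assms] by (auto simp: slice_end_def cantor_slice_def)
qed

lemma frontier_part_dist:
  fixes x p :: "real ^ 'n::{finite,linorder}"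
  assumes "x \<in> frontier (block_Q k)" "\<And>i. \<bar>p $ i\<bar> \<le> 1/2" "p $ last_ix = - r" "r \<ge> 0"
  shows "r \<le> dist x p"
proof (cases "k = 0")
  case True
  then obtain i where "\<bar>x $ i\<bar> = 1" using frontier_block_Q_0 assms(1) by blast
  then have "1/2 \<le> dist x p" using component_le_dist[of x i p] assms(2)[of i] by linarith
  moreover have "r \<le> 1/2" using assms(2)[of last_ix] assms(3,4) by simp
  ultimately show ?thesis by linarith
next
  case False
  then have "0 \<le> x $ last_ix"
    using assms(1) frontier_block_Q_subset block_Q_spike[of k] by (force simp: spike_part_def)
  then show ?thesis using component_le_dist[of x last_ix p] assms(3,4) by linarith
qed

text \<open>The unit-scale contradiction. Let y be the image of the point at depth r below the tip 0.
  Quasisymmetry keeps y away from the image of the boundary by a fixed fraction of its distance d to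
  the image of the tip, while the flipped spike has width of order d squared there. So y lies well
  outside the flipped spike, and the vertical ray above y avoids the image of the boundary. The image of
  the bounded domain then contains the whole ray. All choices depend on the control function only.\<close>
lemma no_model_quasisymmetry:
  fixes \<eta> \<theta> :: "real \<Rightarrow> real"
  assumes n: "CARD('n::{finite,linorder}) \<ge> 2" and \<eta>: "homeomorphism {0..} {0..} \<eta> \<theta>"
  shows "\<exists>\<epsilon>>0. \<forall>(\<Phi> :: real ^ 'n::{finite,linorder} \<Rightarrow> real ^ 'n::{finite,linorder}) P.
    continuous_on UNIV \<Phi> \<longrightarrow> inj \<Phi> \<longrightarrow>
    (\<forall>x a b. x \<noteq> b \<longrightarrow> dist (\<Phi> x) (\<Phi> a) \<le> \<eta> (dist x a / dist x b) * dist (\<Phi> x) (\<Phi> b)) \<longrightarrow>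
    \<Phi> 0 = axis last_ix 2 \<longrightarrow> \<Phi> slice_end = slice_end \<longrightarrow>
    (\<forall>k. \<forall>x\<in>P k. x \<in> frontier (block_Q k) \<and> x \<in> boundary_X \<and> \<Phi> x = (if k = 0 then x else flip_h x)) \<longrightarrow>
    (\<forall>k. \<forall>z\<in>frontier (block_Q k) \<inter> boundary_X. \<exists>x\<in>P k. dist z x < \<epsilon>) \<longrightarrow> False"
proof -
  have ne: "(first_ix :: 'n) \<noteq> last_ix" using first_ix_neq_last_ix[OF n] .
  define tip :: "real ^ 'n::{finite,linorder}" where "tip = axis last_ix 2"
  define q :: "real ^ 'n::{finite,linorder}" where "q = slice_end"
  have q: "\<bar>q $ i\<bar> \<le> 1/2" "q $ last_ix = - (1/2)" for i using ne by (auto simp: q_def slice_end_def)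
  have q_cube: "q \<in> big_cube"
    using slice_end_in_slice[OF n] cantor_slice_fixed fixed_part_big_cube unfolding q_def by blast
  have tip_cube: "tip \<in> big_cube"
    using spike_part_big_cube(2)[OF zero_spike] by (simp add: tip_def flip_h_zero)
  have zero_cube: "(0 :: real ^ 'n::{finite,linorder}) \<in> big_cube"
    using spike_part_big_cube(1)[OF zero_spike] .
  have q_half: "1/2 \<le> dist 0 q" using component_le_dist[of 0 last_ix q] q(2) by simp
  have tip_q: "1 \<le> dist tip q" using component_le_dist[of tip last_ix q] q(2) by (simp add: tip_def axis_def)
  define C where "C = 4 * real CARD('n)"
  have C: "C \<ge> 1" "\<And>x y :: real ^ 'n::{finite,linorder}. x \<in> big_cube \<Longrightarrow> y \<in> big_cube \<Longrightarrow> dist x y \<le> C"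
    using n big_cube_dist by (auto simp: C_def)
  obtain M where M: "M \<ge> 1" "\<And>s. 0 \<le> s \<Longrightarrow> s \<le> 1 \<Longrightarrow> \<eta> s \<le> M"
    using half_line_homeomorphism_bounded[OF \<eta>, of 1] by blast
  \<comment> \<open>The depth r is chosen so that d \<le> 1 / (32 M), which makes M d^2 small against d. Then 1 / N is a
    lower bound for d, and \<epsilon>' bounds the error caused by knowing the map on \<epsilon>-dense sets only.\<close>
  have "1 / (32 * M * C) > 0" using M(1) C(1) by simp
  then obtain \<delta>1 where \<delta>1: "\<delta>1 > 0" "\<And>s. 0 \<le> s \<Longrightarrow> s < \<delta>1 \<Longrightarrow> \<eta> s < 1 / (32 * M * C)"
    using half_line_homeomorphism_small[OF \<eta>] by metis
  define r where "r = min (1/2) (\<delta>1 / 4)"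
  have r: "0 < r" "r \<le> 1/2" "2 * r < \<delta>1" using \<delta>1(1) by (auto simp: r_def)
  obtain N where N: "N \<ge> 1" "\<And>s. 0 \<le> s \<Longrightarrow> s \<le> C / r \<Longrightarrow> \<eta> s \<le> N"
    using half_line_homeomorphism_bounded[OF \<eta>, of "C / r"] by blast
  define \<epsilon>' where "\<epsilon>' = 1 / (32 * M * N)"
  have \<epsilon>': "\<epsilon>' > 0" using M(1) N(1) by (simp add: \<epsilon>'_def)
  then have "\<epsilon>' / C > 0" using C(1) by simp
  then obtain \<delta>2 where \<delta>2: "\<delta>2 > 0" "\<And>s. 0 \<le> s \<Longrightarrow> s < \<delta>2 \<Longrightarrow> \<eta> s < \<epsilon>' / C"
    using half_line_homeomorphism_small[OF \<eta>] by metis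
  define \<epsilon> where "\<epsilon> = min \<epsilon>' (\<delta>2 / 4)"
  have \<epsilon>: "\<epsilon> > 0" "\<epsilon> \<le> \<epsilon>'" "2 * \<epsilon> < \<delta>2" using \<epsilon>' \<delta>2(1) by (auto simp: \<epsilon>_def)
  show ?thesis
  proof (intro exI[of _ \<epsilon>] conjI allI impI)
    show "\<epsilon> > 0" by (rule \<epsilon>(1))
    fix \<Phi> :: "real ^ 'n::{finite,linorder} \<Rightarrow> real ^ 'n::{finite,linorder}" and P
    assume cont: "continuous_on UNIV \<Phi>" and inj: "inj \<Phi>"
      and qs0: "\<forall>x a b. x \<noteq> b \<longrightarrow> dist (\<Phi> x) (\<Phi> a) \<le> \<eta> (dist x a / dist x b) * dist (\<Phi> x) (\<Phi> b)"
      and \<Phi>0: "\<Phi> 0 = axis last_ix 2" and \<Phi>q: "\<Phi> slice_end = slice_end"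
      and P: "\<forall>k. \<forall>x\<in>P k. x \<in> frontier (block_Q k) \<and> x \<in> boundary_X \<and> \<Phi> x = (if k = 0 then x else flip_h x)"
      and dense: "\<forall>k. \<forall>z\<in>frontier (block_Q k) \<inter> boundary_X. \<exists>x\<in>P k. dist z x < \<epsilon>"
    have qs: "dist (\<Phi> x) (\<Phi> a) \<le> B * D"
      if "x \<noteq> b" "\<eta> (dist x a / dist x b) \<le> B" "dist (\<Phi> x) (\<Phi> b) \<le> D" "0 \<le> B" for x a b B D
    proof -
      have "dist (\<Phi> x) (\<Phi> a) \<le> \<eta> (dist x a / dist x b) * dist (\<Phi> x) (\<Phi> b)" using qs0 that(1) by blast
      also have "\<dots> \<le> B * dist (\<Phi> x) (\<Phi> b)" using that(2) by (intro mult_right_mono) auto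
      also have "\<dots> \<le> B * D" using that(3,4) by (rule mult_left_mono)
      finally show ?thesis .
    qed
    define e :: "real ^ 'n::{finite,linorder}" where "e = axis last_ix 1"
    define xr :: "real ^ 'n::{finite,linorder}" where "xr = axis last_ix (- r)"
    define y where "y = \<Phi> xr"
    define d where "d = dist y tip"
    have xr_c: "\<bar>xr $ i\<bar> \<le> 1/2" "xr $ last_ix = - r" for i using r by (auto simp: xr_def axis_def)
    have "xr = (- r) *\<^sub>R axis last_ix 1" by (simp add: xr_def vec_eq_iff axis_def)
    then have norm_xr: "norm xr = r" using r(1) by (simp add: norm_axis_1)
    have d_up: "d \<le> 1 / (32 * M)"
    proof -
      have "dist 0 xr / dist 0 q \<le> 2 * r"
      proof -
        have "r * 1 \<le> r * (2 * dist 0 q)" using q_half r(1) by (intro mult_left_mono) auto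
        then show ?thesis using q_half norm_xr r(1) by (simp add: divide_le_eq)
      qed
      then have "\<eta> (dist 0 xr / dist 0 q) \<le> 1 / (32 * M * C)"
        using \<delta>1(2)[of "dist 0 xr / dist 0 q"] r(3) by simp
      moreover have "dist (\<Phi> 0) (\<Phi> q) \<le> C"
        using C(2)[OF tip_cube q_cube] \<Phi>0 \<Phi>q by (simp add: tip_def q_def)
      moreover have "0 \<noteq> q" using q_half by auto
      ultimately have "dist (\<Phi> 0) (\<Phi> xr) \<le> 1 / (32 * M * C) * C"
        using M(1) C(1) by (intro qs) auto
      also have "\<dots> = 1 / (32 * M)" using C(1) by simp
      finally show ?thesis by (simp add: d_def y_def \<Phi>0 tip_def dist_commute)
    qed
    have d_low: "1 \<le> N * d"
    proof -
      have "dist 0 q / dist 0 xr \<le> C / r"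
        using C(2)[OF zero_cube q_cube] r(1) norm_xr by (simp add: divide_right_mono)
      then have "\<eta> (dist 0 q / dist 0 xr) \<le> N" by (intro N(2)) auto
      moreover have "0 \<noteq> xr" using norm_xr r(1) by auto
      ultimately have "dist (\<Phi> 0) (\<Phi> q) \<le> N * d"
        using N(1) by (intro qs[of 0 xr]) (auto simp: d_def y_def \<Phi>0 tip_def dist_commute)
      then show ?thesis using tip_q by (simp add: \<Phi>0 \<Phi>q tip_def q_def)
    qed
    have d0: "d > 0" using d_low N(1) by (metis mult_eq_0_iff not_one_le_zero zero_le_dist order_le_less d_def)
    have d32: "d \<le> 1/32" using d_up M(1) by (smt (verit) frac_le)
    have \<epsilon>'d: "32 * M * \<epsilon>' \<le> d"
    proof -
      have "32 * M * \<epsilon>' = 1 / N" using M(1) by (simp add: \<epsilon>'_def)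
      also have "\<dots> \<le> d" using d_low N(1) by (simp add: divide_le_eq mult.commute)
      finally show ?thesis .
    qed
    have M\<epsilon>': "\<epsilon>' \<le> M * \<epsilon>'" using M(1) \<epsilon>' by simp
    \<comment> \<open>Errors and squares are negligible against d / M.\<close>
    have numeric: "\<not> d \<le> M * (\<epsilon>' + 2 * (d + \<epsilon>')^2 + \<epsilon>)"
    proof
      assume a: "d \<le> M * (\<epsilon>' + 2 * (d + \<epsilon>')^2 + \<epsilon>)"
      have "d + \<epsilon>' \<le> 2 * d" using \<epsilon>'d M\<epsilon>' \<epsilon>' by linarith
      then have "(d + \<epsilon>')^2 \<le> (2 * d)^2" using d0 \<epsilon>' by (intro power_mono) auto
      then have "M * (d + \<epsilon>')^2 \<le> M * (4 * d^2)" using M(1) by (intro mult_left_mono) (auto simp: power2_eq_square)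
      also have "\<dots> = (32 * M * d) * d / 8" by (simp add: power2_eq_square)
      also have "\<dots> \<le> 1 * d / 8"
      proof -
        have "32 * M * d \<le> 1" using d_up M(1) by (simp add: le_divide_eq mult.commute)
        then show ?thesis using d0 by (intro divide_right_mono mult_right_mono) auto
      qed
      finally have "M * (d + \<epsilon>')^2 \<le> d / 8" by simp
      moreover have "M * \<epsilon> \<le> M * \<epsilon>'" using \<epsilon>(2) M(1) by (intro mult_left_mono) auto
      ultimately show False using a \<epsilon>'d d0 by (simp add: algebra_simps)
    qed
    have P_far: "d \<le> M * dist y (\<Phi> x)" if x: "x \<in> P k" for x k
    proof -
      have "r \<le> dist x xr"
        using P x xr_c r by (intro frontier_part_dist[of x k]) auto
      then have "dist xr 0 / dist xr x \<le> 1" "xr \<noteq> x" using norm_xr r(1) by (auto simp: dist_commute divide_le_eq)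
      then have "dist (\<Phi> xr) (\<Phi> 0) \<le> M * dist (\<Phi> xr) (\<Phi> x)"
        using M by (intro qs) auto
      then show ?thesis by (simp add: d_def y_def \<Phi>0 tip_def)
    qed
    have P_err: "dist (\<Phi> x) (\<Phi> z) \<le> \<epsilon>'" if x: "x \<in> P k" and z: "dist z x < \<epsilon>" for x z k
    proof -
      have xf: "x \<in> frontier (block_Q k)" using P x by blast
      have far: "1/2 \<le> dist x q" using q xf by (intro frontier_part_dist[of x k]) auto
      have "dist x z * 1 \<le> \<epsilon> * (2 * dist x q)" using z far \<epsilon>(1) by (intro mult_mono) (auto simp: dist_commute)
      then have "dist x z / dist x q \<le> 2 * \<epsilon>" using far \<epsilon>(1) by (simp add: divide_le_eq mult.commute mult.left_commute)
      then have "\<eta> (dist x z / dist x q) \<le> \<epsilon>' / C" using \<delta>2(2)[of "dist x z / dist x q"] \<epsilon>(3) by simp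
      moreover have "\<Phi> x \<in> big_cube"
      proof (cases "k = 0")
        case True
        then have "x \<in> fixed_part" "\<Phi> x = x" using P x xf frontier_block_Q_0_fixed by auto
        then show ?thesis using fixed_part_big_cube by auto
      next
        case False
        then have "x \<in> spike_part" "\<Phi> x = flip_h x"
          using P x subsetD[OF frontier_block_Q_subset xf] block_Q_spike[of k] by auto
        then show ?thesis using spike_part_big_cube(2) by simp
      qed
      then have "dist (\<Phi> x) (\<Phi> q) \<le> C" using C(2) q_cube \<Phi>q by (simp add: q_def)
      moreover have "x \<noteq> q" using far by auto
      ultimately have "dist (\<Phi> x) (\<Phi> z) \<le> \<epsilon>' / C * C" using \<epsilon>' C(1) by (intro qs) auto
      then show ?thesis using C(1) by simp
    qed
    have spike: "d \<le> M * (dist y (flip_h p) + 2 * (p $ last_ix)^2 + \<epsilon>)" if j: "j \<ge> 1" and p: "p \<in> block_Q j" for p j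
    proof -
      define z :: "real ^ 'n::{finite,linorder}" where "z = (\<chi> i. if i = first_ix then 1 / 4 ^ j else p $ i)"
      have zi: "z $ i = (if i = first_ix then 1 / 4 ^ j else p $ i)" for i by (simp add: z_def)
      have "z \<in> block_Q j" using p j ne by (simp add: block_Q_def zi)
      then have "z \<in> frontier (block_Q j) \<inter> boundary_X"
        using j by (intro lateral_face_boundary_X n) (simp_all add: zi)
      then obtain x where x: "x \<in> P j" "dist z x < \<epsilon>" using dense by blast
      have "p - z = (p $ first_ix - 1 / 4 ^ j) *\<^sub>R axis first_ix 1"
        by (simp add: vec_eq_iff zi axis_def)
      then have "dist p z = \<bar>p $ first_ix - 1 / 4 ^ j\<bar>" by (simp add: dist_norm norm_axis_1)
      also have "\<dots> \<le> 2 * (1 / 4 ^ j)"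
      proof -
        have "- (1 / 4 ^ j) \<le> p $ first_ix \<and> p $ first_ix \<le> 1 / 4 ^ j" using p j ne by (simp add: block_Q_def)
        then show ?thesis by linarith
      qed
      also have "1 / (4::real) ^ j = (1 / 2 ^ j)^2" by (simp add: power_one_over power_mult_distrib[symmetric] power2_eq_square)
      also have "2 * (1 / 2 ^ j)^2 \<le> 2 * (p $ last_ix)^2"
        using p j by (intro mult_left_mono power_mono) (auto simp: block_Q_def)
      finally have pz: "dist p z \<le> 2 * (p $ last_ix)^2" .
      have "\<Phi> x = flip_h x" using P x(1) j by auto
      then have "dist y (\<Phi> x) \<le> dist y (flip_h p) + dist p x"
        using dist_triangle[of y "flip_h x" "flip_h p"] by simp
      also have "dist p x \<le> dist p z + dist z x" by (rule dist_triangle)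
      finally have "dist y (\<Phi> x) \<le> dist y (flip_h p) + 2 * (p $ last_ix)^2 + \<epsilon>" using pz x(2) by linarith
      then have "M * dist y (\<Phi> x) \<le> M * (dist y (flip_h p) + 2 * (p $ last_ix)^2 + \<epsilon>)"
        using M(1) by (intro mult_left_mono) auto
      then show ?thesis using P_far[OF x(1)] by linarith
    qed
    have far_spike: False if j: "j \<ge> 1" "p \<in> block_Q j" and p: "dist y (flip_h p) \<le> \<epsilon>'" "p $ last_ix \<le> d + \<epsilon>'" for p j
    proof -
      have "0 \<le> p $ last_ix" using j block_Q_spike by (auto simp: spike_part_def)
      then have "(p $ last_ix)^2 \<le> (d + \<epsilon>')^2" using p(2) by (intro power_mono)
      then have "M * (dist y (flip_h p) + 2 * (p $ last_ix)^2 + \<epsilon>) \<le> M * (\<epsilon>' + 2 * (d + \<epsilon>')^2 + \<epsilon>)"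
        using M(1) p(1) by (intro mult_left_mono) auto
      then show False using spike[OF j] numeric by linarith
    qed
    have y_last: "2 - d \<le> y $ last_ix"
      using component_le_dist[of y last_ix tip] by (simp add: d_def tip_def axis_def)
    have e_i: "(y + s *\<^sub>R e) $ i = (if i = last_ix then y $ i + s else y $ i)" for s i
      by (simp add: e_def axis_def)
    have ray: "\<Phi> z \<noteq> y + s *\<^sub>R e" if z: "z \<in> boundary_X" and s: "s \<ge> 0" for z s
    proof
      assume eq: "\<Phi> z = y + s *\<^sub>R e"
      from boundary_X_cases[OF z] show False
      proof
        assume "z = 0"
        then have yt: "y + s *\<^sub>R e = tip" using eq \<Phi>0 by (simp add: tip_def)
        then have "y - tip = - s *\<^sub>R e" by (metis add_diff_cancel_left' minus_diff_eq scaleR_minus_left)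
        then have "s = d" using s by (simp add: d_def dist_norm e_def norm_axis_1)
        then have s1: "0 < s" "s \<le> 1" using d0 d32 by auto
        then obtain j where j: "j \<ge> 1" "1 / 2 ^ j \<le> s" "s \<le> 2 / 2 ^ j" by (rule dyadic_scale)
        have "y = tip - s *\<^sub>R e" using yt by (metis add_diff_cancel_right')
        then have "flip_h y = axis last_ix s"
          by (simp add: vec_eq_iff flip_h_component tip_def e_def axis_def)
        moreover have "axis last_ix s \<in> block_Q j" using j by (simp add: block_Q_def axis_def)
        ultimately have fy: "flip_h y \<in> block_Q j" "flip_h y $ last_ix = s" by (simp_all add: axis_def)
        show False by (rule far_spike[OF j(1) fy(1)]) (use \<open>s = d\<close> fy(2) \<epsilon>' in auto)
      next
        assume "\<exists>k. z \<in> frontier (block_Q k)"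
        then obtain k where "z \<in> frontier (block_Q k)" by blast
        then obtain x where x: "x \<in> P k" "dist z x < \<epsilon>" using dense z by blast
        have close: "dist (y + s *\<^sub>R e) (\<Phi> x) \<le> \<epsilon>'"
          using P_err[OF x] eq by (simp add: dist_commute)
        have xQ: "x \<in> block_Q k" using P x(1) frontier_block_Q_subset by blast
        have \<epsilon>'32: "\<epsilon>' \<le> 1/32" using \<epsilon>'d M\<epsilon>' d32 \<epsilon>' by linarith
        show False
        proof (cases "k = 0")
          case True
          then have "\<Phi> x = x" using P x(1) by auto
          moreover have "x $ last_ix \<le> 1" using xQ True by (simp add: block_Q_def)
          ultimately show False
            using component_le_dist[of "y + s *\<^sub>R e" last_ix "\<Phi> x"] close y_last s d32 \<epsilon>'32
            unfolding e_i by simp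
        next
          case False
          then have k: "k \<ge> 1" and \<Phi>x: "\<Phi> x = flip_h x" using P x(1) by auto
          have xl: "1 / 2 ^ k \<le> x $ last_ix" "x $ last_ix \<le> 1"
            using xQ k block_Q_spike[OF k] by (auto simp: block_Q_def spike_part_def)
          define \<tau> where "\<tau> = max (2 - y $ last_ix) (x $ last_ix)"
          define p :: "real ^ 'n::{finite,linorder}" where "p = (\<chi> i. if i = last_ix then \<tau> else x $ i)"
          have pi: "p $ i = (if i = last_ix then \<tau> else x $ i)" for i by (simp add: p_def)
          have "(0::real) < 1 / 2 ^ k" by simp
          then have "0 < \<tau>" using xl(1) unfolding \<tau>_def by linarith
          moreover have "\<tau> \<le> 1" using xl(2) y_last d32 by (simp add: \<tau>_def)
          ultimately obtain j where j: "j \<ge> 1" "1 / 2 ^ j \<le> \<tau>" "\<tau> \<le> 2 / 2 ^ j"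
            "\<And>i. i \<ge> 1 \<Longrightarrow> 1 / 2 ^ i \<le> \<tau> \<Longrightarrow> j \<le> i" by (rule dyadic_scale) blast
          have "1 / 2 ^ k \<le> \<tau>" using xl(1) by (simp add: \<tau>_def)
          then have "j \<le> k" using j(4) k by blast
          then have "(4::real) ^ j \<le> 4 ^ k" by (intro power_increasing) auto
          then have "1 / 4 ^ k \<le> 1 / (4::real) ^ j" by (simp add: field_simps)
          moreover have "\<bar>x $ i\<bar> \<le> 1 / 4 ^ k" if "i \<noteq> last_ix" for i
            using xQ k that by (auto simp: block_Q_def abs_le_iff)
          ultimately have "\<bar>x $ i\<bar> \<le> 1 / 4 ^ j" if "i \<noteq> last_ix" for i using that by (meson order_trans)
          then have xj: "- (1 / 4 ^ j) \<le> x $ i \<and> x $ i \<le> 1 / 4 ^ j" if "i \<noteq> last_ix" for i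
            using that by (metis abs_le_iff minus_le_iff)
          then have pj: "p \<in> block_Q j" using j by (simp add: block_Q_def pi)
          have "dist y (flip_h p) \<le> dist (y + s *\<^sub>R e) (flip_h x)"
            unfolding dist_norm
          proof (rule norm_le_componentwise_cart)
            fix i
            show "norm ((y - flip_h p) $ i) \<le> norm ((y + s *\<^sub>R e - flip_h x) $ i)"
              using s unfolding vector_minus_component e_i flip_h_component pi
              by (cases "i = last_ix") (simp_all add: \<tau>_def max_def)
          qed
          then have near: "dist y (flip_h p) \<le> \<epsilon>'" using close \<Phi>x by simp
          have "x $ last_ix \<le> d + \<epsilon>'"
            using component_le_dist[of "y + s *\<^sub>R e" last_ix "flip_h x"] close \<Phi>x y_last s
            unfolding e_i flip_h_component by simp
          then have "p $ last_ix \<le> d + \<epsilon>'" using y_last \<epsilon>' by (simp add: pi \<tau>_def)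
          then show False using far_spike[OF j(1) pj near] by blast
        qed
      qed
    qed
    define R where "R = (\<lambda>s. y + s *\<^sub>R e) ` {0..}"
    have opU: "open (domain_U :: (real ^ 'n::{finite,linorder}) set)" by (simp add: domain_U_def)
    have "domain_U \<subseteq> (block_Q 0 :: (real ^ 'n::{finite,linorder}) set)" using domain_U_subset by blast
    then have "bounded (domain_U :: (real ^ 'n::{finite,linorder}) set)"
      using compact_block_Q compact_imp_bounded bounded_subset by blast
    then have cmp: "compact (\<Phi> ` closure domain_U)"
      by (intro compact_continuous_image continuous_on_subset[OF cont]) auto
    have clU: "closure domain_U = domain_U \<union> (boundary_X :: (real ^ 'n::{finite,linorder}) set)"
      by (simp add: boundary_X_def closure_Un_frontier)
    have "R \<inter> \<Phi> ` boundary_X = {}" using ray by (auto simp: R_def) metis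
    then have RR: "R \<inter> \<Phi> ` domain_U = R \<inter> \<Phi> ` closure domain_U" by (auto simp: clU)
    have "open (\<Phi> ` domain_U)"
      using opU inj by (intro invariance_of_domain continuous_on_subset[OF cont]) (auto simp: inj_on_def)
    then have "openin (top_of_set R) (R \<inter> \<Phi> ` domain_U)" by (rule openin_open_Int)
    moreover have "closedin (top_of_set R) (R \<inter> \<Phi> ` domain_U)"
      unfolding RR using cmp by (intro closedin_closed_Int compact_imp_closed)
    moreover have "connected R" unfolding R_def
      by (intro connected_continuous_image continuous_intros) auto
    moreover have "y \<in> R \<inter> \<Phi> ` domain_U"
    proof -
      have "xr \<in> domain_U" using below_in_domain_U r by (simp add: xr_def)
      moreover have "y = y + 0 *\<^sub>R e" by simp
      then have "y \<in> R" unfolding R_def by (metis atLeast_iff image_eqI order_refl)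
      ultimately show ?thesis by (simp add: y_def)
    qed
    ultimately have "R \<inter> \<Phi> ` domain_U = R" using connected_clopen by blast
    then have "bounded R" using RR cmp compact_imp_bounded bounded_subset by (metis inf.cobounded2)
    then obtain B where B: "\<And>v. v \<in> R \<Longrightarrow> norm v \<le> B" by (auto simp: bounded_iff)
    define s where "s = \<bar>B\<bar> + norm y + 1"
    have "s \<ge> 0" by (simp add: s_def)
    then have "y + s *\<^sub>R e \<in> R" unfolding R_def by blast
    then have "norm (y + s *\<^sub>R e) \<le> B" by (rule B)
    moreover have "norm (s *\<^sub>R e) \<le> norm (y + s *\<^sub>R e) + norm y"
      using norm_triangle_ineq4[of "y + s *\<^sub>R e" y] by simp
    moreover have "norm (s *\<^sub>R e) = s" using \<open>s \<ge> 0\<close> by (simp add: e_def norm_axis_1)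
    ultimately have "s \<le> B + norm y" by linarith
    then show False by (simp add: s_def)
  qed
qed

context cube_cantor_family
begin

text \<open>Pulling back two points of the target cube at distance \<open>1/2 * (1/4 ^ m)\<close> bounds the ratio of
  the similarity from below.\<close>
lemma zeta_scale_lower:
  fixes c :: real
  assumes "c > 0" "\<And>x y. dist (\<zeta> m x) (\<zeta> m y) = c * dist x y"
  shows "1 / 4 ^ m \<le> 8 * CARD('n) * c"
proof -
  define p :: "real ^ 'n::{finite,linorder}" where "p = axis first_ix (1 / 4 ^ m)"
  define p' :: "real ^ 'n::{finite,linorder}" where "p' = axis first_ix (1 / 2 * (1 / 4 ^ m))"
  have "1 / (2 * 4 ^ m) \<le> 1 / (4::real) ^ m" by (simp add: field_simps)
  then have "p \<in> target_cube m" "p' \<in> target_cube m"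
    by (auto simp: p_def p'_def target_cube_def axis_def)
  then obtain u u' where u: "u \<in> big_cube" "u' \<in> big_cube" "p = \<zeta> m u" "p' = \<zeta> m u'"
    using cubes by (metis imageE)
  have "p $ first_ix - p' $ first_ix = 1 / 2 * (1 / 4 ^ m)" by (simp add: p_def p'_def axis_def)
  then have "1 / 2 * (1 / 4 ^ m) \<le> dist p p'" using component_le_dist[of p first_ix p'] by linarith
  also have "\<dots> = c * dist u u'" using u assms(2) by simp
  also have "\<dots> \<le> c * (4 * CARD('n))" using big_cube_dist[OF u(1,2)] assms(1) by (intro mult_left_mono) auto
  finally show ?thesis by (simp add: mult.commute mult.left_commute)
qed

text \<open>In the coordinates of the m-th cube the distortion function is unchanged, while the Cantor
  pieces become \<open>\<epsilon>\<close>-dense in the boundary once m is large.\<close>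
lemma no_quasisymmetric_extension:
  assumes f: "cantor_map \<zeta> K f" and F: "quasisymmetric_on UNIV F" "\<forall>x\<in>big_cantor \<zeta> K. F x = f x"
  shows False
proof -
  obtain \<eta> \<theta> where \<eta>: "homeomorphism {0..} {0..} \<eta> \<theta>"
    and qs: "\<And>x a b. x \<noteq> b \<Longrightarrow> dist (F x) (F a) / dist (F x) (F b) \<le> \<eta> (dist x a / dist x b)"
    using F(1) unfolding quasisymmetric_on_def by auto
  obtain F' where F': "homeomorphism UNIV (F ` UNIV) F F'"
    using F(1) by (auto simp: quasisymmetric_on_def embedding_on_def)
  have contF: "continuous_on UNIV F" and injF: "inj F"
    using F' by (auto simp: homeomorphism_def inj_on_def) metis
  obtain \<epsilon> where \<epsilon>: "\<epsilon> > 0" and contra: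
    "\<And>(\<Phi> :: real ^ 'n::{finite,linorder} \<Rightarrow> real ^ 'n::{finite,linorder}) P. continuous_on UNIV \<Phi> \<Longrightarrow> inj \<Phi> \<Longrightarrow>
      \<forall>x a b. x \<noteq> b \<longrightarrow> dist (\<Phi> x) (\<Phi> a) \<le> \<eta> (dist x a / dist x b) * dist (\<Phi> x) (\<Phi> b) \<Longrightarrow>
      \<Phi> 0 = axis last_ix 2 \<Longrightarrow> \<Phi> slice_end = slice_end \<Longrightarrow>
      \<forall>k. \<forall>x\<in>P k. x \<in> frontier (block_Q k) \<and> x \<in> boundary_X \<and> \<Phi> x = (if k = 0 then x else flip_h x) \<Longrightarrow>
      \<forall>k. \<forall>z\<in>frontier (block_Q k) \<inter> boundary_X. \<exists>x\<in>P k. dist z x < \<epsilon> \<Longrightarrow> False"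
    using no_model_quasisymmetry[OF dim \<eta>] by blast
  obtain m where m: "(8 * CARD('n)) / 2 ^ m < \<epsilon>"
    using geometric_eventually_small[of 2 \<epsilon> "8 * CARD('n)"] \<epsilon> by auto
  obtain c where c: "c > 0" "\<And>x y. dist (\<zeta> m x) (\<zeta> m y) = c * dist x y" using zeta_dist[of m] by blast
  have "1 / 8 ^ m = (1 / 2 ^ m) * (1 / (4::real) ^ m)" by (simp add: power_mult_distrib[symmetric])
  also have "\<dots> \<le> (1 / 2 ^ m) * (8 * CARD('n) * c)"
    using zeta_scale_lower[OF c] by (intro mult_left_mono) auto
  also have "\<dots> = (8 * CARD('n)) / 2 ^ m * c" by simp
  also have "\<dots> \<le> \<epsilon> * c" using m c(1) by (intro mult_right_mono) auto
  finally have fine: "1 / 8 ^ m \<le> \<epsilon> * c" .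
  define \<Phi> where "\<Phi> u = inv (\<zeta> m) (F (\<zeta> m u))" for u
  define P where "P k = {u. \<zeta> m u \<in> K m k}" for k
  have \<zeta>\<Phi>: "\<zeta> m (\<Phi> u) = F (\<zeta> m u)" for u by (simp add: \<Phi>_def)
  have d\<Phi>: "dist (\<Phi> u) (\<Phi> v) = dist (F (\<zeta> m u)) (F (\<zeta> m v)) / c" for u v
    using c(2)[of "\<Phi> u" "\<Phi> v"] c(1) by (simp add: \<zeta>\<Phi>)
  show False
  proof (rule contra[of \<Phi> P])
    show "continuous_on UNIV \<Phi>"
    proof -
      have c\<zeta>: "continuous_on UNIV (\<zeta> m)" and ci: "continuous_on UNIV (inv (\<zeta> m))"
        using zeta_homeo[of m] by (simp_all add: homeomorphism_def)
      have "continuous_on UNIV (\<lambda>u. F (\<zeta> m u))" by (rule continuous_on_compose2[OF contF c\<zeta>]) simp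
      then show ?thesis unfolding \<Phi>_def by (rule continuous_on_compose2[OF ci]) simp
    qed
    show "inj \<Phi>"
    proof (rule injI)
      fix u v assume "\<Phi> u = \<Phi> v"
      then have "F (\<zeta> m u) = F (\<zeta> m v)" by (metis \<zeta>\<Phi>)
      then show "u = v" using injF by (simp add: inj_eq)
    qed
    show "\<forall>x a b. x \<noteq> b \<longrightarrow> dist (\<Phi> x) (\<Phi> a) \<le> \<eta> (dist x a / dist x b) * dist (\<Phi> x) (\<Phi> b)"
    proof (intro allI impI)
      fix x a b :: "real ^ 'n::{finite,linorder}" assume "x \<noteq> b"
      then have ne: "\<zeta> m x \<noteq> \<zeta> m b" by simp
      have "dist (F (\<zeta> m x)) (F (\<zeta> m a)) / dist (F (\<zeta> m x)) (F (\<zeta> m b)) \<le> \<eta> (dist x a / dist x b)"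
        using qs[OF ne, of "\<zeta> m a"] c by simp
      moreover have "dist (F (\<zeta> m x)) (F (\<zeta> m b)) > 0" using ne injF by (simp add: inj_eq)
      ultimately have "dist (F (\<zeta> m x)) (F (\<zeta> m a)) \<le> \<eta> (dist x a / dist x b) * dist (F (\<zeta> m x)) (F (\<zeta> m b))"
        by (simp add: divide_le_eq)
      then show "dist (\<Phi> x) (\<Phi> a) \<le> \<eta> (dist x a / dist x b) * dist (\<Phi> x) (\<Phi> b)"
        unfolding d\<Phi> using c(1) by (simp add: divide_right_mono)
    qed
    show "\<Phi> 0 = axis last_ix 2"
    proof -
      have "\<zeta> m 0 \<in> big_cantor \<zeta> K" by (auto simp: big_cantor_def)
      then have "F (\<zeta> m 0) = \<zeta> m (axis last_ix 2)" using F(2) f by (simp add: cantor_map_def)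
      then show ?thesis by (simp add: \<Phi>_def)
    qed
    show "\<Phi> slice_end = slice_end"
    proof -
      have "slice_end \<in> (cantor_slice :: (real ^ 'n::{finite,linorder}) set)" by (rule slice_end_in_slice[OF dim])
      then have "\<zeta> m slice_end \<in> \<zeta> m ` cantor_slice" by blast
      moreover from this have "\<zeta> m slice_end \<in> big_cantor \<zeta> K" by (auto simp: big_cantor_def)
      moreover have "\<forall>x\<in>\<zeta> m ` cantor_slice. f x = x" using f unfolding cantor_map_def by blast
      ultimately have "F (\<zeta> m slice_end) = \<zeta> m slice_end" using F(2) by metis
      then show ?thesis by (simp add: \<Phi>_def)
    qed
    show "\<forall>k. \<forall>x\<in>P k. x \<in> frontier (block_Q k) \<and> x \<in> boundary_X \<and> \<Phi> x = (if k = 0 then x else flip_h x)"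
    proof (intro allI ballI)
      fix k u assume "u \<in> P k"
      then have uK: "\<zeta> m u \<in> K m k" by (simp add: P_def)
      then have u: "u \<in> frontier (block_Q k)" "u \<in> boundary_X" using K_frontier[OF uK] by auto
      have "\<zeta> m u \<in> big_cantor \<zeta> K" using uK by (auto simp: big_cantor_def)
      then have "F (\<zeta> m u) = \<zeta> m (h_piece k u)" using F(2) f uK by (simp add: cantor_map_def)
      moreover have "h_piece k u = (if k = 0 then u else flip_h u)"
        using u(1) frontier_block_Q_subset by (auto simp: h_piece_def)
      ultimately show "u \<in> frontier (block_Q k) \<and> u \<in> boundary_X \<and> \<Phi> u = (if k = 0 then u else flip_h u)"
        using u by (simp add: \<Phi>_def)
    qed
    show "\<forall>k. \<forall>z\<in>frontier (block_Q k) \<inter> boundary_X. \<exists>x\<in>P k. dist z x < \<epsilon>"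
    proof (intro allI ballI)
      fix k and z :: "real ^ 'n::{finite,linorder}" assume z: "z \<in> frontier (block_Q k) \<inter> boundary_X"
      then have "\<zeta> m z \<in> frontier (\<zeta> m ` block_Q k) \<inter> \<zeta> m ` boundary_X"
        by (simp add: homeomorphism_frontier_image[OF zeta_homeo])
      then have "infdist (\<zeta> m z) (K m k) < 1 / 8 ^ (k + m)" by (rule K_dense)
      moreover obtain x where x: "x \<in> K m k" "infdist (\<zeta> m z) (K m k) = dist (\<zeta> m z) x"
        using infdist_attains_inf[of "K m k"] K_cantor_like[of m k] compact_imp_closed
        unfolding cantor_like_def by metis
      moreover have "1 / 8 ^ (k + m) \<le> 1 / (8::real) ^ m"
        by (intro divide_left_mono power_increasing) auto
      ultimately have "dist (\<zeta> m z) x < \<epsilon> * c" using fine by linarith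
      moreover define u where "u = inv (\<zeta> m) x"
      have xu: "x = \<zeta> m u" by (simp add: u_def)
      ultimately have "c * dist z u < c * \<epsilon>" using c(2)[of z u] by (simp add: mult.commute)
      then have "dist z u < \<epsilon>" using c(1) by simp
      moreover have "u \<in> P k" using x(1) xu by (simp add: P_def)
      ultimately show "\<exists>x\<in>P k. dist z x < \<epsilon>" by blast
    qed
  qed
qed

end

theorem mainTheorem5:
  fixes \<zeta> :: "nat \<Rightarrow> real ^ 'n::{finite,linorder} \<Rightarrow> real ^ 'n::{finite,linorder}"
    and K :: "nat \<Rightarrow> nat \<Rightarrow> (real ^ 'n::{finite,linorder}) set"
  assumes "CARD('n) \<ge> 2"
    and "\<And>m. similarity (\<zeta> m)"
    and "\<And>m. \<zeta> m ` big_cube = target_cube m"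
    and "\<And>m k. cantor_set (K m k)"
    and "\<And>m k. uniformly_perfect (K m k)"
    and "\<And>m k. K m k \<subseteq> frontier (\<zeta> m ` block_Q k) \<inter> \<zeta> m ` boundary_X"
    and "\<And>m k x. x \<in> frontier (\<zeta> m ` block_Q k) \<inter> \<zeta> m ` boundary_X \<Longrightarrow> infdist x (K m k) < 1 / 8 ^ (k + m)"
  shows "cantor_set (big_cantor \<zeta> K) \<and>
    (\<exists>f. cantor_map \<zeta> K f) \<and>
    (\<forall>f. cantor_map \<zeta> K f \<longrightarrow>
       bi_lipschitz_on (big_cantor \<zeta> K) f \<and>
       (\<exists>F G. homeomorphism UNIV UNIV F G \<and> (\<forall>x\<in>big_cantor \<zeta> K. F x = f x)) \<and>
       \<not> (\<exists>F :: real ^ 'n::{finite,linorder} \<Rightarrow> real ^ 'n::{finite,linorder}.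
            quasisymmetric_on UNIV F \<and> (\<forall>x\<in>big_cantor \<zeta> K. F x = f x)))"
proof -
  interpret cube_cantor_family \<zeta> K
    by unfold_locales (fact assms)+
  show ?thesis
  proof (intro conjI allI impI)
    show "cantor_set (big_cantor \<zeta> K)" by (rule big_cantor_is_cantor)
    show "\<exists>f. cantor_map \<zeta> K f" by (rule cantor_map_exists)
    fix f assume f: "cantor_map \<zeta> K f"
    show "bi_lipschitz_on (big_cantor \<zeta> K) f" by (rule cantor_map_bi_lipschitz(1)[OF f])
    show "\<exists>F G. homeomorphism UNIV UNIV F G \<and> (\<forall>x\<in>big_cantor \<zeta> K. F x = f x)"
      using cantor_map_ambient[OF f] by (simp add: extends_ambiently_def)
    show "\<not> (\<exists>F. quasisymmetric_on UNIV F \<and> (\<forall>x\<in>big_cantor \<zeta> K. F x = f x))"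
      using no_quasisymmetric_extension[OF f] by blast
  qed
qed

end
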